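(* Let $\alpha\in\mathbb{R}$ and $v\in L^2_{\mathbb{C}}(0,1)$. Then the spectrum of the operator $L_\alpha=L_\alpha(v)$ is discrete, the multiplicity of each eigenvalue is not higher than $2$, and the number of eigenvalues of multiplicity $2$ is finite.
   Context: $\langle f,g\rangle=\int_0^1 f(x)\overline{g(x)}\,dx$ is the inner product on $L^2_{\mathbb{C}}(0,1)$. For $\alpha\in\mathbb{R}$ and $v\in L^2_{\mathbb{C}}(0,1)$, the self-adjoint operator $L_\alpha=L_\alpha(v)$ in $L^2_{\mathbb{C}}(0,1)$ is $$(L_\alpha y)(x)=\mathrm{i}y'''(x)+\alpha\langle y,v\rangle v(x),$$ with domain $\mathcal{D}(L_\alpha)=\{y\in W_3^2(0,1): y(1)=y(0),\ y'(1)=y'(0),\ y''(1)=y''(0)\}$, where $W_3^2(0,1)$ is the Sobolev space of functions with three derivatives in $L^2$. The multiplicity of an eigenvalue is the dimension of its eigenspace. *)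

theory Defs
  imports "HOL-Analysis.Analysis" "HOL-Library.Extended_Nat"
begin

section \<open>The complex Hilbert space $L^2(0,1)$\<close>

abbreviation unit_leb :: "real measure" where
  "unit_leb \<equiv> lebesgue_on {0<..<1}"

definition square_int :: "(real \<Rightarrow> complex) \<Rightarrow> bool" where
  "square_int f \<longleftrightarrow> f \<in> borel_measurable unit_leb \<and> integrable unit_leb (\<lambda>x. (norm (f x))\<^sup>2)"

definition ae_rel :: "(real \<Rightarrow> complex) \<Rightarrow> (real \<Rightarrow> complex) \<Rightarrow> bool" where
  "ae_rel f g \<longleftrightarrow> square_int f \<and> square_int g \<and> (AE x in unit_leb. f x = g x)"

lemma square_int_measurable [measurable_dest]: "square_int f \<Longrightarrow> f \<in> borel_measurable unit_leb"
  by (simp add: square_int_def)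

lemma square_int_zero [simp]: "square_int (\<lambda>_. 0)"
  by (simp add: square_int_def)

lemma square_int_add:
  assumes "square_int f" "square_int g" shows "square_int (\<lambda>x. f x + g x)"
proof -
  have m: "f \<in> borel_measurable unit_leb" "g \<in> borel_measurable unit_leb"
    using assms by (auto simp: square_int_def)
  have "integrable unit_leb (\<lambda>x. 2 * (norm (f x))\<^sup>2 + 2 * (norm (g x))\<^sup>2)"
    using assms unfolding square_int_def by auto
  then have "integrable unit_leb (\<lambda>x. (norm (f x + g x))\<^sup>2)"
  proof (rule Bochner_Integration.integrable_bound)
    show "(\<lambda>x. (norm (f x + g x))\<^sup>2) \<in> borel_measurable unit_leb" using m by measurable
    have "(norm (a + b))\<^sup>2 \<le> 2 * (norm a)\<^sup>2 + 2 * (norm b)\<^sup>2" for a b :: complex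
    proof -
      have "(norm (a + b))\<^sup>2 \<le> (norm a + norm b)\<^sup>2" by (simp add: norm_triangle_ineq power_mono)
      also have "\<dots> \<le> 2 * (norm a)\<^sup>2 + 2 * (norm b)\<^sup>2"
        using sum_squares_bound[of "norm a" "norm b"] by (simp add: power2_sum)
      finally show ?thesis .
    qed
    then show "AE x in unit_leb. norm ((norm (f x + g x))\<^sup>2)
        \<le> norm (2 * (norm (f x))\<^sup>2 + 2 * (norm (g x))\<^sup>2)"
      by (intro AE_I2) (auto intro: order_trans)
  qed
  then show ?thesis using m by (simp add: square_int_def)
qed

lemma square_int_scale: "square_int f \<Longrightarrow> square_int (\<lambda>x. c * f x)"
  by (auto simp: square_int_def norm_mult power_mult_distrib)

lemma square_int_uminus: "square_int f \<Longrightarrow> square_int (\<lambda>x. - f x)"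
  by (auto simp: square_int_def)

lemma square_int_prod:
  assumes "square_int f" "square_int g" shows "integrable unit_leb (\<lambda>x. f x * cnj (g x))"
proof -
  have m: "f \<in> borel_measurable unit_leb" "g \<in> borel_measurable unit_leb"
    using assms by (auto simp: square_int_def)
  have "integrable unit_leb (\<lambda>x. (norm (f x))\<^sup>2 + (norm (g x))\<^sup>2)"
    using assms unfolding square_int_def by auto
  then show ?thesis
  proof (rule Bochner_Integration.integrable_bound)
    show "(\<lambda>x. f x * cnj (g x)) \<in> borel_measurable unit_leb"
      using m by (intro borel_measurable_times borel_measurable_continuous_on[of cnj])
        (auto intro: continuous_intros)
    have "a * b \<le> a\<^sup>2 + b\<^sup>2" if "a \<ge> 0" "b \<ge> 0" for a b :: real
    proof -
      have "0 \<le> a * b" using that by simp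
      then show ?thesis using sum_squares_bound[of a b] by linarith
    qed
    then show "AE x in unit_leb. norm (f x * cnj (g x)) \<le> norm ((norm (f x))\<^sup>2 + (norm (g x))\<^sup>2)"
      by (intro AE_I2) (simp add: norm_mult)
  qed
qed

quotient_type l2 = "real \<Rightarrow> complex" / partial: ae_rel
proof (rule part_equivpI)
  show "\<exists>f. ae_rel f f" by (rule exI[of _ "\<lambda>_. 0"]) (simp add: ae_rel_def)
  show "symp ae_rel" by (rule sympI) (auto simp: ae_rel_def)
  show "transp ae_rel" by (rule transpI) (auto simp: ae_rel_def)
qed

lift_definition cscale :: "complex \<Rightarrow> l2 \<Rightarrow> l2" (infixr "*\<^sub>C" 75) is "\<lambda>c f x. c * f x"
  by (auto simp: ae_rel_def square_int_scale)

lift_definition cinner_l2 :: "l2 \<Rightarrow> l2 \<Rightarrow> complex" is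
  "\<lambda>f g. LINT x|unit_leb. f x * cnj (g x)"
proof -
  fix f f' g g' assume "ae_rel f f'" "ae_rel g g'"
  then have "AE x in unit_leb. f x = f' x" "AE x in unit_leb. g x = g' x"
    and "integrable unit_leb (\<lambda>x. f x * cnj (g x))" "integrable unit_leb (\<lambda>x. f' x * cnj (g' x))"
    by (auto simp: ae_rel_def square_int_prod)
  then show "(LINT x|unit_leb. f x * cnj (g x)) = (LINT x|unit_leb. f' x * cnj (g' x))"
    by (intro integral_cong_AE) auto
qed

instantiation l2 :: real_inner
begin

lift_definition zero_l2 :: l2 is "\<lambda>_. 0"
  by (simp add: ae_rel_def)

lift_definition plus_l2 :: "l2 \<Rightarrow> l2 \<Rightarrow> l2" is "\<lambda>f g x. f x + g x"
  by (auto simp: ae_rel_def square_int_add)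

lift_definition uminus_l2 :: "l2 \<Rightarrow> l2" is "\<lambda>f x. - f x"
  by (auto simp: ae_rel_def square_int_uminus)

definition minus_l2 :: "l2 \<Rightarrow> l2 \<Rightarrow> l2" where "minus_l2 f g = f + - g"

definition scaleR_l2 :: "real \<Rightarrow> l2 \<Rightarrow> l2" where "scaleR_l2 r f = complex_of_real r *\<^sub>C f"

definition inner_l2 :: "l2 \<Rightarrow> l2 \<Rightarrow> real" where "inner_l2 f g = Re (cinner_l2 f g)"

definition norm_l2 :: "l2 \<Rightarrow> real" where "norm_l2 f = sqrt (inner f f)"

definition dist_l2 :: "l2 \<Rightarrow> l2 \<Rightarrow> real" where "dist_l2 f g = norm (f - g)"

definition sgn_l2 :: "l2 \<Rightarrow> l2" where "sgn_l2 f = scaleR (inverse (norm f)) f"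

definition uniformity_l2 :: "(l2 \<times> l2) filter" where
  "uniformity_l2 = (INF e\<in>{0 <..}. principal {(x, y). dist x y < e})"

definition open_l2 :: "l2 set \<Rightarrow> bool" where
  "open_l2 U \<longleftrightarrow> (\<forall>x\<in>U. eventually (\<lambda>(x', y). x' = x \<longrightarrow> y \<in> U) uniformity)"

lemma cinner_l2_add: "cinner_l2 (f + g) h = cinner_l2 f h + cinner_l2 g h"
  by transfer (auto simp: ae_rel_def distrib_right square_int_prod)

lemma cinner_l2_scale: "cinner_l2 (c *\<^sub>C f) h = c * cinner_l2 f h"
  by transfer (simp add: mult.assoc)

lemma cinner_l2_commute: "cinner_l2 f g = cnj (cinner_l2 g f)"
proof transfer
  fix f g assume "ae_rel f f" "ae_rel g g"
  have "cnj (LINT x|unit_leb. g x * cnj (f x)) = (LINT x|unit_leb. cnj (g x * cnj (f x)))"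
    by (rule Bochner_Integration.integral_cnj[symmetric])
  then show "(LINT x|unit_leb. f x * cnj (g x)) = cnj (LINT x|unit_leb. g x * cnj (f x))"
    by (simp only: complex_cnj_mult complex_cnj_cnj mult.commute)
qed

lemma inner_l2_self:
  assumes "square_int f"
  shows "Re (LINT x|unit_leb. f x * cnj (f x)) = (LINT x|unit_leb. (norm (f x))\<^sup>2)"
proof -
  have "(LINT x|unit_leb. f x * cnj (f x)) = (LINT x|unit_leb. complex_of_real ((norm (f x))\<^sup>2))"
    by (simp only: complex_norm_square)
  also have "\<dots> = complex_of_real (LINT x|unit_leb. (norm (f x))\<^sup>2)"
    by (rule integral_complex_of_real)
  finally show ?thesis by simp
qed

instance
proof
  fix a b c :: l2 and r s :: real
  show "a + b + c = a + (b + c)" by transfer (auto simp: ae_rel_def add.assoc square_int_add)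
  show "a + b = b + a" by transfer (auto simp: ae_rel_def add.commute square_int_add)
  show "0 + a = a" by transfer (auto simp: ae_rel_def)
  show "- a + a = 0" by transfer (auto simp: ae_rel_def)
  show "a - b = a + - b" by (rule minus_l2_def)
  show "r *\<^sub>R (a + b) = r *\<^sub>R a + r *\<^sub>R b" unfolding scaleR_l2_def
    by transfer (auto simp: ae_rel_def distrib_left square_int_add square_int_scale)
  show "(r + s) *\<^sub>R a = r *\<^sub>R a + s *\<^sub>R a" unfolding scaleR_l2_def of_real_add
    by transfer (simp add: ae_rel_def distrib_right square_int_add square_int_scale)
  show "r *\<^sub>R s *\<^sub>R a = (r * s) *\<^sub>R a" unfolding scaleR_l2_def of_real_mult
    by transfer (simp add: ae_rel_def mult.assoc square_int_scale)
  show "1 *\<^sub>R a = a" unfolding scaleR_l2_def of_real_1 by transfer (auto simp: ae_rel_def)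
  show "dist a b = norm (a - b)" by (rule dist_l2_def)
  show "sgn a = scaleR (inverse (norm a)) a" by (rule sgn_l2_def)
  show "uniformity = (INF e\<in>{0 <..}. principal {(x, y::l2). dist x y < e})" by (rule uniformity_l2_def)
  show "open U \<longleftrightarrow> (\<forall>x\<in>U. eventually (\<lambda>(x', y). x' = x \<longrightarrow> y \<in> U) uniformity)" for U :: "l2 set"
    by (rule open_l2_def)
  show "norm a = sqrt (inner a a)" by (rule norm_l2_def)
  show "inner a b = inner b a" unfolding inner_l2_def by (subst cinner_l2_commute) simp
  show "inner (a + b) c = inner a c + inner b c" by (simp add: inner_l2_def cinner_l2_add)
  show "inner (r *\<^sub>R a) b = r * inner a b"
    by (simp add: inner_l2_def scaleR_l2_def cinner_l2_scale)
  show "0 \<le> inner a a" unfolding inner_l2_def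
    by transfer (simp add: ae_rel_def inner_l2_self)
  show "inner a a = 0 \<longleftrightarrow> a = 0" unfolding inner_l2_def
  proof transfer
    fix f assume "ae_rel f f"
    then have f: "square_int f" by (simp add: ae_rel_def)
    then have "(LINT x|unit_leb. (norm (f x))\<^sup>2) = 0 \<longleftrightarrow> (AE x in unit_leb. (norm (f x))\<^sup>2 = 0)"
      by (intro integral_nonneg_eq_0_iff_AE) (auto simp: square_int_def)
    then show "(Re (LINT x|unit_leb. f x * cnj (f x)) = 0) = ae_rel f (\<lambda>_. 0)"
      using f by (simp add: inner_l2_self ae_rel_def)
  qed
qed

end

interpretation l2: vector_space cscale
proof
  fix a b :: complex and x y :: l2
  show "a *\<^sub>C (x + y) = a *\<^sub>C x + a *\<^sub>C y"
    by transfer (auto simp: ae_rel_def distrib_left square_int_add square_int_scale)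
  show "(a + b) *\<^sub>C x = a *\<^sub>C x + b *\<^sub>C x"
    by transfer (auto simp: ae_rel_def distrib_right square_int_add square_int_scale)
  show "a *\<^sub>C b *\<^sub>C x = (a * b) *\<^sub>C x"
    by transfer (auto simp: ae_rel_def mult.assoc square_int_scale)
  show "1 *\<^sub>C x = x" by transfer (auto simp: ae_rel_def)
qed


section \<open>The Sobolev space and boundary values\<close>

text \<open>The \<open>C\<^sup>1\<close> test functions with compact support are those of Brezis, Functional Analysis,
  Sobolev Spaces and Partial Differential Equations, Section 8.2; they give the same weak
  derivatives as the smooth ones.\<close>

definition test_function :: "(real \<Rightarrow> real) \<Rightarrow> bool" where
  "test_function \<phi> \<longleftrightarrow> \<phi> C1_differentiable_on UNIV \<and>
     (\<exists>K. compact K \<and> K \<subseteq> {0<..<1} \<and> (\<forall>x. x \<notin> K \<longrightarrow> \<phi> x = 0))"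

lift_definition has_weak_deriv :: "l2 \<Rightarrow> l2 \<Rightarrow> bool" is
  "\<lambda>f g. \<forall>\<phi>. test_function \<phi> \<longrightarrow>
     (LINT x|unit_leb. f x * of_real (deriv \<phi> x)) = - (LINT x|unit_leb. g x * of_real (\<phi> x))"
proof -
  fix f f' g g' assume "ae_rel f f'" "ae_rel g g'"
  then have ae: "AE x in unit_leb. f x = f' x" "AE x in unit_leb. g x = g' x"
    and m: "f \<in> borel_measurable unit_leb" "f' \<in> borel_measurable unit_leb"
      "g \<in> borel_measurable unit_leb" "g' \<in> borel_measurable unit_leb"
    by (auto simp: ae_rel_def square_int_def)
  have "(LINT x|unit_leb. f x * of_real (deriv \<phi> x)) = (LINT x|unit_leb. f' x * of_real (deriv \<phi> x))
      \<and> (LINT x|unit_leb. g x * of_real (\<phi> x)) = (LINT x|unit_leb. g' x * of_real (\<phi> x))"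
    if tf: "test_function \<phi>" for \<phi>
  proof -
    obtain D where D: "\<And>x. (\<phi> has_vector_derivative D x) (at x)" "continuous_on UNIV D"
      using tf unfolding test_function_def C1_differentiable_on_def by auto
    have "deriv \<phi> = D"
      using D(1) by (auto intro!: DERIV_imp_deriv simp: has_real_derivative_iff_has_vector_derivative)
    then have c: "continuous_on UNIV (deriv \<phi>)" "continuous_on UNIV \<phi>"
      using D by (auto simp: continuous_on_eq_continuous_at intro: has_vector_derivative_continuous)
    have "(\<lambda>x. complex_of_real (h x)) \<in> borel_measurable unit_leb"
      if "continuous_on UNIV h" for h :: "real \<Rightarrow> real"
    proof -
      have "(\<lambda>x. complex_of_real (h x)) \<in> borel_measurable borel"
        using that by (intro borel_measurable_continuous_onI continuous_intros) auto
      then show ?thesis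
        by (intro measurable_restrict_space1 measurable_completion) simp
    qed
    note m' = this[OF c(1)] this[OF c(2)]
    show ?thesis using ae m m'
      by (intro conjI integral_cong_AE borel_measurable_times) auto
  qed
  then show "(\<forall>\<phi>. test_function \<phi> \<longrightarrow>
      (LINT x|unit_leb. f x * of_real (deriv \<phi> x)) = - (LINT x|unit_leb. g x * of_real (\<phi> x))) =
    (\<forall>\<phi>. test_function \<phi> \<longrightarrow>
      (LINT x|unit_leb. f' x * of_real (deriv \<phi> x)) = - (LINT x|unit_leb. g' x * of_real (\<phi> x)))"
    by auto
qed

definition weak_deriv :: "l2 \<Rightarrow> l2" where
  "weak_deriv y = (THE g. has_weak_deriv y g)"

fun sobolev :: "nat \<Rightarrow> l2 set" where
  "sobolev 0 = UNIV"
| "sobolev (Suc k) = {y. \<exists>g. has_weak_deriv y g \<and> g \<in> sobolev k}"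

text \<open>The value at a point of \<open>[0,1]\<close> of an element of \<open>L\<^sup>2(0,1)\<close> is that of its representative
  continuous on the closed interval. This is meaningful only for elements that have such a
  representative; it is then unique. All elements of \<open>sobolev 1\<close> do.\<close>

lift_definition represents :: "(real \<Rightarrow> complex) \<Rightarrow> l2 \<Rightarrow> bool" is
  "\<lambda>f g. AE x in unit_leb. f x = g x"
  by (auto simp: ae_rel_def)

definition point_value :: "l2 \<Rightarrow> real \<Rightarrow> complex" where
  "point_value y x = (THE c. \<exists>f. continuous_on {0..1} f \<and> represents f y \<and> f x = c)"


section \<open>Unbounded operators on $L^2(0,1)$\<close>

text \<open>An operator is given by its domain \<open>D\<close> and a map \<open>A\<close>, whose values outside \<open>D\<close> are
  irrelevant.\<close>

definition resolvent_set :: "l2 set \<Rightarrow> (l2 \<Rightarrow> l2) \<Rightarrow> complex set" where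
  "resolvent_set D A = {z. bij_betw (\<lambda>y. A y - z *\<^sub>C y) D UNIV \<and>
     (\<exists>C. \<forall>y\<in>D. norm y \<le> C * norm (A y - z *\<^sub>C y))}"

definition spectrum :: "l2 set \<Rightarrow> (l2 \<Rightarrow> l2) \<Rightarrow> complex set" where
  "spectrum D A = - resolvent_set D A"

definition eigenspace :: "l2 set \<Rightarrow> (l2 \<Rightarrow> l2) \<Rightarrow> complex \<Rightarrow> l2 set" where
  "eigenspace D A z = {y \<in> D. A y = z *\<^sub>C y}"

definition eigenvalue :: "l2 set \<Rightarrow> (l2 \<Rightarrow> l2) \<Rightarrow> complex \<Rightarrow> bool" where
  "eigenvalue D A z \<longleftrightarrow> (\<exists>y\<in>eigenspace D A z. y \<noteq> 0)"

text \<open>\<open>l2.dim\<close> is the complex dimension; it is \<open>0\<close> by convention for infinite-dimensional spaces,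
  hence the case distinction.\<close>

definition eig_multiplicity :: "l2 set \<Rightarrow> (l2 \<Rightarrow> l2) \<Rightarrow> complex \<Rightarrow> enat" where
  "eig_multiplicity D A z =
     (if \<exists>B. finite B \<and> eigenspace D A z \<subseteq> l2.span B then enat (l2.dim (eigenspace D A z)) else \<infinity>)"

text \<open>The spectrum is discrete if it consists of isolated eigenvalues of finite multiplicity.
  Since the spectrum of a closed operator is closed, its points are all isolated
  iff it has no limit point in the plane.\<close>

definition discrete_spectrum :: "l2 set \<Rightarrow> (l2 \<Rightarrow> l2) \<Rightarrow> bool" where
  "discrete_spectrum D A \<longleftrightarrow> (\<forall>z. \<not> z islimpt spectrum D A) \<and>
     (\<forall>z\<in>spectrum D A. eigenvalue D A z \<and> eig_multiplicity D A z < \<infinity>)"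


section \<open>The operator\<close>

definition L_dom :: "l2 set" where
  "L_dom = {y \<in> sobolev 3.
     point_value y 1 = point_value y 0 \<and>
     point_value (weak_deriv y) 1 = point_value (weak_deriv y) 0 \<and>
     point_value (weak_deriv (weak_deriv y)) 1 = point_value (weak_deriv (weak_deriv y)) 0}"

definition L_op :: "real \<Rightarrow> l2 \<Rightarrow> l2 \<Rightarrow> l2" where
  "L_op \<alpha> v y = \<i> *\<^sub>C weak_deriv (weak_deriv (weak_deriv y)) + (of_real \<alpha> * cinner_l2 y v) *\<^sub>C v"

end

theory Submission imports Defs
begin

text \<open>The Fourier modes \<open>e\<^sub>n\<close> diagonalize the unperturbed operator \<open>A = i D\<^sup>3\<close>, with the
  simple eigenvalues \<open>(2 \<pi> n)\<^sup>3\<close>, which tend to infinity and whose distance from each other is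
  at least of order \<open>n\<^sup>2\<close>. The operator \<open>L = A + \<alpha> \<langle>\<cdot>, v\<rangle> v\<close> is inverted explicitly by the
  rank-one perturbation formula wherever it is injective. An eigenspace of \<open>L\<close> meets the orthogonal
  complement of \<open>v\<close>, which has codimension at most one, in a subspace of an eigenspace of \<open>A\<close>; so
  its dimension is at most two. If it is two, the eigenvalue is some \<open>(2 \<pi> n)\<^sup>3\<close>, and an
  eigenvector \<open>w\<close> orthogonal to \<open>e\<^sub>n\<close> satisfies
  \<open>c n\<^sup>2 \<parallel>w\<parallel> \<le> \<parallel>(A - (2 \<pi> n)\<^sup>3) w\<parallel> \<le> \<bar>\<alpha>\<bar> \<parallel>v\<parallel>\<^sup>2 \<parallel>w\<parallel>\<close>, which bounds \<open>n\<close>.\<close>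

section \<open>Square-integrable functions on the unit interval\<close>

text \<open>The domain is described by weak derivatives and boundary values, whereas the argument
  runs on Fourier coefficients. The bridge is that periodicity turns a weak derivative into
  multiplication of the \<open>n\<close>-th coefficient by \<open>2 pi i n\<close>. Two things have
  to be earned for it: totality, so that equal coefficients mean equal elements, and synthesis, the
  existence of an element with given coefficients. Synthesis goes through uniform convergence and so
  asks for absolutely summable coefficients. These are available because \<open>mode_eig\<close>
  grows at least like \<open>n^2\<close>: bounded coefficients divided by
  \<open>mode_eig n - z\<close> are summable. The rank-one formula presupposes that
  \<open>A - z\<close> is invertible; at an unperturbed eigenvalue it gives way to a correction
  along the mode. Both cases show only that each spectral point is an eigenvalue. That spectral
  points do not accumulate is a separate matter, settled by counting how much mass orthonormal
  eigenvectors can place on finitely many modes.\<close>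

lemma ae_rel_self [simp]: "ae_rel f f \<longleftrightarrow> square_int f"
  by (simp add: ae_rel_def)

lemma l2_cases:
  obtains f where "square_int f" "y = abs_l2 f"
proof
  show "square_int (rep_l2 y)"
    using Quotient_rep_reflp[OF Quotient_l2, of y] by simp
  show "y = abs_l2 (rep_l2 y)"
    using Quotient_abs_rep[OF Quotient_l2, of y] by simp
qed

lemma abs_l2_eq_iff:
  assumes "square_int f" "square_int g"
  shows "abs_l2 f = abs_l2 g \<longleftrightarrow> (AE x in unit_leb. f x = g x)"
  using Quotient_rel[OF Quotient_l2, of f g] assms by (simp add: ae_rel_def)

lemma abs_l2_add: "square_int f \<Longrightarrow> square_int g \<Longrightarrow> abs_l2 f + abs_l2 g = abs_l2 (\<lambda>x. f x + g x)"
  by (simp add: plus_l2.abs_eq)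

lemma abs_l2_cscale: "square_int f \<Longrightarrow> c *\<^sub>C abs_l2 f = abs_l2 (\<lambda>x. c * f x)"
  by (simp add: cscale.abs_eq)

lemma abs_l2_uminus: "square_int f \<Longrightarrow> - abs_l2 f = abs_l2 (\<lambda>x. - f x)"
  by (simp add: uminus_l2.abs_eq)

lemma abs_l2_diff: "square_int f \<Longrightarrow> square_int g \<Longrightarrow> abs_l2 f - abs_l2 g = abs_l2 (\<lambda>x. f x - g x)"
  by (simp add: minus_l2_def abs_l2_add abs_l2_uminus square_int_uminus)

lemma square_int_diff: "square_int f \<Longrightarrow> square_int g \<Longrightarrow> square_int (\<lambda>x. f x - g x)"
  using square_int_add[of f "\<lambda>x. - g x"] square_int_uminus[of g] by simp

lemma cinner_abs_l2:
  "square_int f \<Longrightarrow> square_int g \<Longrightarrow> cinner_l2 (abs_l2 f) (abs_l2 g) = (LINT x|unit_leb. f x * cnj (g x))"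
  by (simp add: cinner_l2.abs_eq)

lemma has_weak_deriv_abs_l2:
  "square_int f \<Longrightarrow> square_int g \<Longrightarrow> has_weak_deriv (abs_l2 f) (abs_l2 g) \<longleftrightarrow> (\<forall>\<phi>. test_function \<phi> \<longrightarrow>
     (LINT x|unit_leb. f x * of_real (deriv \<phi> x)) = - (LINT x|unit_leb. g x * of_real (\<phi> x)))"
  by (simp add: has_weak_deriv.abs_eq)

lemma represents_abs_l2: "square_int g \<Longrightarrow> represents f (abs_l2 g) \<longleftrightarrow> (AE x in unit_leb. f x = g x)"
  by (simp add: represents.abs_eq)

lemma zero_abs_l2: "0 = abs_l2 (\<lambda>_. 0)"
  by (simp add: zero_l2_def)

lemma finite_measure_unit_leb: "finite_measure unit_leb"
  by (rule finite_measure_lebesgue_on) simp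

lemma measure_unit_leb [simp]: "measure unit_leb {0<..<1} = 1"
  by (simp add: measure_restrict_space)

lemma borel_measurable_unit_leb:
  assumes "f \<in> borel_measurable borel" shows "f \<in> borel_measurable unit_leb"
  using assms by (intro measurable_restrict_space1 measurable_completion) simp

lemma continuous_measurable_unit_leb:
  fixes f :: "real \<Rightarrow> 'a::euclidean_space"
  assumes "continuous_on {0<..<1} f" shows "f \<in> borel_measurable unit_leb"
  using assms by (intro continuous_imp_measurable_on_sets_lebesgue) auto

lemma integrable_bounded_unit_leb:
  fixes f :: "real \<Rightarrow> 'a::{banach,second_countable_topology}"
  assumes "f \<in> borel_measurable unit_leb" "\<And>x. x \<in> {0<..<1} \<Longrightarrow> norm (f x) \<le> B"
  shows "integrable unit_leb f"
  using assms by (intro finite_measure.integrable_const_bound[OF finite_measure_unit_leb, of _ B] AE_I2) auto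

lemma square_int_bounded:
  assumes "f \<in> borel_measurable unit_leb" "\<And>x. x \<in> {0<..<1} \<Longrightarrow> norm (f x) \<le> B"
  shows "square_int f"
  unfolding square_int_def
  using assms by (auto intro!: integrable_bounded_unit_leb[where B="B\<^sup>2"] simp: power_mono)

lemma continuous_bounded_unit:
  fixes f :: "real \<Rightarrow> 'a::real_normed_vector"
  assumes "continuous_on {0..1} f"
  obtains B where "\<And>x. x \<in> {0..1} \<Longrightarrow> norm (f x) \<le> B"
proof -
  have "bounded (f ` {0..1})"
    using assms by (intro compact_imp_bounded compact_continuous_image) auto
  then obtain B where "\<forall>y\<in>f ` {0..1}. norm y \<le> B" unfolding bounded_iff by blast
  then show ?thesis using that[of B] by blast
qed

lemma continuous_integrable_unit_leb:
  fixes f :: "real \<Rightarrow> 'a::euclidean_space"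
  assumes "continuous_on {0..1} f" shows "integrable unit_leb f"
proof -
  obtain B where "\<And>x. x \<in> {0..1} \<Longrightarrow> norm (f x) \<le> B"
    using continuous_bounded_unit[OF assms] by blast
  then show ?thesis
    using assms by (intro integrable_bounded_unit_leb[where B=B] continuous_measurable_unit_leb)
      (auto intro: continuous_on_subset)
qed

lemma square_int_continuous:
  assumes "continuous_on {0..1} f" shows "square_int f"
proof -
  obtain B where "\<And>x. x \<in> {0..1} \<Longrightarrow> norm (f x) \<le> B"
    using continuous_bounded_unit[OF assms] by blast
  then show ?thesis
    using assms by (intro square_int_bounded[where B=B] continuous_measurable_unit_leb)
      (auto intro: continuous_on_subset)
qed

lemma square_int_integrable: "square_int f \<Longrightarrow> integrable unit_leb f"
  using square_int_prod[of f "\<lambda>_. 1"] square_int_continuous[of "\<lambda>_. 1"] by simp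

lemma integrable_mult_bounded:
  fixes f h :: "real \<Rightarrow> complex"
  assumes "integrable unit_leb f" "h \<in> borel_measurable unit_leb" "\<And>x. x \<in> {0<..<1} \<Longrightarrow> norm (h x) \<le> B"
  shows "integrable unit_leb (\<lambda>x. f x * h x)"
proof (rule Bochner_Integration.integrable_bound)
  show "integrable unit_leb (\<lambda>x. B * norm (f x))" using assms(1) by auto
  show "(\<lambda>x. f x * h x) \<in> borel_measurable unit_leb"
    using assms by (intro borel_measurable_times) auto
  show "AE x in unit_leb. norm (f x * h x) \<le> norm (B * norm (f x))"
  proof (rule AE_I2)
    fix x :: real assume x: "x \<in> space unit_leb"
    have "norm (f x * h x) \<le> norm (f x) * B"
      using assms(3) x by (simp add: norm_mult mult_left_mono)
    then show "norm (f x * h x) \<le> norm (B * norm (f x))" by (simp add: mult.commute)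
  qed
qed

lemma integrable_mult_continuous:
  fixes f h :: "real \<Rightarrow> complex"
  assumes "integrable unit_leb f" "continuous_on {0..1} h"
  shows "integrable unit_leb (\<lambda>x. f x * h x)"
proof -
  obtain B where "\<And>x. x \<in> {0..1} \<Longrightarrow> norm (h x) \<le> B"
    using continuous_bounded_unit[OF assms(2)] by blast
  then show ?thesis
    using assms by (intro integrable_mult_bounded[where B=B] continuous_measurable_unit_leb)
      (auto intro: continuous_on_subset)
qed

text \<open>A closed set of full Lebesgue measure is the whole line; continuity then carries the
  zero to the endpoints. This makes continuous representatives, hence point values, unique.\<close>

lemma continuous_AE_zero:
  fixes f :: "real \<Rightarrow> complex"
  assumes c: "continuous_on {0..1} f" and ae: "AE x in unit_leb. f x = 0" and x: "x \<in> {0..1}"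
  shows "f x = 0"
proof -
  \<comment> \<open>The half-lines are adjoined because the full-measure criterion concerns closed
    subsets of the whole line.\<close>
  let ?C = "{x \<in> {0..1}. f x \<in> {0}} \<union> {..0} \<union> {1..}"
  have "closed {x \<in> {0..1}. f x \<in> {0}}"
    using continuous_closed_preimage[OF c, of "{0}"] by (simp add: vimage_def Int_def)
  then have cl: "closed ?C" by auto
  have "AE x in lebesgue. x \<in> {0<..<1} \<longrightarrow> f x = 0"
    using ae by (subst (asm) AE_restrict_space_iff) auto
  then have aeC: "AE x in lebesgue. x \<in> ?C"
    by eventually_elim auto
  have all: "y \<in> ?C" for y using mem_closed_if_AE_lebesgue[OF cl aeC] .
  have "\<forall>x\<in>{0<..<1}. f x = 0" using all by force
  moreover have "closure {0<..<1} = {0..1::real}" by simp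
  ultimately show ?thesis
    using continuous_constant_on_closure[of "{0<..<1}" f 0 x] c x by simp
qed


section \<open>Functions orthogonal to all test functions\<close>

text \<open>Dynkin's pi-lambda argument: open intervals form an intersection-stable generator of the
  Borel sets, and sets of integral zero are stable under complements and countable disjoint unions.
  Lebesgue sets differ from Borel sets by null sets.\<close>

lemma set_integral_zero_if_interval_integrals_zero:
  fixes f :: "real \<Rightarrow> complex"
  assumes f: "integrable lebesgue f"
    and zero: "\<And>a b. (LINT x:{a<..<b}|lebesgue. f x) = 0"
    and A: "A \<in> sets lebesgue"
  shows "(LINT x:A|lebesgue. f x) = 0"
proof -
  have ind: "set_integrable lebesgue A f" if "A \<in> sets lebesgue" for A
    using that f unfolding set_integrable_def by (rule integrable_mult_indicator)
  \<comment> \<open>Complements require the integral over the whole line, which is exhausted by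
    bounded intervals.\<close>
  have total: "(LINT x:UNIV|lebesgue. f x) = 0"
  proof -
    have "((\<lambda>n. LINT x|lebesgue. indicat_real {- real n<..<real n} x *\<^sub>R f x) \<longlonglongrightarrow> (LINT x|lebesgue. f x))"
    proof (rule integral_dominated_convergence[where w="\<lambda>x. norm (f x)"])
      show "AE x in lebesgue. (\<lambda>n. indicat_real {- real n<..<real n} x *\<^sub>R f x) \<longlonglongrightarrow> f x"
      proof (rule AE_I2)
        fix x :: real
        have "\<forall>\<^sub>F n in sequentially. real n > \<bar>x\<bar>"
          using filterlim_real_sequentially by (simp add: filterlim_at_top_dense)
        then have "\<forall>\<^sub>F n in sequentially. indicat_real {- real n<..<real n} x *\<^sub>R f x = f x"
          by eventually_elim (auto simp: indicator_def)
        then show "(\<lambda>n. indicat_real {- real n<..<real n} x *\<^sub>R f x) \<longlonglongrightarrow> f x"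
          by (rule tendsto_eventually)
      qed
      show "integrable lebesgue (\<lambda>x. norm (f x))" using f by simp
      show "f \<in> borel_measurable lebesgue" using f by simp
      show "(\<lambda>x. indicat_real {- real n<..<real n} x *\<^sub>R f x) \<in> borel_measurable lebesgue" for n
        using ind[of "{- real n<..<real n}"] by (simp add: set_integrable_def)
      show "AE x in lebesgue. norm (indicat_real {- real n<..<real n} x *\<^sub>R f x) \<le> norm (f x)" for n
        by (rule AE_I2) (auto simp: indicator_def)
    qed
    then have "(\<lambda>n. 0) \<longlonglongrightarrow> (LINT x|lebesgue. f x)"
      using zero by (simp add: set_lebesgue_integral_def)
    then show ?thesis
      by (simp add: set_lebesgue_integral_def LIMSEQ_const_iff)
  qed
  have beq: "borel = sigma UNIV (range (\<lambda>(a, b). {a<..<b::real}))"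
    using borel_eq_box[where 'a=real] by simp
  have borel_zero: "(LINT x:A|lebesgue. f x) = 0" if "A \<in> sets borel" for A
  proof -
    have gen: "A \<in> sigma_sets UNIV (range (\<lambda>(a, b). {a<..<b::real}))"
      using that by (subst (asm) beq) (simp add: sets_measure_of)
    have stable: "Int_stable (range (\<lambda>(a, b). {a<..<b::real}))"
    proof (rule Int_stableI)
      fix A B assume "A \<in> range (\<lambda>(a, b). {a<..<b::real})" "B \<in> range (\<lambda>(a, b). {a<..<b::real})"
      then obtain a b c d where "A = {a<..<b}" "B = {c<..<d}" by auto
      then have "A \<inter> B = (\<lambda>(a, b). {a<..<b}) (max a c, min b d)" by auto
      then show "A \<inter> B \<in> range (\<lambda>(a, b). {a<..<b::real})" by blast
    qed
    have "range (\<lambda>(a, b). {a<..<b::real}) \<subseteq> Pow UNIV" by simp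
    from stable this gen show ?thesis
    proof (induction rule: sigma_sets_induct_disjoint)
      case (basic A) then show ?case using zero by auto
    next
      case empty show ?case by (simp add: set_lebesgue_integral_def)
    next
      case (compl A)
      then have A: "A \<in> sets borel"
        by (subst beq) (simp add: sets_measure_of)
      then have A': "A \<in> sets lebesgue" by simp
      have "(LINT x:UNIV|lebesgue. f x) = (LINT x:A \<union> (UNIV - A)|lebesgue. f x)" by simp
      also have "\<dots> = (LINT x:A|lebesgue. f x) + (LINT x:UNIV - A|lebesgue. f x)"
        by (rule set_integral_Un) (use A' in \<open>auto intro!: ind\<close>)
      finally show ?case using total compl by simp
    next
      case (union A)
      then have A: "A i \<in> sets borel" for i
        by (subst beq) (auto simp add: sets_measure_of)
      then have A': "A i \<in> sets lebesgue" for i by simp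
      have "(LINT x:(\<Union>i. A i)|lebesgue. f x) = (\<Sum>i. LINT x:A i|lebesgue. f x)"
        by (rule lebesgue_integral_countable_add)
          (use A' union in \<open>auto intro!: ind simp: disjoint_family_on_def\<close>)
      then show ?case using union by simp
    qed
  qed
  obtain S N N' where SN: "A = S \<union> N" "N \<subseteq> N'" "N' \<in> null_sets lborel" "S \<in> sets lborel"
    using A by (rule sets_completionE)
  have "AE x in lebesgue. x \<notin> N'"
    by (rule AE_completion) (use SN(3) AE_not_in in blast)
  then have "AE x in lebesgue. (x \<in> A) = (x \<in> S)" by eventually_elim (use SN in auto)
  then have "(LINT x:A|lebesgue. f x) = (LINT x:S|lebesgue. f x)"
    using ind[OF A] ind[of S] SN(4) f A
    unfolding set_lebesgue_integral_def set_integrable_def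
    by (intro integral_cong_AE) (auto simp: indicator_def elim!: eventually_mono)
  then show ?thesis using borel_zero SN(4) by simp
qed

text \<open>The hypothesis covers only intervals compactly inside \<open>{0<..<1}\<close>, those
  that test functions can approximate. Dominated convergence adds the intervals that touch the ends,
  and extension by zero reduces to the whole line.\<close>

lemma AE_zero_unit_leb_if_interval_integrals_zero:
  fixes f :: "real \<Rightarrow> complex"
  assumes f: "integrable unit_leb f"
    and zero: "\<And>a b. 0 < a \<Longrightarrow> a < b \<Longrightarrow> b < 1 \<Longrightarrow> (LINT x|unit_leb. indicat_real {a<..<b} x *\<^sub>R f x) = 0"
  shows "AE x in unit_leb. f x = 0"
proof -
  let ?g = "\<lambda>x. indicat_real {0<..<1} x *\<^sub>R f x"
  have g: "integrable lebesgue ?g"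
    using f by (subst (asm) integrable_restrict_space) auto
  have fm: "f \<in> borel_measurable unit_leb" using f by simp
  have zero': "(LINT x|unit_leb. indicat_real {a<..<b} x *\<^sub>R f x) = 0" for a b
  proof -
    let ?A = "\<lambda>n. {max a (1 / real (n + 2))<..<min b (1 - 1 / real (n + 2))}"
    have "(\<lambda>n. LINT x|unit_leb. indicat_real (?A n) x *\<^sub>R f x)
        \<longlonglongrightarrow> (LINT x|unit_leb. indicat_real {a<..<b} x *\<^sub>R f x)"
    proof (rule integral_dominated_convergence[where w="\<lambda>x. norm (f x)"])
      show "AE x in unit_leb. (\<lambda>n. indicat_real (?A n) x *\<^sub>R f x) \<longlonglongrightarrow> indicat_real {a<..<b} x *\<^sub>R f x"
      proof (rule AE_I2)
        fix x :: real assume "x \<in> space unit_leb"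
        then have x: "0 < x" "x < 1" by auto
        have "(\<lambda>n. 1 / real (n + 2)) \<longlonglongrightarrow> 0"
          using LIMSEQ_ignore_initial_segment[OF lim_1_over_n, of 2] by simp
        then have "\<forall>\<^sub>F n in sequentially. 1 / real (n + 2) < min x (1 - x)"
          using x by (intro order_tendstoD) auto
        then have "\<forall>\<^sub>F n in sequentially. indicat_real (?A n) x *\<^sub>R f x = indicat_real {a<..<b} x *\<^sub>R f x"
          by eventually_elim (auto simp: indicator_def)
        then show "(\<lambda>n. indicat_real (?A n) x *\<^sub>R f x) \<longlonglongrightarrow> indicat_real {a<..<b} x *\<^sub>R f x"
          by (rule tendsto_eventually)
      qed
      show "integrable unit_leb (\<lambda>x. norm (f x))" using f by simp
      show "(\<lambda>x. indicat_real {a<..<b} x *\<^sub>R f x) \<in> borel_measurable unit_leb"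
        by (intro borel_measurable_scaleR[OF _ fm] borel_measurable_unit_leb) auto
      show "(\<lambda>x. indicat_real (?A n) x *\<^sub>R f x) \<in> borel_measurable unit_leb" for n
        by (intro borel_measurable_scaleR[OF _ fm] borel_measurable_unit_leb) auto
      show "AE x in unit_leb. norm (indicat_real (?A n) x *\<^sub>R f x) \<le> norm (f x)" for n
        by (rule AE_I2) (auto simp: indicator_def)
    qed
    moreover have "(LINT x|unit_leb. indicat_real (?A n) x *\<^sub>R f x) = 0" for n
    proof (cases "max a (1 / real (n + 2)) < min b (1 - 1 / real (n + 2))")
      case True
      have "0 < 1 / real (n + 2)" by simp
      then have "0 < max a (1 / real (n + 2))" "min b (1 - 1 / real (n + 2)) < 1"
        unfolding less_max_iff_disj min_less_iff_disj by linarith+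
      then show ?thesis using True zero by blast
    next
      case False
      then have "?A n = {}" by (simp only: greaterThanLessThan_empty_iff not_less)
      then show ?thesis by simp
    qed
    ultimately have "(\<lambda>n. 0) \<longlonglongrightarrow> (LINT x|unit_leb. indicat_real {a<..<b} x *\<^sub>R f x)" by simp
    then show ?thesis by (simp add: LIMSEQ_const_iff)
  qed
  have "(LINT x:{a<..<b}|lebesgue. ?g x) = 0" for a b
  proof -
    have "(LINT x|unit_leb. indicat_real {a<..<b} x *\<^sub>R f x)
        = (LINT x|lebesgue. indicat_real {0<..<1} x *\<^sub>R indicat_real {a<..<b} x *\<^sub>R f x)"
      by (rule integral_restrict_space) simp
    also have "\<dots> = (LINT x:{a<..<b}|lebesgue. ?g x)"
      unfolding set_lebesgue_integral_def by (intro Bochner_Integration.integral_cong) (auto simp: indicator_def)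
    finally show ?thesis using zero' by simp
  qed
  note set_zero = set_integral_zero_if_interval_integrals_zero[OF g this]
  interpret finite_measure unit_leb by (rule finite_measure_unit_leb)
  have "(LINT x:A|unit_leb. f x) = 0" if A: "A \<in> sets unit_leb" for A
  proof -
    have A': "A \<in> sets lebesgue" using A by (auto simp: sets_restrict_space_iff)
    have "(LINT x:A|unit_leb. f x) = (LINT x|lebesgue. indicat_real {0<..<1} x *\<^sub>R indicat_real A x *\<^sub>R f x)"
      unfolding set_lebesgue_integral_def by (rule integral_restrict_space) simp
    also have "\<dots> = (LINT x:A|lebesgue. ?g x)"
      unfolding set_lebesgue_integral_def by (intro Bochner_Integration.integral_cong) (auto simp: indicator_def)
    finally show ?thesis using set_zero[OF A'] by simp
  qed
  then show ?thesis
    using density_unique_banach[of f "\<lambda>_. 0"] f by (simp add: set_lebesgue_integral_def)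
qed

text \<open>Powers of the bump \<open>u\<close> turn it into test functions \<open>1 - (1 - u)\<^sup>k\<close> that increase to the
  indicator of the interval.\<close>

lemma test_function_interval:
  fixes a b :: real and k :: nat
  assumes ab: "0 < a" "a < b" "b < 1"
  defines "u \<equiv> \<lambda>x::real. (max 0 ((x - a) * (b - x)))\<^sup>2"
  shows "test_function (\<lambda>x. 1 - (1 - u x) ^ k)"
proof -
  \<comment> \<open>Squaring removes the corner of \<open>max 0 t\<close> at \<open>0\<close>, which
    makes the bump continuously differentiable.\<close>
  have sq: "((\<lambda>t::real. (max 0 t)\<^sup>2) has_real_derivative 2 * max 0 t) (at t)" for t
  proof -
    consider "t > 0" | "t < 0" | "t = 0" by linarith
    then show ?thesis
    proof cases
      case 1
      have "((\<lambda>t. t\<^sup>2) has_real_derivative 2 * t) (at t)" by (auto intro!: derivative_eq_intros)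
      then have "((\<lambda>t. (max 0 t)\<^sup>2) has_real_derivative 2 * t) (at t)"
        by (rule has_field_derivative_transform_within_open[where S="{0<..}"]) (use 1 in auto)
      then show ?thesis using 1 by simp
    next
      case 2
      have "((\<lambda>t. (max 0 t)\<^sup>2) has_real_derivative 0) (at t)"
        by (rule has_field_derivative_transform_within_open[where S="{..<0}" and f="\<lambda>_. 0"]) (use 2 in auto)
      then show ?thesis using 2 by simp
    next
      case 3
      have "(\<lambda>h::real. (max 0 h)\<^sup>2 / h) \<midarrow>0\<rightarrow> 0"
      proof (rule Lim_null_comparison)
        show "\<forall>\<^sub>F h in at 0. norm ((max 0 h)\<^sup>2 / h) \<le> \<bar>h\<bar>"
          by (rule always_eventually) (auto simp: max_def power2_eq_square)
        show "(\<lambda>h::real. \<bar>h\<bar>) \<midarrow>0\<rightarrow> 0" by (intro tendsto_eq_intros) auto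
      qed
      then show ?thesis using 3 by (simp add: DERIV_def)
    qed
  qed
  have du: "(u has_real_derivative 2 * max 0 ((x - a) * (b - x)) * (a + b - 2 * x)) (at x)" for x
    unfolding u_def
    by (rule DERIV_cong, rule DERIV_chain2[OF sq]) (auto intro!: derivative_eq_intros simp: algebra_simps)
  define D where "D = (\<lambda>x. real k * (1 - u x) ^ (k - 1) * (2 * max 0 ((x - a) * (b - x)) * (a + b - 2 * x)))"
  have "((\<lambda>x. 1 - (1 - u x) ^ k) has_real_derivative D x) (at x)" for x
    unfolding D_def by (auto intro!: derivative_eq_intros du)
  then have "\<forall>x. ((\<lambda>x. 1 - (1 - u x) ^ k) has_vector_derivative D x) (at x)"
    by (simp add: has_real_derivative_iff_has_vector_derivative)
  moreover have "continuous_on UNIV D"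
    unfolding D_def u_def by (intro continuous_intros)
  ultimately have "(\<lambda>x. 1 - (1 - u x) ^ k) C1_differentiable_on UNIV"
    unfolding C1_differentiable_on_def by blast
  moreover have "u x = 0" if "x \<notin> {a..b}" for x
  proof -
    have "(x - a) * (b - x) \<le> 0" using that ab by (auto simp: mult_le_0_iff)
    then show ?thesis by (simp add: u_def)
  qed
  ultimately show ?thesis
    unfolding test_function_def using ab by (auto intro!: exI[of _ "{a..b}"])
qed

text \<open>Fundamental lemma of the calculus of variations. On the unit interval the functions
  \<open>1 - (1 - u)^k\<close> are bounded by \<open>1\<close>, so dominated convergence passes from
  them to indicators of intervals.\<close>

lemma AE_zero_if_test_integrals_zero:
  fixes g :: "real \<Rightarrow> complex"
  assumes g: "integrable unit_leb g"
    and zero: "\<And>\<phi>. test_function \<phi> \<Longrightarrow> (LINT x|unit_leb. g x * of_real (\<phi> x)) = 0"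
  shows "AE x in unit_leb. g x = 0"
proof (rule AE_zero_unit_leb_if_interval_integrals_zero[OF g])
  fix a b :: real assume ab: "0 < a" "a < b" "b < 1"
  define u where "u = (\<lambda>x::real. (max 0 ((x - a) * (b - x)))\<^sup>2)"
  have u: "0 \<le> u x" "u x \<le> 1" if "x \<in> {0<..<1}" for x
  proof -
    have "(x - a) * (b - x) \<le> 1"
    proof (cases "x < a \<or> b < x")
      case True
      then have "(x - a) * (b - x) \<le> 0" using ab by (auto simp: mult_le_0_iff)
      then show ?thesis by linarith
    next
      case False
      then have "(x - a) * (b - x) \<le> 1 * 1" using that ab by (intro mult_mono) auto
      then show ?thesis by simp
    qed
    then show "0 \<le> u x" "u x \<le> 1" by (auto simp: u_def power_le_one)
  qed
  have cu: "continuous_on UNIV u" unfolding u_def by (intro continuous_intros)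
  have gm: "g \<in> borel_measurable unit_leb" using g by simp
  have "(\<lambda>k. LINT x|unit_leb. g x * of_real (1 - (1 - u x) ^ k))
      \<longlonglongrightarrow> (LINT x|unit_leb. indicat_real {a<..<b} x *\<^sub>R g x)"
  proof (rule integral_dominated_convergence[where w="\<lambda>x. norm (g x)"])
    show "AE x in unit_leb. (\<lambda>k. g x * of_real (1 - (1 - u x) ^ k)) \<longlonglongrightarrow> indicat_real {a<..<b} x *\<^sub>R g x"
    proof (rule AE_I2)
      fix x assume x: "x \<in> space unit_leb"
      have "(\<lambda>k. 1 - (1 - u x) ^ k) \<longlonglongrightarrow> indicat_real {a<..<b} x"
      proof (cases "x \<in> {a<..<b}")
        case True
        then have "u x > 0" by (simp add: u_def)
        then have "(\<lambda>k. 1 - (1 - u x) ^ k) \<longlonglongrightarrow> 1 - 0"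
          using u[of x] x by (intro tendsto_diff tendsto_const LIMSEQ_realpow_zero) auto
        then show ?thesis using True by simp
      next
        case False
        then have "(x - a) * (b - x) \<le> 0" using ab by (auto simp: mult_le_0_iff)
        then show ?thesis using False by (simp add: u_def)
      qed
      then have "(\<lambda>k. g x * of_real (1 - (1 - u x) ^ k)) \<longlonglongrightarrow> g x * of_real (indicat_real {a<..<b} x)"
        by (intro tendsto_mult tendsto_const tendsto_of_real)
      then show "(\<lambda>k. g x * of_real (1 - (1 - u x) ^ k)) \<longlonglongrightarrow> indicat_real {a<..<b} x *\<^sub>R g x"
        by (simp add: scaleR_conv_of_real mult.commute)
    qed
    show "integrable unit_leb (\<lambda>x. norm (g x))" using g by simp
    show "(\<lambda>x. indicat_real {a<..<b} x *\<^sub>R g x) \<in> borel_measurable unit_leb"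
      by (intro borel_measurable_scaleR[OF _ gm] borel_measurable_unit_leb) auto
    show "(\<lambda>x. g x * of_real (1 - (1 - u x) ^ k)) \<in> borel_measurable unit_leb" for k
      by (intro borel_measurable_times[OF gm] borel_measurable_unit_leb borel_measurable_continuous_onI
          continuous_intros cu)
    show "AE x in unit_leb. norm (g x * of_real (1 - (1 - u x) ^ k)) \<le> norm (g x)" for k
    proof (rule AE_I2)
      fix x assume "x \<in> space unit_leb"
      then have "0 \<le> (1 - u x) ^ k" "(1 - u x) ^ k \<le> 1"
        using u[of x] by (auto intro: power_le_one)
      then have "\<bar>1 - (1 - u x) ^ k\<bar> \<le> 1" by auto
      then have "norm (g x) * \<bar>1 - (1 - u x) ^ k\<bar> \<le> norm (g x) * 1" by (intro mult_left_mono) auto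
      then show "norm (g x * of_real (1 - (1 - u x) ^ k)) \<le> norm (g x)"
        by (simp only: norm_mult norm_of_real mult_1_right)
    qed
  qed
  moreover have "(LINT x|unit_leb. g x * of_real (1 - (1 - u x) ^ k)) = 0" for k
    using test_function_interval[OF ab, of k] zero unfolding u_def by blast
  ultimately have "(\<lambda>k. 0) \<longlonglongrightarrow> (LINT x|unit_leb. indicat_real {a<..<b} x *\<^sub>R g x)" by simp
  then show "(LINT x|unit_leb. indicat_real {a<..<b} x *\<^sub>R g x) = 0" by (simp add: LIMSEQ_const_iff)
qed


section \<open>Weak derivatives and primitives\<close>

lemma integrable_on_subinterval_unit_leb:
  fixes h :: "real \<Rightarrow> complex"
  assumes "integrable unit_leb h" "0 \<le> a" "b \<le> 1"
  shows "h integrable_on {a..b}"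
proof -
  have "h integrable_on {0<..<1}"
    using assms(1) by (intro integrable_on_lebesgue_on) auto
  then have "h integrable_on {0..1}"
    by (simp add: integrable_on_open_interval_real)
  then show ?thesis
    by (rule integrable_on_subinterval) (use assms in auto)
qed

lemma integral_unit_leb_subinterval:
  fixes h :: "real \<Rightarrow> complex"
  assumes h: "integrable unit_leb h" and ab: "0 \<le> a" "b \<le> 1"
  shows "(LINT x|unit_leb. indicat_real {a..b} x *\<^sub>R h x) = integral {a..b} h"
proof -
  have hm: "h \<in> borel_measurable unit_leb" using h by simp
  have "(\<lambda>x. indicat_real {a..b} x *\<^sub>R h x) \<in> borel_measurable unit_leb"
    by (intro borel_measurable_scaleR[OF _ hm] borel_measurable_unit_leb) auto
  then have "integrable unit_leb (\<lambda>x. indicat_real {a..b} x *\<^sub>R h x)"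
    by (intro Bochner_Integration.integrable_bound[OF h] AE_I2) (auto simp: indicator_def)
  then have "(LINT x|unit_leb. indicat_real {a..b} x *\<^sub>R h x)
      = integral {0<..<1} (\<lambda>x. indicat_real {a..b} x *\<^sub>R h x)"
    by (intro lebesgue_integral_eq_integral) auto
  also have "\<dots> = integral {0..1} (\<lambda>x. if x \<in> {a..b} then h x else 0)"
    unfolding integral_open_interval_real by (intro Henstock_Kurzweil_Integration.integral_cong) auto
  also have "\<dots> = integral ({a..b} \<inter> {0..1}) h"
    by (rule integral_restrict_Int)
  also have "{a..b} \<inter> {0..1} = {a..b}" using ab by auto
  finally show ?thesis .
qed

lemma integral_unit_leb_eq:
  fixes h :: "real \<Rightarrow> complex"
  assumes "integrable unit_leb h"
  shows "(LINT x|unit_leb. h x) = integral {0..1} h"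
proof -
  have "(LINT x|unit_leb. h x) = (LINT x|unit_leb. indicat_real {0..1} x *\<^sub>R h x)"
    by (intro Bochner_Integration.integral_cong) auto
  then show ?thesis using integral_unit_leb_subinterval[OF assms, of 0 1] by simp
qed

lemma
  assumes "test_function \<phi>"
  shows test_function_has_deriv: "(\<phi> has_real_derivative deriv \<phi> x) (at x)"
    and test_function_continuous_deriv: "continuous_on A (deriv \<phi>)"
    and test_function_continuous: "continuous_on A \<phi>"
proof -
  obtain D where D: "\<And>x. (\<phi> has_vector_derivative D x) (at x)" "continuous_on UNIV D"
    using assms unfolding test_function_def C1_differentiable_on_def by auto
  have D': "(\<phi> has_real_derivative D x) (at x)" for x
    using D(1) by (simp add: has_real_derivative_iff_has_vector_derivative)
  then have e: "deriv \<phi> = D" by (auto intro!: DERIV_imp_deriv)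
  show "(\<phi> has_real_derivative deriv \<phi> x) (at x)" using D' e by simp
  show "continuous_on A (deriv \<phi>)" using D(2) e by (auto intro: continuous_on_subset)
  have "isCont \<phi> x" for x using D(1) by (rule has_vector_derivative_continuous)
  then show "continuous_on A \<phi>" by (simp add: continuous_at_imp_continuous_on)
qed

lemma test_function_support:
  assumes "test_function \<phi>"
  obtains a b where "0 < a" "a \<le> b" "b < 1" "\<And>x. x \<notin> {a..b} \<Longrightarrow> \<phi> x = 0"
proof -
  obtain K where K: "compact K" "K \<subseteq> {0<..<1}" "\<And>x. x \<notin> K \<Longrightarrow> \<phi> x = 0"
    using assms unfolding test_function_def by auto
  show ?thesis
  proof (cases "K = {}")
    case True
    show ?thesis by (rule that[of "1/2" "1/2"]) (use K True in auto)
  next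
    case False
    then obtain a b where ab: "a \<in> K" "b \<in> K" "\<And>x. x \<in> K \<Longrightarrow> a \<le> x" "\<And>x. x \<in> K \<Longrightarrow> x \<le> b"
      using compact_attains_inf[OF K(1)] compact_attains_sup[OF K(1)] by metis
    have "x \<notin> K" if "x \<notin> {a..b}" for x using ab that by auto
    then show ?thesis
      by (intro that[of a b]) (use ab K in auto)
  qed
qed

lemma integrable_mult_test_function:
  fixes f :: "real \<Rightarrow> complex"
  assumes "integrable unit_leb f" "test_function \<phi>"
  shows "integrable unit_leb (\<lambda>x. f x * of_real (\<phi> x))"
    and "integrable unit_leb (\<lambda>x. f x * of_real (deriv \<phi> x))"
proof -
  show "integrable unit_leb (\<lambda>x. f x * of_real (\<phi> x))"
    by (intro integrable_mult_continuous[OF assms(1)] continuous_intros test_function_continuous[OF assms(2)])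
  show "integrable unit_leb (\<lambda>x. f x * of_real (deriv \<phi> x))"
    by (intro integrable_mult_continuous[OF assms(1)] continuous_intros test_function_continuous_deriv[OF assms(2)])
qed

lemma has_weak_deriv_unique:
  assumes "has_weak_deriv y g" "has_weak_deriv y h"
  shows "g = h"
proof -
  obtain fy fg fh where f: "square_int fy" "y = abs_l2 fy" "square_int fg" "g = abs_l2 fg"
    "square_int fh" "h = abs_l2 fh"
    using l2_cases by metis
  have "AE x in unit_leb. fg x - fh x = 0"
  proof (rule AE_zero_if_test_integrals_zero)
    show "integrable unit_leb (\<lambda>x. fg x - fh x)"
      using f by (auto intro: square_int_integrable)
    fix \<phi> assume \<phi>: "test_function \<phi>"
    have "(LINT x|unit_leb. fg x * of_real (\<phi> x)) = (LINT x|unit_leb. fh x * of_real (\<phi> x))"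
      using assms f \<phi> by (auto simp: has_weak_deriv_abs_l2)
    then show "(LINT x|unit_leb. (fg x - fh x) * of_real (\<phi> x)) = 0"
      using integrable_mult_test_function(1)[OF square_int_integrable \<phi>] f
      by (simp add: left_diff_distrib)
  qed
  then show ?thesis using f by (simp add: abs_l2_eq_iff)
qed

lemma weak_deriv_eq: "has_weak_deriv y g \<Longrightarrow> weak_deriv y = g"
  unfolding weak_deriv_def using has_weak_deriv_unique by blast

lemma has_weak_deriv_add:
  assumes "has_weak_deriv y g" "has_weak_deriv y' g'"
  shows "has_weak_deriv (y + y') (g + g')"
proof -
  obtain fy fg fy' fg' where f: "square_int fy" "y = abs_l2 fy" "square_int fg" "g = abs_l2 fg"
    "square_int fy'" "y' = abs_l2 fy'" "square_int fg'" "g' = abs_l2 fg'"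
    using l2_cases by metis
  note i = integrable_mult_test_function[OF square_int_integrable]
  show ?thesis
    using assms f
    by (auto simp: has_weak_deriv_abs_l2 abs_l2_add square_int_add distrib_right i)
qed

lemma has_weak_deriv_cscale:
  assumes "has_weak_deriv y g"
  shows "has_weak_deriv (c *\<^sub>C y) (c *\<^sub>C g)"
proof -
  obtain fy fg where f: "square_int fy" "y = abs_l2 fy" "square_int fg" "g = abs_l2 fg"
    using l2_cases by metis
  show ?thesis
    using assms f by (auto simp: has_weak_deriv_abs_l2 abs_l2_cscale square_int_scale mult.assoc)
qed

section \<open>Primitives of integrable functions and integration by parts\<close>

definition primitive :: "(real \<Rightarrow> complex) \<Rightarrow> real \<Rightarrow> complex" where
  "primitive g x = integral {0..x} g"

lemma primitive_0 [simp]: "primitive g 0 = 0"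
  by (simp add: primitive_def)

lemma primitive_1: "integrable unit_leb g \<Longrightarrow> primitive g 1 = (LINT x|unit_leb. g x)"
  by (simp add: primitive_def integral_unit_leb_eq)

lemma continuous_on_primitive:
  "integrable unit_leb g \<Longrightarrow> continuous_on {0..1} (primitive g)"
  unfolding primitive_def
  by (rule indefinite_integral_continuous_1) (auto intro: integrable_on_subinterval_unit_leb)

lemma primitive_has_vector_derivative:
  "continuous_on {0..1} g \<Longrightarrow> x \<in> {0..1} \<Longrightarrow> (primitive g has_vector_derivative g x) (at x within {0..1})"
  unfolding primitive_def by (rule integral_has_vector_derivative)

text \<open>As \<open>g\<close> is only integrable, the product rule for differentiable functions
  does not apply to \<open>primitive g\<close>; Fubini on the triangle \<open>t \<le> x\<close>
  takes its place.\<close>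

lemma primitive_by_parts:
  fixes g \<phi> :: "real \<Rightarrow> complex"
  assumes g: "integrable unit_leb g"
    and \<phi>: "\<And>x. x \<in> {0..1} \<Longrightarrow> (\<phi> has_vector_derivative \<phi>' x) (at x within {0..1})"
    and \<phi>': "continuous_on {0..1} \<phi>'"
  shows "(LINT x|unit_leb. primitive g x * \<phi>' x) = primitive g 1 * \<phi> 1 - (LINT x|unit_leb. g x * \<phi> x)"
proof -
  interpret finite_measure unit_leb by (rule finite_measure_unit_leb)
  interpret pair_sigma_finite unit_leb unit_leb ..
  \<comment> \<open>Integrated over \<open>t\<close>, \<open>K\<close> gives
    \<open>primitive g x * \<phi>' x\<close>; integrated over \<open>x\<close>, it gives
    \<open>g t * (\<phi> 1 - \<phi> t)\<close>.\<close>
  define K where "K = (\<lambda>t x. if t \<le> x then g t * \<phi>' x else 0)"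
  have c: "continuous_on {0..1} \<phi>"
    using \<phi> by (rule continuous_on_vector_derivative)
  obtain B where B: "\<And>x. x \<in> {0..1} \<Longrightarrow> norm (\<phi>' x) \<le> B"
    using continuous_bounded_unit[OF \<phi>'] by blast
  have \<phi>'i: "integrable unit_leb \<phi>'" using \<phi>' by (rule continuous_integrable_unit_leb)
  have m[measurable]: "g \<in> borel_measurable unit_leb" "\<phi>' \<in> borel_measurable unit_leb"
    using g \<phi>'i by auto
  have id: "(\<lambda>x. x) \<in> borel_measurable unit_leb" by (rule borel_measurable_unit_leb) simp
  have [measurable]: "fst \<in> borel_measurable (unit_leb \<Otimes>\<^sub>M unit_leb)" "snd \<in> borel_measurable (unit_leb \<Otimes>\<^sub>M unit_leb)"
    using measurable_compose[OF measurable_fst[of unit_leb unit_leb] id] measurable_compose[OF measurable_snd[of unit_leb unit_leb] id] by simp_all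
  have gm: "(\<lambda>p. g (fst p)) \<in> borel_measurable (unit_leb \<Otimes>\<^sub>M unit_leb)"
    "(\<lambda>p. \<phi>' (snd p)) \<in> borel_measurable (unit_leb \<Otimes>\<^sub>M unit_leb)"
    using measurable_compose[OF measurable_fst[of unit_leb unit_leb] m(1)] measurable_compose[OF measurable_snd[of unit_leb unit_leb] m(2)] by simp_all
  have bound: "integrable (unit_leb \<Otimes>\<^sub>M unit_leb) (\<lambda>p. norm (g (fst p)) * B)"
  proof (rule Fubini_integrable)
    show "(\<lambda>p. norm (g (fst p)) * B) \<in> borel_measurable (unit_leb \<Otimes>\<^sub>M unit_leb)"
      using gm by simp
    show "integrable unit_leb (\<lambda>x. LINT y|unit_leb. norm (norm (g (fst (x, y))) * B))"
      using g by (simp add: abs_mult)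
    show "AE x in unit_leb. integrable unit_leb (\<lambda>y. norm (g (fst (x, y))) * B)"
      by simp
  qed
  have K: "integrable (unit_leb \<Otimes>\<^sub>M unit_leb) (case_prod K)"
  proof (rule Bochner_Integration.integrable_bound[OF bound])
    have "(\<lambda>p. if fst p \<le> snd p then g (fst p) * \<phi>' (snd p) else 0) \<in> borel_measurable (unit_leb \<Otimes>\<^sub>M unit_leb)"
      using gm by measurable
    then show "case_prod K \<in> borel_measurable (unit_leb \<Otimes>\<^sub>M unit_leb)"
      by (simp add: K_def case_prod_beta')
    show "AE p in unit_leb \<Otimes>\<^sub>M unit_leb. norm (case_prod K p) \<le> norm (norm (g (fst p)) * B)"
    proof (rule AE_I2)
      fix p assume p: "p \<in> space (unit_leb \<Otimes>\<^sub>M unit_leb)"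
      then have B': "norm (\<phi>' (snd p)) \<le> B" by (intro B) (auto simp: space_pair_measure)
      moreover have "0 \<le> B" using B' norm_ge_zero order_trans by blast
      ultimately show "norm (case_prod K p) \<le> norm (norm (g (fst p)) * B)"
        by (auto simp: K_def case_prod_beta' norm_mult abs_mult intro!: mult_left_mono)
    qed
  qed
  have "(LINT x|unit_leb. primitive g x * \<phi>' x) = (LINT x|unit_leb. (LINT t|unit_leb. K t x))"
  proof (intro Bochner_Integration.integral_cong refl)
    fix x assume "x \<in> space unit_leb"
    then have x: "0 < x" "x < 1" by auto
    have "(LINT t|unit_leb. K t x) = (LINT t|unit_leb. (indicat_real {0..x} t *\<^sub>R g t) * \<phi>' x)"
      by (intro Bochner_Integration.integral_cong) (auto simp: K_def)
    also have "\<dots> = (LINT t|unit_leb. indicat_real {0..x} t *\<^sub>R g t) * \<phi>' x"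
      by (rule integral_mult_left_zero)
    also have "\<dots> = primitive g x * \<phi>' x"
      using integral_unit_leb_subinterval[OF g, of 0 x] x by (simp add: primitive_def)
    finally show "primitive g x * \<phi>' x = (LINT t|unit_leb. K t x)" by simp
  qed
  also have "\<dots> = (LINT t|unit_leb. (LINT x|unit_leb. K t x))"
    using Fubini_integral[OF K] .
  also have "\<dots> = (LINT t|unit_leb. g t * \<phi> 1 - g t * \<phi> t)"
  proof (intro Bochner_Integration.integral_cong refl)
    fix t assume "t \<in> space unit_leb"
    then have t: "0 < t" "t < 1" by auto
    have "(LINT x|unit_leb. K t x) = (LINT x|unit_leb. g t * (indicat_real {t..1} x *\<^sub>R \<phi>' x))"
      by (intro Bochner_Integration.integral_cong) (auto simp: K_def)
    also have "\<dots> = g t * (LINT x|unit_leb. indicat_real {t..1} x *\<^sub>R \<phi>' x)"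
      by (rule integral_mult_right_zero)
    also have "\<dots> = g t * integral {t..1} \<phi>'"
      using integral_unit_leb_subinterval[OF \<phi>'i, of t 1] t by simp
    also have "(\<phi>' has_integral \<phi> 1 - \<phi> t) {t..1}"
    proof (rule fundamental_theorem_of_calculus)
      show "(\<phi> has_vector_derivative \<phi>' x) (at x within {t..1})" if "x \<in> {t..1}" for x
        by (rule has_vector_derivative_within_subset[OF \<phi>]) (use that t in auto)
    qed (use t in simp)
    then have "integral {t..1} \<phi>' = \<phi> 1 - \<phi> t" by (rule integral_unique)
    finally show "(LINT x|unit_leb. K t x) = g t * \<phi> 1 - g t * \<phi> t" by (simp add: algebra_simps)
  qed
  also have "\<dots> = (LINT t|unit_leb. g t) * \<phi> 1 - (LINT t|unit_leb. g t * \<phi> t)"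
    using g integrable_mult_continuous[OF g c] by simp
  finally show ?thesis using g by (simp add: primitive_1)
qed

lemma square_int_primitive: "integrable unit_leb g \<Longrightarrow> square_int (\<lambda>x. c + primitive g x)"
  by (intro square_int_continuous continuous_intros continuous_on_primitive)

text \<open>Test functions vanish at \<open>0\<close> and \<open>1\<close>, so integration by parts
  leaves no boundary term, and the constant meets a derivative of integral zero.\<close>

lemma has_weak_deriv_primitive:
  assumes g: "square_int g"
  shows "has_weak_deriv (abs_l2 (\<lambda>x. c + primitive g x)) (abs_l2 g)"
proof -
  have gi: "integrable unit_leb g" using g by (rule square_int_integrable)
  have "(LINT x|unit_leb. (c + primitive g x) * of_real (deriv \<phi> x)) = - (LINT x|unit_leb. g x * of_real (\<phi> x))"
    if \<phi>: "test_function \<phi>" for \<phi>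
  proof -
    have end0: "\<phi> 0 = 0" "\<phi> 1 = 0" using test_function_support[OF \<phi>] by force+
    have d: "((\<lambda>x. complex_of_real (\<phi> x)) has_vector_derivative of_real (deriv \<phi> x)) (at x within {0..1})" for x
      by (rule has_vector_derivative_of_real) (rule has_field_derivative_at_within[OF test_function_has_deriv[OF \<phi>]])
    have cd: "continuous_on {0..1} (\<lambda>x. complex_of_real (deriv \<phi> x))"
      by (intro continuous_intros test_function_continuous_deriv[OF \<phi>])
    have "((\<lambda>x. complex_of_real (deriv \<phi> x)) has_integral of_real (\<phi> 1) - of_real (\<phi> 0)) {0..1}"
      by (rule fundamental_theorem_of_calculus) (use d in auto)
    then have "integral {0..1} (\<lambda>x. complex_of_real (deriv \<phi> x)) = 0"
      using end0 by (auto dest: integral_unique)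
    then have "(LINT x|unit_leb. complex_of_real (deriv \<phi> x)) = 0"
      using integral_unit_leb_eq[OF continuous_integrable_unit_leb[OF cd]] by argo
    moreover have "(LINT x|unit_leb. primitive g x * of_real (deriv \<phi> x))
        = primitive g 1 * of_real (\<phi> 1) - (LINT x|unit_leb. g x * of_real (\<phi> x))"
      by (rule primitive_by_parts[OF gi d cd])
    moreover have "integrable unit_leb (\<lambda>x. primitive g x * of_real (deriv \<phi> x))"
      by (intro continuous_integrable_unit_leb continuous_on_mult continuous_on_primitive gi cd)
    ultimately show ?thesis
      using end0 continuous_integrable_unit_leb[OF cd] by (simp add: distrib_right)
  qed
  then show ?thesis
    using g gi by (simp add: has_weak_deriv_abs_l2 square_int_primitive)
qed

text \<open>Zero mean makes the antiderivative return to zero to the right of the support of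
  \<open>s\<close>.\<close>

lemma test_function_antiderivative:
  fixes s :: "real \<Rightarrow> real"
  assumes s: "continuous_on UNIV s" and ab: "0 < a" "a \<le> b" "b < 1"
    and out: "\<And>x. x \<notin> {a..b} \<Longrightarrow> s x = 0" and zero: "integral {0..1} s = 0"
  obtains \<phi> where "test_function \<phi>" "deriv \<phi> = s"
proof -
  define \<phi> where "\<phi> = (\<lambda>x. integral {-1..x} s)"
  have int: "s integrable_on {u..v}" for u v
    by (rule integrable_continuous_real) (use s in \<open>auto intro: continuous_on_subset\<close>)
  have off: "integral {u..v} s = 0" if "b < u \<or> v < a" for u v
    using Henstock_Kurzweil_Integration.integral_cong[of "{u..v}" s "\<lambda>_. 0"] that out by force
  have left: "\<phi> x = 0" if "x < a" for x
    unfolding \<phi>_def using off that by blast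
  have "\<phi> 1 = integral {-1..0} s + integral {0..1} s"
    unfolding \<phi>_def by (rule Henstock_Kurzweil_Integration.integral_combine[symmetric]) (use int in auto)
  then have \<phi>1: "\<phi> 1 = 0" using zero left[of 0] ab by (simp add: \<phi>_def)
  have right: "\<phi> x = 0" if "x > b" for x
  proof -
    consider "x \<le> 1" | "1 \<le> x" by linarith
    then show ?thesis
    proof cases
      case 1
      have "\<phi> 1 = \<phi> x + integral {x..1} s"
        unfolding \<phi>_def by (rule Henstock_Kurzweil_Integration.integral_combine[symmetric])
          (use 1 int that ab in auto)
      then show ?thesis using \<phi>1 off[of x 1] that by simp
    next
      case 2
      have "\<phi> x = \<phi> 1 + integral {1..x} s"
        unfolding \<phi>_def by (rule Henstock_Kurzweil_Integration.integral_combine[symmetric])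
          (use 2 int ab in auto)
      then show ?thesis using \<phi>1 off[of 1 x] ab by simp
    qed
  qed
  have d: "(\<phi> has_vector_derivative s x) (at x)" for x
  proof (cases "x < a")
    case True
    have "((\<lambda>_. 0) has_vector_derivative 0) (at x)" by simp
    then have "(\<phi> has_vector_derivative 0) (at x)"
      by (rule has_vector_derivative_transform_within_open[where S="{..<a}"]) (use True left in auto)
    then show ?thesis using True out by simp
  next
    case False
    then have x: "x > -1" using ab by simp
    have "(\<phi> has_vector_derivative s x) (at x within {-1..x + 1})"
      unfolding \<phi>_def by (rule integral_has_vector_derivative)
        (use x s in \<open>auto intro: continuous_on_subset\<close>)
    moreover have "at x within {-1..x + 1} = at x"
      by (rule at_within_interior) (use x in auto)
    ultimately show ?thesis by simp
  qed
  have "\<phi> C1_differentiable_on UNIV"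
    unfolding C1_differentiable_on_def using d s by blast
  moreover have "\<phi> x = 0" if "x \<notin> {a..b}" for x using that left right by force
  ultimately have "test_function \<phi>"
    unfolding test_function_def using ab by (auto intro!: exI[of _ "{a..b}"])
  moreover have "deriv \<phi> = s"
    using d by (auto intro!: DERIV_imp_deriv simp: has_real_derivative_iff_has_vector_derivative)
  ultimately show ?thesis by (rule that)
qed

lemma integral_unit_leb_of_real:
  assumes "continuous_on {0..1} h"
  shows "(LINT x|unit_leb. complex_of_real (h x)) = of_real (integral {0..1} h)"
proof -
  have "(LINT x|unit_leb. complex_of_real (h x)) = integral {0..1} (\<lambda>x. of_real (h x))"
    by (intro integral_unit_leb_eq continuous_integrable_unit_leb continuous_intros assms)
  moreover have "((\<lambda>x. complex_of_real (h x)) has_integral of_real (integral {0..1} h)) {0..1}"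
    by (intro has_integral_of_real integrable_integral integrable_continuous_real assms)
  ultimately show ?thesis by (simp only: integral_unique)
qed

text \<open>Lemma of du Bois-Reymond. Subtracting from \<open>\<psi>\<close> a suitable multiple of
  a fixed \<open>\<psi>0\<close> of nonzero mean leaves the derivative of a test function; hence
  \<open>w\<close> and the constant \<open>c\<close> have the same integral against every
  \<open>\<psi>\<close>.\<close>

lemma AE_const_if_weak_deriv_zero:
  fixes w :: "real \<Rightarrow> complex"
  assumes w: "integrable unit_leb w"
    and zero: "\<And>\<phi>. test_function \<phi> \<Longrightarrow> (LINT x|unit_leb. w x * of_real (deriv \<phi> x)) = 0"
  obtains c where "AE x in unit_leb. w x = c"
proof -
  \<comment> \<open>If all test functions had mean zero, the constant \<open>1\<close> would vanish
    almost everywhere.\<close>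
  have "\<exists>\<psi>. test_function \<psi> \<and> integral {0..1} \<psi> \<noteq> 0"
  proof (rule ccontr)
    assume *: "\<nexists>\<psi>. test_function \<psi> \<and> integral {0..1} \<psi> \<noteq> 0"
    have "AE x in unit_leb. (1::complex) = 0"
    proof (rule AE_zero_if_test_integrals_zero)
      show "integrable unit_leb (\<lambda>x. 1::complex)"
        by (rule continuous_integrable_unit_leb) (rule continuous_on_const)
      fix \<psi> assume \<psi>: "test_function \<psi>"
      then show "(LINT x|unit_leb. 1 * complex_of_real (\<psi> x)) = 0"
        using * integral_unit_leb_of_real[OF test_function_continuous[OF \<psi>]] by simp
    qed
    then have "(1::complex) = 0"
      by (rule continuous_AE_zero[OF continuous_on_const, of 1 0]) simp
    then show False by simp
  qed
  then obtain \<psi>0 where \<psi>0: "test_function \<psi>0" "integral {0..1} \<psi>0 \<noteq> 0" by blast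
  define c where "c = (LINT x|unit_leb. w x * of_real (\<psi>0 x)) / of_real (integral {0..1} \<psi>0)"
  have "AE x in unit_leb. w x - c = 0"
  proof (rule AE_zero_if_test_integrals_zero)
    show "integrable unit_leb (\<lambda>x. w x - c)"
      by (rule Bochner_Integration.integrable_diff[OF w]) (rule continuous_integrable_unit_leb, rule continuous_on_const)
    fix \<psi> assume \<psi>: "test_function \<psi>"
    define m where "m = integral {0..1} \<psi> / integral {0..1} \<psi>0"
    obtain a b where ab: "0 < a" "a \<le> b" "b < 1" "\<And>x. x \<notin> {a..b} \<Longrightarrow> \<psi> x = 0"
      using test_function_support[OF \<psi>] by metis
    obtain a0 b0 where ab0: "0 < a0" "a0 \<le> b0" "b0 < 1" "\<And>x. x \<notin> {a0..b0} \<Longrightarrow> \<psi>0 x = 0"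
      using test_function_support[OF \<psi>0(1)] by metis
    note cont = test_function_continuous[OF \<psi>] test_function_continuous[OF \<psi>0(1)]
    obtain \<phi> where \<phi>: "test_function \<phi>" "deriv \<phi> = (\<lambda>x. \<psi> x - m * \<psi>0 x)"
    proof (rule test_function_antiderivative)
      show "continuous_on UNIV (\<lambda>x. \<psi> x - m * \<psi>0 x)"
        by (intro continuous_intros cont)
      show "0 < min a a0" "min a a0 \<le> max b b0" "max b b0 < 1" using ab(1-3) ab0(1-3) by auto
      show "\<psi> x - m * \<psi>0 x = 0" if "x \<notin> {min a a0..max b b0}" for x
      proof -
        have "x \<notin> {a..b}" "x \<notin> {a0..b0}" using that by auto
        then show ?thesis using ab(4) ab0(4) by simp
      qed
      have "integral {0..1} (\<lambda>x. \<psi> x - m * \<psi>0 x) = integral {0..1} \<psi> - integral {0..1} (\<lambda>x. m * \<psi>0 x)"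
        by (intro Henstock_Kurzweil_Integration.integral_diff integrable_continuous_real continuous_intros cont)
      then show "integral {0..1} (\<lambda>x. \<psi> x - m * \<psi>0 x) = 0"
        using \<psi>0(2) by (simp add: m_def)
    qed
    note i = integrable_mult_test_function(1)[OF w \<psi>] integrable_mult_test_function(1)[OF w \<psi>0(1)]
    have i1: "integrable unit_leb (\<lambda>x. complex_of_real (\<psi> x))"
      by (intro continuous_integrable_unit_leb continuous_intros cont)
    have "(LINT x|unit_leb. w x * of_real (deriv \<phi> x))
        = (LINT x|unit_leb. w x * of_real (\<psi> x) - of_real m * (w x * of_real (\<psi>0 x)))"
      unfolding \<phi>(2) by (intro Bochner_Integration.integral_cong refl) (simp add: right_diff_distrib)
    also have "\<dots> = (LINT x|unit_leb. w x * of_real (\<psi> x)) - (LINT x|unit_leb. of_real m * (w x * of_real (\<psi>0 x)))"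
      by (intro Bochner_Integration.integral_diff i integrable_mult_right)
    also have "(LINT x|unit_leb. of_real m * (w x * of_real (\<psi>0 x))) = of_real m * (LINT x|unit_leb. w x * of_real (\<psi>0 x))"
      by (rule integral_mult_right_zero)
    also have "\<dots> = c * of_real (integral {0..1} \<psi>)"
      using \<psi>0(2) by (simp add: m_def c_def)
    also have "\<dots> = c * (LINT x|unit_leb. of_real (\<psi> x))"
      using integral_unit_leb_of_real[OF cont(1)] by simp
    finally have *: "(LINT x|unit_leb. w x * of_real (\<psi> x)) - c * (LINT x|unit_leb. of_real (\<psi> x)) = 0"
      using zero[OF \<phi>(1)] by metis
    have "(LINT x|unit_leb. (w x - c) * of_real (\<psi> x))
        = (LINT x|unit_leb. w x * of_real (\<psi> x) - c * of_real (\<psi> x))"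
      by (intro Bochner_Integration.integral_cong refl) (simp add: left_diff_distrib)
    also have "\<dots> = (LINT x|unit_leb. w x * of_real (\<psi> x)) - (LINT x|unit_leb. c * of_real (\<psi> x))"
      by (intro Bochner_Integration.integral_diff i integrable_mult_right i1)
    also have "\<dots> = (LINT x|unit_leb. w x * of_real (\<psi> x)) - c * (LINT x|unit_leb. of_real (\<psi> x))"
      by (simp only: integral_mult_right_zero)
    finally show "(LINT x|unit_leb. (w x - c) * of_real (\<psi> x)) = 0" using * by simp
  qed
  then have "AE x in unit_leb. w x = c" by simp
  then show ?thesis by (rule that)
qed

text \<open>A representative of \<open>y\<close> minus \<open>primitive g\<close> has weak
  derivative zero, hence is constant. Elements with a weak derivative thus get a continuous
  representative.\<close>

lemma has_weak_deriv_imp_primitive: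
  assumes g: "square_int g" and wd: "has_weak_deriv y (abs_l2 g)"
  obtains c where "y = abs_l2 (\<lambda>x. c + primitive g x)"
proof -
  obtain f where f: "square_int f" "y = abs_l2 f" by (rule l2_cases)
  have gi: "integrable unit_leb g" using g by (rule square_int_integrable)
  have p: "square_int (primitive g)" using square_int_primitive[OF gi, of 0] by simp
  have pd: "has_weak_deriv (abs_l2 (primitive g)) (abs_l2 g)"
    using has_weak_deriv_primitive[OF g, of 0] by simp
  obtain c where c: "AE x in unit_leb. f x - primitive g x = c"
  proof (rule AE_const_if_weak_deriv_zero)
    show "integrable unit_leb (\<lambda>x. f x - primitive g x)"
      using f p by (auto intro: square_int_integrable)
    fix \<phi> assume \<phi>: "test_function \<phi>"
    note i = integrable_mult_test_function(2)[OF square_int_integrable \<phi>]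
    show "(LINT x|unit_leb. (f x - primitive g x) * of_real (deriv \<phi> x)) = 0"
      using wd pd f g p \<phi> i[OF f(1)] i[OF p] by (simp add: has_weak_deriv_abs_l2 left_diff_distrib)
  qed
  have "AE x in unit_leb. f x = c + primitive g x" using c by eventually_elim (simp add: algebra_simps)
  then have "y = abs_l2 (\<lambda>x. c + primitive g x)"
    using f gi by (simp add: abs_l2_eq_iff square_int_primitive)
  then show ?thesis by (rule that)
qed

text \<open>Replaces the definite description by evaluation of any continuous representative;
  \<open>continuous_AE_zero\<close> supplies the uniqueness.\<close>

lemma point_value_abs_l2:
  assumes f: "continuous_on {0..1} f" and x: "x \<in> {0..1}"
  shows "point_value (abs_l2 f) x = f x"
  unfolding point_value_def
proof (rule the_equality)
  have sf: "square_int f" using f by (rule square_int_continuous)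
  show "\<exists>h. continuous_on {0..1} h \<and> represents h (abs_l2 f) \<and> h x = f x"
    using f sf by (intro exI[of _ f]) (simp add: represents_abs_l2)
  fix c assume "\<exists>h. continuous_on {0..1} h \<and> represents h (abs_l2 f) \<and> h x = c"
  then obtain h where h: "continuous_on {0..1} h" "represents h (abs_l2 f)" "h x = c" by blast
  then have "AE x in unit_leb. h x - f x = 0" using sf by (simp add: represents_abs_l2)
  then have "h x - f x = 0"
    by (intro continuous_AE_zero[where f="\<lambda>x. h x - f x"] continuous_on_diff h f x)
  then show "c = f x" using h by simp
qed


section \<open>Orthonormal families and Fourier coefficients\<close>

lemma cinner_l2_add_right: "cinner_l2 f (g + h) = cinner_l2 f g + cinner_l2 f h"
  by (metis cinner_l2_add cinner_l2_commute complex_cnj_add)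

lemma cinner_l2_scale_right: "cinner_l2 f (c *\<^sub>C g) = cnj c * cinner_l2 f g"
  by (metis cinner_l2_scale cinner_l2_commute complex_cnj_mult)

lemma cinner_l2_zero [simp]: "cinner_l2 0 f = 0" "cinner_l2 f 0 = 0"
  using cinner_l2_add[of 0 0 f] cinner_l2_add_right[of f 0 0] by simp_all

lemma cinner_l2_uminus: "cinner_l2 (- f) g = - cinner_l2 f g" "cinner_l2 f (- g) = - cinner_l2 f g"
  using cinner_l2_add[of f "- f" g] cinner_l2_add_right[of f g "- g"]
  by (simp_all add: add_eq_0_iff)

lemma cinner_l2_diff: "cinner_l2 (f - g) h = cinner_l2 f h - cinner_l2 g h"
  "cinner_l2 h (f - g) = cinner_l2 h f - cinner_l2 h g"
  using cinner_l2_add[of f "- g" h] cinner_l2_add_right[of h f "- g"] by (simp_all add: cinner_l2_uminus)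

lemma cinner_l2_sum: "cinner_l2 (\<Sum>n\<in>S. f n) g = (\<Sum>n\<in>S. cinner_l2 (f n) g)"
  by (induction S rule: infinite_finite_induct) (simp_all add: cinner_l2_add)

lemma cinner_l2_self: "cinner_l2 f f = of_real ((norm f)\<^sup>2)"
proof (rule complex_eqI)
  show "Re (cinner_l2 f f) = Re (of_real ((norm f)\<^sup>2))"
    by (simp add: power2_norm_eq_inner inner_l2_def)
  show "Im (cinner_l2 f f) = Im (of_real ((norm f)\<^sup>2))"
    using arg_cong[OF cinner_l2_commute[of f f], of Im] by simp
qed

lemma norm_cscale: "norm (c *\<^sub>C f) = norm c * norm (f :: l2)"
proof -
  have "complex_of_real ((norm (c *\<^sub>C f))\<^sup>2) = of_real ((norm c * norm f)\<^sup>2)"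
    unfolding cinner_l2_self[symmetric] cinner_l2_scale cinner_l2_scale_right
    by (simp only: cinner_l2_self power_mult_distrib of_real_mult complex_norm_square mult_ac)
  then have "(norm (c *\<^sub>C f))\<^sup>2 = (norm c * norm f)\<^sup>2" by (simp only: of_real_eq_iff)
  then show ?thesis by (simp add: power2_eq_iff_nonneg)
qed

lemma norm_cinner_l2_le: "norm (cinner_l2 f g) \<le> norm f * norm g"
proof (cases "cinner_l2 f g = 0")
  case False
  \<comment> \<open>Rotating \<open>f\<close> by this unimodular factor makes the inner product real
    and positive, so the real Cauchy-Schwarz inequality applies.\<close>
  define c where "c = cnj (sgn (cinner_l2 f g))"
  have nc: "norm c = 1" using False by (simp add: c_def norm_sgn)
  have "c * cinner_l2 f g = of_real (norm (cinner_l2 f g))"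
    using False by (simp add: c_def sgn_eq mult.commute complex_norm_square[symmetric] power2_eq_square)
  then have "norm (cinner_l2 f g) = inner (c *\<^sub>C f) g"
    by (simp add: inner_l2_def cinner_l2_scale)
  also have "\<dots> \<le> norm (c *\<^sub>C f) * norm g" by (rule norm_cauchy_schwarz)
  finally show ?thesis using nc by (simp add: norm_cscale)
qed simp

lemma tendsto_cinner_l2:
  assumes "(f \<longlongrightarrow> y) F" shows "((\<lambda>i. cinner_l2 (f i) g) \<longlongrightarrow> cinner_l2 y g) F"
proof -
  have "((\<lambda>i. norm (f i - y) * norm g) \<longlongrightarrow> 0 * norm g) F"
    using assms by (intro tendsto_intros) (simp add: LIM_zero_iff tendsto_norm_zero)
  then have lim: "((\<lambda>i. norm (f i - y) * norm g) \<longlongrightarrow> 0) F" by simp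
  have "((\<lambda>i. cinner_l2 (f i) g - cinner_l2 y g) \<longlongrightarrow> 0) F"
    by (rule Lim_null_comparison[OF always_eventually lim])
      (simp add: cinner_l2_diff[symmetric] norm_cinner_l2_le)
  then show ?thesis by (simp add: LIM_zero_iff)
qed

lemma tendsto_cinner_l2_right:
  assumes "(f \<longlongrightarrow> y) F" shows "((\<lambda>i. cinner_l2 g (f i)) \<longlongrightarrow> cinner_l2 g y) F"
  using tendsto_cnj[OF tendsto_cinner_l2[OF assms, of g]] by (simp add: cinner_l2_commute[symmetric])

section \<open>Finite orthonormal families: Pythagoras and Bessel\<close>

context
  fixes S :: "'i set" and u :: "'i \<Rightarrow> l2"
  assumes S: "finite S" and orth: "\<And>m n. m \<in> S \<Longrightarrow> n \<in> S \<Longrightarrow> cinner_l2 (u m) (u n) = (if m = n then 1 else 0)"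
begin

lemma cinner_orthonormal_sum:
  "m \<in> S \<Longrightarrow> cinner_l2 (\<Sum>n\<in>S. a n *\<^sub>C u n) (u m) = a m"
  using S by (simp add: cinner_l2_sum cinner_l2_scale orth if_distrib cong: if_cong)

lemma norm_orthonormal_sum: "(norm (\<Sum>n\<in>S. a n *\<^sub>C u n))\<^sup>2 = (\<Sum>n\<in>S. (norm (a n))\<^sup>2)"
proof -
  let ?s = "\<Sum>n\<in>S. a n *\<^sub>C u n"
  have "complex_of_real ((norm ?s)\<^sup>2) = (\<Sum>n\<in>S. a n * cinner_l2 (u n) ?s)"
    unfolding cinner_l2_self[symmetric] by (subst cinner_l2_sum) (simp add: cinner_l2_scale)
  also have "\<dots> = (\<Sum>n\<in>S. a n * cnj (a n))"
    by (intro sum.cong refl arg_cong2[where f="(*)"], subst cinner_l2_commute)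
      (simp add: cinner_orthonormal_sum)
  also have "\<dots> = of_real (\<Sum>n\<in>S. (norm (a n))\<^sup>2)"
    by (simp only: of_real_sum complex_norm_square)
  finally show ?thesis by (simp only: of_real_eq_iff)
qed

text \<open>Both cross terms equal the squared norm of the projection, so one copy of it is left
  with a minus sign.\<close>

lemma norm_diff_orthonormal_proj:
  "(norm (y - (\<Sum>n\<in>S. cinner_l2 y (u n) *\<^sub>C u n)))\<^sup>2 = (norm y)\<^sup>2 - (\<Sum>n\<in>S. (norm (cinner_l2 y (u n)))\<^sup>2)"
proof -
  let ?s = "\<Sum>n\<in>S. cinner_l2 y (u n) *\<^sub>C u n"
  have sy: "cinner_l2 ?s y = of_real (\<Sum>n\<in>S. (norm (cinner_l2 y (u n)))\<^sup>2)"
    by (simp only: cinner_l2_sum cinner_l2_scale of_real_sum complex_norm_square cinner_l2_commute[symmetric])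
  have ys: "cinner_l2 y ?s = of_real (\<Sum>n\<in>S. (norm (cinner_l2 y (u n)))\<^sup>2)"
    by (subst cinner_l2_commute) (simp add: sy)
  have "complex_of_real ((norm (y - ?s))\<^sup>2) = of_real ((norm y)\<^sup>2 - (\<Sum>n\<in>S. (norm (cinner_l2 y (u n)))\<^sup>2))"
    unfolding cinner_l2_self[symmetric] cinner_l2_diff sy ys
    by (simp add: cinner_l2_self norm_orthonormal_sum)
  then show ?thesis by (simp only: of_real_eq_iff)
qed

lemma bessel: "(\<Sum>n\<in>S. (norm (cinner_l2 y (u n)))\<^sup>2) \<le> (norm y)\<^sup>2"
  using norm_diff_orthonormal_proj[of y] by (smt (verit) zero_le_power2)

end

section \<open>Fourier modes and the coefficients of derivatives\<close>

definition fourier_mode :: "int \<Rightarrow> l2" where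
  "fourier_mode n = abs_l2 (\<lambda>x. cis (2 * pi * of_int n * x))"

lemma square_int_fourier_mode [simp]: "square_int (\<lambda>x. cis (2 * pi * of_int n * x))"
  by (intro square_int_continuous continuous_intros)

lemma cis_linear_has_vector_derivative:
  "((\<lambda>x. cis (c * x)) has_vector_derivative (\<i> * of_real c) * cis (c * x)) (at x within A)"
  using exp_scaleR_has_vector_derivative_right[of "\<i> * of_real c" x A]
  by (simp add: cis_conv_exp scaleR_conv_of_real mult_ac)

lemma integral_fourier_mode: "(LINT x|unit_leb. cis (2 * pi * of_int n * x)) = (if n = 0 then 1 else 0)"
proof (cases "n = 0")
  case False
  let ?c = "2 * pi * of_int n"
  have c: "?c \<noteq> 0" using False by simp
  have "((\<lambda>x. (\<i> * of_real ?c) * cis (?c * x)) has_integral cis (?c * 1) - cis (?c * 0)) {0..1}"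
    by (intro fundamental_theorem_of_calculus cis_linear_has_vector_derivative) auto
  moreover have "cis (?c * 1) = 1" using cis_multiple_2pi[of "of_int n"] by simp
  ultimately have "integral {0..1} (\<lambda>x. (\<i> * of_real ?c) * cis (?c * x)) = 0"
    by (auto dest: integral_unique)
  then have "integral {0..1} (\<lambda>x. cis (?c * x)) = 0" using c by simp
  moreover have "(LINT x|unit_leb. cis (?c * x)) = integral {0..1} (\<lambda>x. cis (?c * x))"
    by (intro integral_unit_leb_eq continuous_integrable_unit_leb continuous_intros)
  ultimately show ?thesis using False by simp
qed simp

lemma fourier_mode_orthonormal: "cinner_l2 (fourier_mode m) (fourier_mode n) = (if m = n then 1 else 0)"
proof -
  have "cinner_l2 (fourier_mode m) (fourier_mode n) = (LINT x|unit_leb. cis (2 * pi * of_int (m - n) * x))"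
    unfolding fourier_mode_def cinner_abs_l2[OF square_int_fourier_mode square_int_fourier_mode]
    by (simp add: cis_cnj cis_mult algebra_simps)
  then show ?thesis using integral_fourier_mode[of "m - n"] by simp
qed

lemma norm_fourier_mode [simp]: "norm (fourier_mode n) = 1"
proof -
  have "complex_of_real ((norm (fourier_mode n))\<^sup>2) = of_real 1"
    by (simp only: cinner_l2_self[symmetric] fourier_mode_orthonormal) simp
  then have "(norm (fourier_mode n))\<^sup>2 = 1" by (simp only: of_real_eq_iff)
  then show ?thesis by (simp add: abs_square_eq_1)
qed

lemma cinner_fourier_mode:
  "square_int f \<Longrightarrow> cinner_l2 (abs_l2 f) (fourier_mode n) = (LINT x|unit_leb. f x * cis (- (2 * pi * of_int n) * x))"
  unfolding fourier_mode_def by (simp add: cinner_abs_l2 cis_cnj)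

lemma bessel_fourier: "finite S \<Longrightarrow> (\<Sum>n\<in>S. (norm (cinner_l2 y (fourier_mode n)))\<^sup>2) \<le> (norm y)\<^sup>2"
  by (rule bessel) (simp_all add: fourier_mode_orthonormal)

lemma norm_cinner_fourier_le: "norm (cinner_l2 y (fourier_mode n)) \<le> norm y"
  using norm_cinner_l2_le[of y "fourier_mode n"] by simp

lemma has_weak_deriv_fourier_mode:
  "has_weak_deriv (fourier_mode n) ((\<i> * of_real (2 * pi * of_int n)) *\<^sub>C fourier_mode n)"
proof -
  let ?c = "2 * pi * real_of_int n" and ?d = "\<i> * of_real (2 * pi * of_int n)"
  let ?g = "\<lambda>x. ?d * cis (?c * x)"
  have g: "square_int ?g" by (intro square_int_continuous continuous_intros)
  have "1 + primitive ?g x = cis (?c * x)" if "x \<in> {0..1}" for x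
  proof -
    have "(?g has_integral cis (?c * x) - cis (?c * 0)) {0..x}"
      using that by (intro fundamental_theorem_of_calculus cis_linear_has_vector_derivative) auto
    then show ?thesis unfolding primitive_def by (auto dest: integral_unique)
  qed
  then have "abs_l2 (\<lambda>x. 1 + primitive ?g x) = fourier_mode n"
    unfolding fourier_mode_def abs_l2_eq_iff[OF square_int_primitive[OF square_int_integrable[OF g]] square_int_fourier_mode]
    by (intro AE_I2) simp
  moreover have "abs_l2 ?g = ?d *\<^sub>C fourier_mode n"
    unfolding fourier_mode_def by (subst abs_l2_cscale) auto
  ultimately show ?thesis using has_weak_deriv_primitive[OF g, of 1] by simp
qed

lemma point_value_fourier_mode: "point_value (fourier_mode n) 1 = 1" "point_value (fourier_mode n) 0 = 1"
proof -
  have "cis (2 * pi * of_int n) = 1" by (rule cis_multiple_2pi) simp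
  moreover have "continuous_on {0..1} (\<lambda>x. cis (2 * pi * of_int n * x))" by (intro continuous_intros)
  ultimately show "point_value (fourier_mode n) 1 = 1" "point_value (fourier_mode n) 0 = 1"
    unfolding fourier_mode_def by (simp_all add: point_value_abs_l2)
qed

text \<open>Integration by parts against the conjugate mode; the boundary term
  \<open>primitive g 1\<close> measures the failure of periodicity. The constant \<open>c\<close>
  has no effect: the prefactor is zero for \<open>n = 0\<close>, and otherwise the mode has mean
  zero.\<close>

lemma fourier_coeff_primitive:
  assumes g: "integrable unit_leb g"
  shows "(LINT x|unit_leb. g x * cis (- (2 * pi * of_int n) * x)) =
    primitive g 1 + (\<i> * of_real (2 * pi * of_int n)) * cinner_l2 (abs_l2 (\<lambda>x. c + primitive g x)) (fourier_mode n)"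
proof -
  let ?c = "- (2 * pi * real_of_int n)"
  have i1: "integrable unit_leb (\<lambda>x. c * cis (?c * x))"
    by (intro continuous_integrable_unit_leb continuous_intros)
  have i2: "integrable unit_leb (\<lambda>x. primitive g x * cis (?c * x))"
    by (intro continuous_integrable_unit_leb continuous_intros continuous_on_primitive g)
  have c0: "(\<i> * of_real ?c) * (LINT x|unit_leb. c * cis (?c * x)) = 0"
    using integral_fourier_mode[of "- n"] by simp
  have "cis ?c = 1" using cis_multiple_2pi[of "of_int (- n)"] by simp
  then have "primitive g 1 - (LINT x|unit_leb. g x * cis (?c * x))
      = (LINT x|unit_leb. primitive g x * ((\<i> * of_real ?c) * cis (?c * x)))"
    using primitive_by_parts[OF g cis_linear_has_vector_derivative[of ?c]]
    by (simp add: continuous_intros)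
  also have "\<dots> = (\<i> * of_real ?c) * (LINT x|unit_leb. primitive g x * cis (?c * x))"
    by (simp only: integral_mult_right_zero[symmetric] ac_simps)
  also have "\<dots> = (\<i> * of_real ?c) * (LINT x|unit_leb. (c + primitive g x) * cis (?c * x))"
    using c0 i1 i2 by (simp only: distrib_right Bochner_Integration.integral_add distrib_left) simp
  also have "\<dots> = (\<i> * of_real ?c) * cinner_l2 (abs_l2 (\<lambda>x. c + primitive g x)) (fourier_mode n)"
    by (simp add: cinner_fourier_mode square_int_primitive g)
  finally show ?thesis by (simp add: algebra_simps)
qed

text \<open>Periodicity of \<open>y\<close> is precisely the vanishing of the boundary term
  \<open>primitive f 1\<close>.\<close>

lemma fourier_coeff_weak_deriv:
  assumes wd: "has_weak_deriv y g" and per: "point_value y 1 = point_value y 0"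
  shows "cinner_l2 g (fourier_mode n) = (\<i> * of_real (2 * pi * of_int n)) * cinner_l2 y (fourier_mode n)"
proof -
  obtain f where f: "square_int f" "g = abs_l2 f" by (rule l2_cases)
  obtain c where c: "y = abs_l2 (\<lambda>x. c + primitive f x)"
    using has_weak_deriv_imp_primitive f wd by blast
  have fi: "integrable unit_leb f" using f(1) by (rule square_int_integrable)
  have "continuous_on {0..1} (\<lambda>x. c + primitive f x)"
    by (intro continuous_intros continuous_on_primitive fi)
  then have "primitive f 1 = 0"
    using per by (simp add: c point_value_abs_l2)
  then show ?thesis
    using fourier_coeff_primitive[OF fi, of n c] f by (simp add: c cinner_fourier_mode)
qed

text \<open>Mean zero of \<open>f\<close> makes its primitive close up at \<open>1\<close>. The
  constant gives the antiderivative mean zero as well, so that the construction can be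
  iterated.\<close>

lemma periodic_antiderivative_exists:
  assumes g: "square_int f" "cinner_l2 (abs_l2 f) (fourier_mode 0) = 0"
  obtains c where "has_weak_deriv (abs_l2 (\<lambda>x. c + primitive f x)) (abs_l2 f)"
    "point_value (abs_l2 (\<lambda>x. c + primitive f x)) 1 = point_value (abs_l2 (\<lambda>x. c + primitive f x)) 0"
    "cinner_l2 (abs_l2 (\<lambda>x. c + primitive f x)) (fourier_mode 0) = 0"
    "continuous_on {0..1} (\<lambda>x. c + primitive f x)"
proof -
  have fi: "integrable unit_leb f" using g(1) by (rule square_int_integrable)
  have cp: "continuous_on {0..1} (primitive f)" by (rule continuous_on_primitive[OF fi])
  define c where "c = - (LINT x|unit_leb. primitive f x)"
  have cont: "continuous_on {0..1} (\<lambda>x. c + primitive f x)" by (intro continuous_intros cp)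
  have "primitive f 1 = 0" using g by (simp add: primitive_1 fi cinner_fourier_mode)
  then have "point_value (abs_l2 (\<lambda>x. c + primitive f x)) 1 = point_value (abs_l2 (\<lambda>x. c + primitive f x)) 0"
    by (simp add: point_value_abs_l2 cont)
  moreover have "cinner_l2 (abs_l2 (\<lambda>x. c + primitive f x)) (fourier_mode 0) = 0"
  proof -
    have "cinner_l2 (abs_l2 (\<lambda>x. c + primitive f x)) (fourier_mode 0) = (LINT x|unit_leb. c + primitive f x)"
      by (simp add: cinner_fourier_mode square_int_primitive fi)
    also have "\<dots> = (LINT x|unit_leb. c) + (LINT x|unit_leb. primitive f x)"
      by (intro Bochner_Integration.integral_add continuous_integrable_unit_leb cp continuous_intros)
    finally show ?thesis by (simp add: c_def)
  qed
  ultimately show ?thesis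
    using that has_weak_deriv_primitive[OF g(1)] cont by blast
qed


section \<open>Totality of the Fourier modes\<close>

lemma has_vector_derivative_difference_quotient:
  fixes f :: "real \<Rightarrow> complex"
  assumes "(f has_vector_derivative d) (at x)"
  shows "((\<lambda>y. (f y - f x) / of_real (y - x)) \<longlongrightarrow> d) (at x)"
proof -
  have "(\<lambda>y. (f y - f x - (y - x) *\<^sub>R d) /\<^sub>R norm (y - x)) \<midarrow>x\<rightarrow> 0"
    using assms unfolding has_vector_derivative_def has_derivative_at_within by simp
  then have "(\<lambda>y. norm ((f y - f x - (y - x) *\<^sub>R d) /\<^sub>R norm (y - x))) \<midarrow>x\<rightarrow> 0"
    by (rule tendsto_norm_zero)
  moreover have "\<forall>\<^sub>F y in at x. norm ((f y - f x - (y - x) *\<^sub>R d) /\<^sub>R norm (y - x))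
      = norm ((f y - f x) / of_real (y - x) - d)"
    unfolding eventually_at_filter
  proof (rule always_eventually, intro allI impI)
    fix y assume "y \<noteq> x"
    then have "(f y - f x) / of_real (y - x) - d = (f y - f x - (y - x) *\<^sub>R d) / of_real (y - x)"
      by (simp add: scaleR_conv_of_real field_simps)
    then show "norm ((f y - f x - (y - x) *\<^sub>R d) /\<^sub>R norm (y - x)) = norm ((f y - f x) / of_real (y - x) - d)"
      by (simp only: norm_divide norm_scaleR norm_of_real) (simp add: divide_inverse)
  qed
  ultimately have "(\<lambda>y. norm ((f y - f x) / of_real (y - x) - d)) \<midarrow>x\<rightarrow> 0"
    by (rule Lim_transform_eventually)
  then show ?thesis by (simp add: tendsto_norm_zero_iff LIM_zero_iff)
qed

text \<open>An interior \<open>x0\<close> avoids the one coincidence on \<open>[0,1]\<close>, that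
  of the two endpoints.\<close>

lemma cis_2pi_eq_iff:
  assumes "x \<in> {0..1}" "0 < x0" "x0 < 1"
  shows "cis (2 * pi * x) = cis (2 * pi * x0) \<longleftrightarrow> x = x0"
proof
  assume "cis (2 * pi * x) = cis (2 * pi * x0)"
  then have "cis (2 * pi * x) / cis (2 * pi * x0) = 1" by simp
  then have "cis (2 * pi * (x - x0)) = 1" by (simp add: cis_divide algebra_simps)
  then have "cos (2 * pi * (x - x0)) = 1" by (metis cis.simps(1) one_complex.simps(1))
  then obtain n :: int where "2 * pi * (x - x0) = of_int n * 2 * pi"
    by (auto simp: cos_one_2pi_int)
  then have n: "x - x0 = of_int n" by simp
  then have "real_of_int n < 1" "real_of_int n > -1" using assms by auto
  then have "n = 0" by linarith
  then show "x = x0" using n by simp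
qed simp

text \<open>With \<open>h = (F - F x\<^sub>0) / (e\<^sub>1 - e\<^sub>1 x\<^sub>0)\<close> the Fourier coefficients satisfy
  \<open>h\<^sub>n\<^sub>-\<^sub>1 - e\<^sub>1(x\<^sub>0) h\<^sub>n = - F(x\<^sub>0) \<delta>\<^sub>n\<^sub>0\<close>. So \<open>\<bar>h\<^sub>n\<bar>\<close> is constant on each half-line,
  and Bessel's inequality forces these constants to vanish.\<close>

lemma zero_if_fourier_coeffs_zero_pointwise:
  fixes F :: "real \<Rightarrow> complex"
  assumes c: "continuous_on {0..1} F" and x0: "0 < x0" "x0 < 1"
    and d: "(F has_vector_derivative d) (at x0)"
    and zero: "\<And>n. cinner_l2 (abs_l2 F) (fourier_mode n) = 0"
  shows "F x0 = 0"
proof -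
  define E where "E = (\<lambda>x. cis (2 * pi * x))"
  define q where "q = (\<lambda>x. (F x - F x0) / (E x - E x0))"
  \<comment> \<open>The limit of \<open>q\<close> at \<open>x0\<close>, a ratio of derivatives;
    filling it in makes \<open>h\<close> continuous, hence square integrable.\<close>
  define d' where "d' = d / ((\<i> * of_real (2 * pi)) * E x0)"
  define h where "h = (\<lambda>x. if x = x0 then d' else q x)"
  have cE: "continuous_on A E" for A unfolding E_def by (intro continuous_intros)
  have E_neq: "E x \<noteq> E x0" if "x \<in> {0..1}" "x \<noteq> x0" for x
    using cis_2pi_eq_iff[OF that(1) x0] that(2) by (simp add: E_def)
  have qlim: "(q \<longlongrightarrow> d') (at x0)"
  proof -
    have "((\<lambda>y. ((F y - F x0) / of_real (y - x0)) / ((E y - E x0) / of_real (y - x0))) \<longlongrightarrow> d') (at x0)"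
      unfolding d'_def
      by (intro tendsto_divide has_vector_derivative_difference_quotient d)
        (use cis_linear_has_vector_derivative[of "2 * pi" x0 UNIV] in \<open>auto simp: E_def\<close>)
    moreover have "\<forall>\<^sub>F y in at x0. ((F y - F x0) / of_real (y - x0)) / ((E y - E x0) / of_real (y - x0)) = q y"
      unfolding eventually_at_filter by (rule always_eventually) (auto simp: q_def)
    ultimately show ?thesis by (rule Lim_transform_eventually)
  qed
  have ch: "continuous_on {0..1} h"
    unfolding continuous_on_def
  proof
    fix x :: real assume x: "x \<in> {0..1}"
    show "(h \<longlongrightarrow> h x) (at x within {0..1})"
    proof (cases "x = x0")
      case True
      have "(q \<longlongrightarrow> d') (at x0 within {0..1})" using qlim by (rule tendsto_within_subset) simp
      moreover have "\<forall>\<^sub>F y in at x0 within {0..1}. q y = h y"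
        unfolding eventually_at_filter by (rule always_eventually) (auto simp: h_def)
      ultimately have "(h \<longlongrightarrow> d') (at x0 within {0..1})" by (rule Lim_transform_eventually)
      then show ?thesis using True by (simp add: h_def)
    next
      case False
      have "(q \<longlongrightarrow> q x) (at x within {0..1})"
        unfolding q_def using c cE[of "{0..1}"] x E_neq[OF x False]
        by (intro tendsto_intros) (auto simp: continuous_on_def)
      moreover have "\<forall>\<^sub>F y in at x within {0..1}. q y = h y"
      proof -
        have "\<forall>\<^sub>F y in at x within {0..1}. y \<noteq> x0"
          by (rule tendsto_imp_eventually_ne[OF tendsto_ident_at False])
        then show ?thesis by eventually_elim (simp add: h_def)
      qed
      ultimately have "(h \<longlongrightarrow> q x) (at x within {0..1})" by (rule Lim_transform_eventually)
      then show ?thesis using False by (simp add: h_def)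
    qed
  qed
  define hc where "hc = (\<lambda>n. cinner_l2 (abs_l2 h) (fourier_mode n))"
  have sh: "square_int h" using ch by (rule square_int_continuous)
  \<comment> \<open>The conjugate mode of index \<open>n - 1\<close> is \<open>E\<close> times that
    of index \<open>n\<close>. The left side is therefore the \<open>n\<close>-th coefficient of
    \<open>h * (E - E x0) = F - F x0\<close>, to which only the constant contributes.\<close>
  have rec: "hc (n - 1) - E x0 * hc n = (if n = 0 then - F x0 else 0)" for n
  proof -
    let ?e = "\<lambda>n x. cis (- (2 * pi * of_int n) * x)"
    have ih: "integrable unit_leb (\<lambda>x. h x * ?e m x)" for m
      by (intro continuous_integrable_unit_leb continuous_intros ch)
    have "hc (n - 1) - E x0 * hc n = (LINT x|unit_leb. h x * ?e (n - 1) x) - (LINT x|unit_leb. E x0 * (h x * ?e n x))"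
      unfolding hc_def cinner_fourier_mode[OF sh] by (simp only: integral_mult_right_zero)
    also have "\<dots> = (LINT x|unit_leb. h x * ?e (n - 1) x - E x0 * (h x * ?e n x))"
      by (intro Bochner_Integration.integral_diff[symmetric] ih integrable_mult_right)
    also have "\<dots> = (LINT x|unit_leb. F x * ?e n x - F x0 * ?e n x)"
    proof (intro Bochner_Integration.integral_cong refl)
      fix x assume "x \<in> space unit_leb"
      then have x: "x \<in> {0..1}" by simp
      have "h x * (E x - E x0) = F x - F x0"
        using E_neq[OF x] by (simp add: h_def q_def)
      moreover have "?e (n - 1) x = E x * ?e n x"
        by (simp add: E_def cis_mult algebra_simps)
      moreover have "h x * (E x * ?e n x) - E x0 * (h x * ?e n x) = (h x * (E x - E x0)) * ?e n x"
        by (simp add: algebra_simps)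
      ultimately show "h x * ?e (n - 1) x - E x0 * (h x * ?e n x) = F x * ?e n x - F x0 * ?e n x"
        by (simp only: left_diff_distrib)
    qed
    also have "\<dots> = (LINT x|unit_leb. F x * ?e n x) - (LINT x|unit_leb. F x0 * ?e n x)"
      by (intro Bochner_Integration.integral_diff continuous_integrable_unit_leb continuous_intros c)
    also have "(LINT x|unit_leb. F x * ?e n x) = 0"
      using zero[of n] by (simp only: cinner_fourier_mode[OF square_int_continuous[OF c]])
    also have "(LINT x|unit_leb. F x0 * ?e n x) = F x0 * (LINT x|unit_leb. ?e n x)"
      by (rule integral_mult_right_zero)
    also have "(LINT x|unit_leb. ?e n x) = (if n = 0 then 1 else 0)"
      using integral_fourier_mode[of "- n"] by simp
    finally show ?thesis by simp
  qed
  have step: "norm (hc (n - 1)) = norm (hc n)" if "n \<noteq> 0" for n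
  proof -
    have "hc (n - 1) = E x0 * hc n" using rec[of n] that by simp
    then show ?thesis by (simp add: norm_mult E_def)
  qed
  have up: "norm (hc (int k)) = norm (hc 0)" for k
    by (induction k) (use step[of "1 + int k" for k] in auto)
  \<comment> \<open>The moduli can change only in the relation for \<open>n = 0\<close>, which links
    the indices \<open>-1\<close> and \<open>0\<close>; so the negative half-line starts at
    \<open>-1\<close>.\<close>
  have down: "norm (hc (- 1 - int k)) = norm (hc (- 1))" for k
    by (induction k) (use step[of "- 1 - int k" for k] in \<open>auto simp: algebra_simps\<close>)
  have vanish: "b = 0" if inj: "inj f" and b: "\<And>k. norm (hc (f k)) = b" for f :: "nat \<Rightarrow> int" and b
  proof (rule ccontr)
    assume "b \<noteq> 0"
    then have "b\<^sup>2 > 0" by simp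
    then obtain N :: nat where N: "real N * b\<^sup>2 > (norm (abs_l2 h))\<^sup>2"
      using ex_less_of_nat_mult by blast
    have "(\<Sum>n\<in>f ` {..<N}. (norm (hc n))\<^sup>2) \<le> (norm (abs_l2 h))\<^sup>2"
      unfolding hc_def by (rule bessel_fourier) simp
    moreover have "(\<Sum>n\<in>f ` {..<N}. (norm (hc n))\<^sup>2) = (\<Sum>k<N. b\<^sup>2)"
      using inj b by (simp add: sum.reindex inj_on_def inj_def)
    ultimately show False using N by simp
  qed
  have "norm (hc 0) = 0" by (rule vanish[of int]) (use up in auto)
  moreover have "norm (hc (- 1)) = 0"
    by (rule vanish[of "\<lambda>k. - 1 - int k"]) (use down in \<open>auto simp: inj_def\<close>)
  ultimately show ?thesis using rec[of 0] by simp
qed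

text \<open>The pointwise criterion needs a differentiable function, which a general element does
  not offer. Two antiderivatives of mean zero produce one whose coefficients still all vanish; once
  it is zero, uniqueness of weak derivatives carries the zero back to \<open>y\<close>.\<close>

lemma fourier_total:
  assumes zero: "\<And>n. cinner_l2 y (fourier_mode n) = 0"
  shows "y = 0"
proof -
  obtain f where f: "square_int f" "y = abs_l2 f" by (rule l2_cases)
  obtain c where c: "has_weak_deriv (abs_l2 (\<lambda>x. c + primitive f x)) (abs_l2 f)"
    "point_value (abs_l2 (\<lambda>x. c + primitive f x)) 1 = point_value (abs_l2 (\<lambda>x. c + primitive f x)) 0"
    "cinner_l2 (abs_l2 (\<lambda>x. c + primitive f x)) (fourier_mode 0) = 0"
    "continuous_on {0..1} (\<lambda>x. c + primitive f x)"
    using periodic_antiderivative_exists[OF f(1)] zero f(2) by metis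
  define G where "G = (\<lambda>x. c + primitive f x)"
  have sG: "square_int G" using c(4) unfolding G_def by (rule square_int_continuous)
  have cG: "cinner_l2 (abs_l2 G) (fourier_mode n) = 0" for n
  proof (cases "n = 0")
    case False
    then show ?thesis using fourier_coeff_weak_deriv[OF c(1,2), of n] zero f(2) by (simp add: G_def)
  qed (use c(3) in \<open>simp add: G_def\<close>)
  obtain c' where c': "has_weak_deriv (abs_l2 (\<lambda>x. c' + primitive G x)) (abs_l2 G)"
    "point_value (abs_l2 (\<lambda>x. c' + primitive G x)) 1 = point_value (abs_l2 (\<lambda>x. c' + primitive G x)) 0"
    "cinner_l2 (abs_l2 (\<lambda>x. c' + primitive G x)) (fourier_mode 0) = 0"
    "continuous_on {0..1} (\<lambda>x. c' + primitive G x)"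
    using periodic_antiderivative_exists[OF sG cG] by metis
  define F where "F = (\<lambda>x. c' + primitive G x)"
  have sF: "square_int F" using c'(4) unfolding F_def by (rule square_int_continuous)
  have cF: "cinner_l2 (abs_l2 F) (fourier_mode n) = 0" for n
  proof (cases "n = 0")
    case False
    then show ?thesis using fourier_coeff_weak_deriv[OF c'(1,2), of n] cG by (simp add: F_def)
  qed (use c'(3) in \<open>simp add: F_def\<close>)
  have "F x = 0" if x: "x \<in> {0<..<1}" for x
  proof (rule zero_if_fourier_coeffs_zero_pointwise)
    show "continuous_on {0..1} F" using c'(4) by (simp add: F_def)
    show "0 < x" "x < 1" using x by auto
    have "at x within {0..1} = at x" using x by (intro at_within_interior) auto
    then have "(primitive G has_vector_derivative G x) (at x)"
      using primitive_has_vector_derivative[of G x] c(4) x by (simp add: G_def)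
    then show "(F has_vector_derivative G x) (at x)"
      unfolding F_def by (auto intro!: derivative_eq_intros)
    show "cinner_l2 (abs_l2 F) (fourier_mode n) = 0" for n by (rule cF)
  qed
  then have "abs_l2 F = 0"
    unfolding zero_abs_l2 abs_l2_eq_iff[OF sF square_int_zero] by (intro AE_I2) simp
  moreover have "has_weak_deriv 0 0"
    using has_weak_deriv_cscale[OF c(1), of 0] by simp
  ultimately have "abs_l2 G = 0"
    using has_weak_deriv_unique[OF c'(1), of 0] by (simp add: F_def)
  then show ?thesis
    using has_weak_deriv_unique[OF c(1), of 0] f(2) \<open>has_weak_deriv 0 0\<close> by (simp add: G_def)
qed

section \<open>Synthesis from absolutely summable coefficients\<close>

lemma norm_abs_l2_le:
  assumes f: "square_int f" and B: "0 \<le> B" "\<And>x. x \<in> {0<..<1} \<Longrightarrow> norm (f x) \<le> B"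
  shows "norm (abs_l2 f) \<le> B"
proof -
  have "(norm (abs_l2 f))\<^sup>2 = Re (LINT x|unit_leb. f x * cnj (f x))"
    using f by (simp add: power2_norm_eq_inner inner_l2_def cinner_abs_l2)
  also have "\<dots> = (LINT x|unit_leb. (norm (f x))\<^sup>2)" using f by (rule inner_l2_self)
  also have "\<dots> \<le> (LINT x|unit_leb. B\<^sup>2)"
    using f B by (intro integral_mono) (auto simp: square_int_def intro!: power_mono
      integrable_bounded_unit_leb[where B="B\<^sup>2"])
  finally have "(norm (abs_l2 f))\<^sup>2 \<le> B\<^sup>2" by simp
  then show ?thesis using B(1) by (rule power2_le_imp_le)
qed

lemma abs_l2_sum_fourier:
  "finite S \<Longrightarrow> square_int (\<lambda>x. \<Sum>n\<in>S. a n * cis (2 * pi * of_int n * x)) \<and>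
    (\<Sum>n\<in>S. a n *\<^sub>C fourier_mode n) = abs_l2 (\<lambda>x. \<Sum>n\<in>S. a n * cis (2 * pi * of_int n * x))"
proof (induction S rule: finite_induct)
  case empty
  show ?case by (simp add: zero_abs_l2)
next
  case (insert n S)
  have s: "square_int (\<lambda>x. a n * cis (2 * pi * of_int n * x))"
    by (rule square_int_scale) simp
  have "a n *\<^sub>C fourier_mode n = abs_l2 (\<lambda>x. a n * cis (2 * pi * of_int n * x))"
    unfolding fourier_mode_def by (rule abs_l2_cscale) simp
  then show ?case
    using insert s by (simp add: abs_l2_add square_int_add)
qed

text \<open>The Weierstrass test makes the series uniformly convergent, so its sum is continuous and
  defines an element of \<open>l2\<close>. On an interval of length one, uniform convergence implies
  convergence in norm.\<close>

lemma fourier_synthesis: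
  assumes sm: "(\<lambda>n. norm (a n)) summable_on UNIV"
  obtains y where "\<And>n. cinner_l2 y (fourier_mode n) = a n"
    "((\<lambda>S. \<Sum>n\<in>S. a n *\<^sub>C fourier_mode n) \<longlongrightarrow> y) (finite_subsets_at_top UNIV)"
proof -
  let ?t = "\<lambda>n x. a n * cis (2 * pi * of_int n * x)"
  define f where "f = (\<lambda>x. \<Sum>\<^sub>\<infinity>n. ?t n x)"
  have u: "uniform_limit {0..1} (\<lambda>S x. \<Sum>n\<in>S. ?t n x) f (finite_subsets_at_top UNIV)"
    unfolding f_def by (rule Weierstrass_m_test_general[OF _ sm]) (simp add: norm_mult)
  have cf: "continuous_on {0..1} f"
    by (rule uniform_limit_theorem[OF always_eventually u])
      (auto intro!: continuous_intros)
  have sf: "square_int f" using cf by (rule square_int_continuous)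
  have lim: "((\<lambda>S. \<Sum>n\<in>S. a n *\<^sub>C fourier_mode n) \<longlongrightarrow> abs_l2 f) (finite_subsets_at_top UNIV)"
  proof (rule tendstoI)
    fix \<epsilon> :: real assume "\<epsilon> > 0"
    then have "\<forall>\<^sub>F S in finite_subsets_at_top UNIV. \<forall>x\<in>{0..1}. dist (\<Sum>n\<in>S. ?t n x) (f x) < \<epsilon> / 2"
      using u by (intro uniform_limitD) auto
    moreover have "\<forall>\<^sub>F S in finite_subsets_at_top (UNIV :: int set). finite S"
      by (rule eventually_finite_subsets_at_top_weakI)
    ultimately show "\<forall>\<^sub>F S in finite_subsets_at_top UNIV. dist (\<Sum>n\<in>S. a n *\<^sub>C fourier_mode n) (abs_l2 f) < \<epsilon>"
    proof eventually_elim
      case (elim S)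
      have "norm (abs_l2 (\<lambda>x. (\<Sum>n\<in>S. ?t n x) - f x)) \<le> \<epsilon> / 2"
        using elim abs_l2_sum_fourier[of S a] sf \<open>\<epsilon> > 0\<close>
        by (intro norm_abs_l2_le square_int_diff) (auto simp: dist_norm less_imp_le)
      then show ?case
        using elim abs_l2_sum_fourier[of S a] sf \<open>\<epsilon> > 0\<close> by (simp add: dist_norm abs_l2_diff)
    qed
  qed
  have "cinner_l2 (abs_l2 f) (fourier_mode m) = a m" for m
  proof -
    have "\<forall>\<^sub>F S in finite_subsets_at_top UNIV. cinner_l2 (\<Sum>n\<in>S. a n *\<^sub>C fourier_mode n) (fourier_mode m) = a m"
    proof -
      have "\<forall>\<^sub>F S in finite_subsets_at_top UNIV. finite S \<and> {m} \<subseteq> S \<and> S \<subseteq> UNIV"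
        by (auto simp: eventually_finite_subsets_at_top intro: exI[of _ "{m}"])
      then show ?thesis
        by eventually_elim (auto intro: cinner_orthonormal_sum simp: fourier_mode_orthonormal)
    qed
    then have "((\<lambda>S. cinner_l2 (\<Sum>n\<in>S. a n *\<^sub>C fourier_mode n) (fourier_mode m)) \<longlongrightarrow> a m) (finite_subsets_at_top UNIV)"
      by (rule tendsto_eventually)
    then show ?thesis
      using tendsto_unique[OF _ tendsto_cinner_l2[OF lim]] by (metis finite_subsets_at_top_neq_bot)
  qed
  then show ?thesis using lim that by blast
qed

lemma fourier_ext: "(\<And>n. cinner_l2 y (fourier_mode n) = cinner_l2 w (fourier_mode n)) \<Longrightarrow> y = w"
  using fourier_total[of "y - w"] by (simp add: cinner_l2_diff)

text \<open>The synthesized element has the coefficients of \<open>y\<close>, so totality identifies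
  the two.\<close>

lemma fourier_series:
  assumes "(\<lambda>n. norm (cinner_l2 y (fourier_mode n))) summable_on UNIV"
  shows "((\<lambda>S. \<Sum>n\<in>S. cinner_l2 y (fourier_mode n) *\<^sub>C fourier_mode n) \<longlongrightarrow> y) (finite_subsets_at_top UNIV)"
  using fourier_synthesis[OF assms] fourier_ext by metis

text \<open>Both half-lines reduce to the series over the naturals; the term at \<open>0\<close> is
  \<open>1 / 0 = 0\<close>.\<close>

lemma summable_on_inverse_int_squares: "(\<lambda>n::int. 1 / (of_int n)\<^sup>2 :: real) summable_on UNIV"
proof -
  have "summable (\<lambda>n. 1 / (real n)\<^sup>2)"
    using inverse_power_summable[of 2, where 'a=real] by (simp add: inverse_eq_divide)
  then have nat: "(\<lambda>n. 1 / (real n)\<^sup>2) summable_on UNIV"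
    by (subst summable_on_UNIV_nonneg_real_iff) auto
  have "(\<lambda>n::int. 1 / (of_int n)\<^sup>2 :: real) summable_on range int"
    using nat by (subst summable_on_reindex) (auto simp: o_def)
  moreover have "(\<lambda>n::int. 1 / (of_int n)\<^sup>2 :: real) summable_on range (\<lambda>k. - int k)"
    using nat by (subst summable_on_reindex) (auto simp: o_def inj_def)
  ultimately have "(\<lambda>n::int. 1 / (of_int n)\<^sup>2 :: real) summable_on range int \<union> range (\<lambda>k. - int k)"
    by (rule summable_on_union)
  moreover have "range int \<union> range (\<lambda>k. - int k) = UNIV"
    by (auto simp: image_def) (metis int_cases2)
  ultimately show ?thesis by simp
qed


section \<open>The unperturbed operator\<close>

text \<open>Pairs a derivative with the boundary condition on the function differentiated. A chain
  of three such steps is exactly membership in \<open>L_dom\<close> and avoids the description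
  operator in \<open>weak_deriv\<close>; see \<open>L_domE\<close> and
  \<open>L_domI\<close>.\<close>

definition periodic_deriv :: "l2 \<Rightarrow> l2 \<Rightarrow> bool" where
  "periodic_deriv y g \<longleftrightarrow> has_weak_deriv y g \<and> point_value y 1 = point_value y 0"

lemma has_weak_deriv_continuous:
  assumes "has_weak_deriv y g"
  obtains f where "continuous_on {0..1} f" "y = abs_l2 f"
proof -
  obtain h where h: "square_int h" "g = abs_l2 h" by (rule l2_cases)
  obtain c where c: "y = abs_l2 (\<lambda>x. c + primitive h x)"
    using has_weak_deriv_imp_primitive h assms by blast
  have "continuous_on {0..1} (\<lambda>x. c + primitive h x)"
    by (intro continuous_intros continuous_on_primitive square_int_integrable h)
  then show ?thesis using c that by blast
qed

lemma periodic_deriv_add: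
  assumes "periodic_deriv y g" "periodic_deriv y' g'"
  shows "periodic_deriv (y + y') (g + g')"
proof -
  have wd: "has_weak_deriv y g" "has_weak_deriv y' g'" using assms by (auto simp: periodic_deriv_def)
  obtain f where f: "continuous_on {0..1} f" "y = abs_l2 f" by (rule has_weak_deriv_continuous[OF wd(1)])
  obtain f' where f': "continuous_on {0..1} f'" "y' = abs_l2 f'" by (rule has_weak_deriv_continuous[OF wd(2)])
  have "y + y' = abs_l2 (\<lambda>x. f x + f' x)"
    using f f' by (simp add: abs_l2_add square_int_continuous)
  moreover have "continuous_on {0..1} (\<lambda>x. f x + f' x)" using f f' by (intro continuous_intros)
  ultimately show ?thesis
    using assms has_weak_deriv_add[OF wd] f f' by (simp add: periodic_deriv_def point_value_abs_l2)
qed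

lemma periodic_deriv_cscale:
  assumes "periodic_deriv y g"
  shows "periodic_deriv (c *\<^sub>C y) (c *\<^sub>C g)"
proof -
  have wd: "has_weak_deriv y g" using assms by (auto simp: periodic_deriv_def)
  obtain f where f: "continuous_on {0..1} f" "y = abs_l2 f" by (rule has_weak_deriv_continuous[OF wd])
  have "c *\<^sub>C y = abs_l2 (\<lambda>x. c * f x)"
    using f by (simp add: abs_l2_cscale square_int_continuous)
  moreover have "continuous_on {0..1} (\<lambda>x. c * f x)" using f by (intro continuous_intros)
  ultimately show ?thesis
    using assms has_weak_deriv_cscale[OF wd, of c] f by (simp add: periodic_deriv_def point_value_abs_l2)
qed

lemma periodic_deriv_fourier_mode:
  "periodic_deriv (fourier_mode n) ((\<i> * of_real (2 * pi * of_int n)) *\<^sub>C fourier_mode n)"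
  using has_weak_deriv_fourier_mode by (simp add: periodic_deriv_def point_value_fourier_mode)

lemma fourier_coeff_periodic_deriv:
  "periodic_deriv y g \<Longrightarrow> cinner_l2 g (fourier_mode n) = (\<i> * of_real (2 * pi * of_int n)) * cinner_l2 y (fourier_mode n)"
  unfolding periodic_deriv_def using fourier_coeff_weak_deriv by blast

lemma periodic_deriv_exists:
  assumes "cinner_l2 g (fourier_mode 0) = 0"
  obtains y where "periodic_deriv y g" "cinner_l2 y (fourier_mode 0) = 0"
proof -
  obtain f where f: "square_int f" "g = abs_l2 f" by (rule l2_cases)
  show ?thesis
    using periodic_antiderivative_exists[OF f(1)] assms that unfolding f(2) periodic_deriv_def by metis
qed

definition A_op :: "l2 \<Rightarrow> l2" where
  "A_op y = \<i> *\<^sub>C weak_deriv (weak_deriv (weak_deriv y))"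

lemma L_op_eq: "L_op \<alpha> v y = A_op y + (of_real \<alpha> * cinner_l2 y v) *\<^sub>C v"
  by (simp add: L_op_def A_op_def)

lemma L_domE:
  assumes "y \<in> L_dom"
  obtains y1 y2 y3 where "periodic_deriv y y1" "periodic_deriv y1 y2" "periodic_deriv y2 y3" "A_op y = \<i> *\<^sub>C y3"
proof -
  from assms obtain y1 y2 y3 where wd: "has_weak_deriv y y1" "has_weak_deriv y1 y2" "has_weak_deriv y2 y3"
    unfolding L_dom_def numeral_3_eq_3 by auto
  note [simp] = weak_deriv_eq[OF wd(1)] weak_deriv_eq[OF wd(2)] weak_deriv_eq[OF wd(3)]
  show ?thesis
    using assms by (intro that[of y1 y2 y3]) (auto simp: wd L_dom_def periodic_deriv_def A_op_def)
qed

lemma L_domI: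
  assumes "periodic_deriv y y1" "periodic_deriv y1 y2" "periodic_deriv y2 y3"
  shows "y \<in> L_dom" and "A_op y = \<i> *\<^sub>C y3"
proof -
  have wd: "has_weak_deriv y y1" "has_weak_deriv y1 y2" "has_weak_deriv y2 y3"
    using assms by (auto simp: periodic_deriv_def)
  note [simp] = weak_deriv_eq[OF wd(1)] weak_deriv_eq[OF wd(2)] weak_deriv_eq[OF wd(3)]
  show "A_op y = \<i> *\<^sub>C y3" by (simp add: A_op_def)
  show "y \<in> L_dom"
    using assms wd unfolding L_dom_def numeral_3_eq_3 by (auto simp: periodic_deriv_def)
qed

lemma L_dom_add:
  assumes "y \<in> L_dom" "w \<in> L_dom"
  shows "y + w \<in> L_dom" and "A_op (y + w) = A_op y + A_op w"
proof -
  obtain y1 y2 y3 where y: "periodic_deriv y y1" "periodic_deriv y1 y2" "periodic_deriv y2 y3" "A_op y = \<i> *\<^sub>C y3"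
    by (rule L_domE[OF assms(1)])
  obtain w1 w2 w3 where w: "periodic_deriv w w1" "periodic_deriv w1 w2" "periodic_deriv w2 w3" "A_op w = \<i> *\<^sub>C w3"
    by (rule L_domE[OF assms(2)])
  note L = L_domI[OF periodic_deriv_add[OF y(1) w(1)] periodic_deriv_add[OF y(2) w(2)] periodic_deriv_add[OF y(3) w(3)]]
  show "y + w \<in> L_dom" by (rule L(1))
  show "A_op (y + w) = A_op y + A_op w" using L(2) y(4) w(4) by (simp add: l2.scale_right_distrib)
qed

lemma L_dom_cscale:
  assumes "y \<in> L_dom"
  shows "c *\<^sub>C y \<in> L_dom" and "A_op (c *\<^sub>C y) = c *\<^sub>C A_op y"
proof -
  obtain y1 y2 y3 where y: "periodic_deriv y y1" "periodic_deriv y1 y2" "periodic_deriv y2 y3" "A_op y = \<i> *\<^sub>C y3"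
    by (rule L_domE[OF assms])
  note L = L_domI[OF periodic_deriv_cscale[OF y(1)] periodic_deriv_cscale[OF y(2)] periodic_deriv_cscale[OF y(3)], of c]
  show "c *\<^sub>C y \<in> L_dom" by (rule L(1))
  show "A_op (c *\<^sub>C y) = c *\<^sub>C A_op y" using L(2) y(4) by (simp add: mult.commute)
qed

lemma L_dom_diff:
  assumes "y \<in> L_dom" "w \<in> L_dom"
  shows "y - w \<in> L_dom" and "A_op (y - w) = A_op y - A_op w"
  using L_dom_add[OF assms(1) L_dom_cscale(1)[OF assms(2), of "-1"]] L_dom_cscale(2)[OF assms(2), of "-1"]
  by simp_all

section \<open>Unperturbed eigenvalues: growth and spacing\<close>

definition mode_eig :: "int \<Rightarrow> real" where
  "mode_eig n = (2 * pi * of_int n) ^ 3"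

text \<open>Four factors \<open>i\<close>, one from the operator and three from the derivatives,
  multiply to \<open>1\<close>; this makes the unperturbed eigenvalues real.\<close>

lemma i_mult_cube: "\<i> * ((\<i> * a) * ((\<i> * a) * ((\<i> * a) * b))) = a ^ 3 * b"
proof -
  have "\<i> * ((\<i> * a) * ((\<i> * a) * ((\<i> * a) * b))) = (\<i> * \<i>) * (\<i> * \<i>) * (a ^ 3 * b)"
    by (simp only: power3_eq_cube ac_simps)
  then show ?thesis by simp
qed

lemma fourier_mode_L_dom:
  "fourier_mode n \<in> L_dom" "A_op (fourier_mode n) = of_real (mode_eig n) *\<^sub>C fourier_mode n"
proof -
  let ?c = "\<i> * complex_of_real (2 * pi * of_int n)"
  note p = periodic_deriv_fourier_mode[of n]
  note L = L_domI[OF p periodic_deriv_cscale[OF p] periodic_deriv_cscale[OF periodic_deriv_cscale[OF p]]]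
  show "fourier_mode n \<in> L_dom" by (rule L(1))
  have "\<i> * (?c * (?c * ?c)) = complex_of_real (mode_eig n)"
    using i_mult_cube[of "of_real (2 * pi * of_int n)" 1] by (simp only: mult_1_right mode_eig_def of_real_power)
  then show "A_op (fourier_mode n) = of_real (mode_eig n) *\<^sub>C fourier_mode n"
    using L(2) by (simp only: l2.scale_scale)
qed

lemma fourier_coeff_A_op:
  assumes "y \<in> L_dom"
  shows "cinner_l2 (A_op y) (fourier_mode n) = of_real (mode_eig n) * cinner_l2 y (fourier_mode n)"
proof -
  obtain y1 y2 y3 where y: "periodic_deriv y y1" "periodic_deriv y1 y2" "periodic_deriv y2 y3" "A_op y = \<i> *\<^sub>C y3"
    by (rule L_domE[OF assms])
  show ?thesis
    by (simp only: y(4) cinner_l2_scale fourier_coeff_periodic_deriv[OF y(1)] fourier_coeff_periodic_deriv[OF y(2)]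
        fourier_coeff_periodic_deriv[OF y(3)] mode_eig_def i_mult_cube of_real_power)
qed

text \<open>In \<open>m^3 - n^3 = (m - n) * (m^2 + m * n + n^2)\<close> the last factor is
  \<open>(m + n / 2)^2 + 3 / 4 * n^2\<close>, the origin of \<open>3 / 4\<close>. The bound involves
  \<open>n\<close> alone because \<open>n\<close> will be the mode of a double eigenvalue and
  \<open>m\<close> any other mode.\<close>

lemma mode_eig_diff_ge:
  assumes "m \<noteq> n" shows "\<bar>mode_eig m - mode_eig n\<bar> \<ge> 3 / 4 * (real_of_int n)\<^sup>2"
proof -
  let ?m = "real_of_int m" and ?n = "real_of_int n"
  have "mode_eig m - mode_eig n = (2 * pi) ^ 3 * ((?m - ?n) * (?m\<^sup>2 + ?m * ?n + ?n\<^sup>2))"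
    unfolding mode_eig_def by (simp add: power_mult_distrib algebra_simps power3_eq_cube power2_eq_square)
  moreover have "?m\<^sup>2 + ?m * ?n + ?n\<^sup>2 = (?m + ?n / 2)\<^sup>2 + 3 / 4 * ?n\<^sup>2"
    by (simp add: power2_eq_square algebra_simps)
  moreover have "(2 * pi) ^ 3 \<ge> 1 ^ 3"
    using pi_gt3 by (intro power_mono) auto
  moreover have "\<bar>?m - ?n\<bar> \<ge> 1" using assms by linarith
  ultimately have "\<bar>mode_eig m - mode_eig n\<bar> \<ge> 1 * (1 * (3 / 4 * ?n\<^sup>2))"
    by (simp only: abs_mult) (intro mult_mono, auto)
  then show ?thesis by simp
qed

lemma mode_eig_inj: "mode_eig m = mode_eig n \<Longrightarrow> m = n"
proof (rule ccontr)
  assume *: "mode_eig m = mode_eig n" "m \<noteq> n"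
  then have "n = 0" "m = 0"
    using mode_eig_diff_ge[of m n] mode_eig_diff_ge[of n m] by (auto simp: mult_le_0_iff)
  then show False using * by simp
qed

text \<open>The constant is \<open>2^3\<close>, from \<open>pi \<ge> 1\<close>. One power of
  \<open>n\<close> is given away, as quadratic growth is what summability asks for.\<close>

lemma abs_mode_eig_ge: "\<bar>mode_eig n\<bar> \<ge> 8 * (real_of_int n)\<^sup>2"
proof (cases "n = 0")
  case False
  then have n: "\<bar>real_of_int n\<bar> \<ge> 1" by linarith
  have p: "(2 * 1) ^ 3 \<le> (2 * pi) ^ 3" using pi_gt3 by (intro power_mono) auto
  have q: "1 * (real_of_int n)\<^sup>2 \<le> \<bar>real_of_int n\<bar> * (real_of_int n)\<^sup>2"
    using n by (rule mult_right_mono) simp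
  have "8 * (real_of_int n)\<^sup>2 = (2 * 1) ^ 3 * (1 * (real_of_int n)\<^sup>2)" by simp
  also have "\<dots> \<le> (2 * pi) ^ 3 * (\<bar>real_of_int n\<bar> * (real_of_int n)\<^sup>2)"
    by (rule mult_mono[OF p q]) auto
  also have "\<dots> = \<bar>mode_eig n\<bar>"
    by (simp add: mode_eig_def abs_mult power_mult_distrib power_abs power3_eq_cube power2_eq_square)
  finally show ?thesis .
qed simp

lemma finite_int_square_le: "finite {n :: int. (real_of_int n)\<^sup>2 \<le> K}"
proof (rule finite_subset)
  show "{n :: int. (real_of_int n)\<^sup>2 \<le> K} \<subseteq> {-\<lfloor>K\<rfloor>..\<lfloor>K\<rfloor>}"
  proof
    fix n :: int assume n: "n \<in> {n. (real_of_int n)\<^sup>2 \<le> K}"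
    have "\<bar>n\<bar> \<le> n\<^sup>2"
    proof (cases "n = 0")
      case False
      then have "\<bar>n\<bar> * 1 \<le> \<bar>n\<bar> * \<bar>n\<bar>" by (intro mult_left_mono) auto
      then show ?thesis by (simp add: power2_eq_square)
    qed simp
    then have "real_of_int \<bar>n\<bar> \<le> real_of_int (n\<^sup>2)" by (simp only: of_int_le_iff)
    then have "real_of_int \<bar>n\<bar> \<le> K" using n by simp
    then have "\<bar>n\<bar> \<le> \<lfloor>K\<rfloor>" by (simp add: le_floor_iff)
    then show "n \<in> {-\<lfloor>K\<rfloor>..\<lfloor>K\<rfloor>}" by auto
  qed
qed simp

lemma finite_mode_eig_le: "finite {n. \<bar>mode_eig n\<bar> \<le> K}"
proof (rule finite_subset[OF _ finite_int_square_le[of "K / 8"]])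
  show "{n. \<bar>mode_eig n\<bar> \<le> K} \<subseteq> {n. (real_of_int n)\<^sup>2 \<le> K / 8}"
    using order_trans[OF abs_mode_eig_ge] by fastforce
qed

text \<open>Only finitely many unperturbed eigenvalues have modulus at most
  \<open>norm z + 1\<close>, so the positive distances among them have a minimum.\<close>

lemma mode_eig_gap:
  fixes z :: complex
  obtains c where "c > 0" "\<And>n. of_real (mode_eig n) = z \<or> c \<le> norm (of_real (mode_eig n) - z)"
proof -
  let ?S = "{n. \<bar>mode_eig n\<bar> \<le> norm z + 1}"
  \<comment> \<open>The inserted \<open>1\<close> keeps the set nonempty and is the distance
    guaranteed for modes outside \<open>?S\<close>.\<close>
  let ?D = "insert 1 ((\<lambda>n. norm (of_real (mode_eig n) - z)) ` {n \<in> ?S. of_real (mode_eig n) \<noteq> z})"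
  have fin: "finite ?D" using finite_mode_eig_le by simp
  show ?thesis
  proof (rule that[of "Min ?D"])
    show "Min ?D > 0" using fin by (subst Min_gr_iff) auto
    fix n
    show "of_real (mode_eig n) = z \<or> Min ?D \<le> norm (of_real (mode_eig n) - z)"
    proof (cases "n \<in> ?S")
      case True
      then show ?thesis by (cases "of_real (mode_eig n) = z") (use fin in \<open>auto intro!: Min_le\<close>)
    next
      case False
      have "Min ?D \<le> 1" using fin by (intro Min_le) auto
      also have "\<dots> \<le> \<bar>mode_eig n\<bar> - norm z" using False by simp
      also have "\<dots> \<le> norm (of_real (mode_eig n) - z)"
        using norm_triangle_ineq2[of "complex_of_real (mode_eig n)" z] by simp
      finally show ?thesis by simp
    qed
  qed
qed

section \<open>Fourier series on the domain; symmetry, coercivity and solvability\<close>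

lemma summable_on_if_inverse_square_bound:
  fixes a :: "int \<Rightarrow> complex"
  assumes F: "finite F" and le: "\<And>n. n \<notin> F \<Longrightarrow> norm (a n) * (real_of_int n)\<^sup>2 \<le> C"
  shows "(\<lambda>n. norm (a n)) summable_on UNIV"
proof -
  have "(\<lambda>n::int. C * (1 / (of_int n)\<^sup>2)) summable_on UNIV"
    by (intro summable_on_cmult_right summable_on_inverse_int_squares)
  \<comment> \<open>The mode \<open>0\<close> joins the exceptional set, since the bound says
    nothing about \<open>a 0\<close>.\<close>
  then have "(\<lambda>n::int. C * (1 / (of_int n)\<^sup>2)) summable_on (- insert 0 F)"
    by (rule summable_on_subset_banach) simp
  then have "(\<lambda>n. norm (a n)) summable_on (- insert 0 F)"
    by (rule summable_on_comparison_test) (use le in \<open>auto simp: field_simps\<close>)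
  moreover have "(\<lambda>n. norm (a n)) summable_on insert 0 F"
    using F by (intro summable_on_finite) simp
  ultimately have "(\<lambda>n. norm (a n)) summable_on (- insert 0 F \<union> insert 0 F)"
    by (rule summable_on_union)
  then show ?thesis by (simp only: Compl_partition2)
qed

text \<open>The coefficient times \<open>mode_eig n\<close> is a coefficient of
  \<open>A_op y\<close>, hence bounded; quadratic growth then gives summability.\<close>

lemma fourier_series_L_dom:
  assumes y: "y \<in> L_dom"
  shows "((\<lambda>S. \<Sum>n\<in>S. cinner_l2 y (fourier_mode n) *\<^sub>C fourier_mode n) \<longlongrightarrow> y) (finite_subsets_at_top UNIV)"
proof (rule fourier_series, rule summable_on_if_inverse_square_bound[where F="{}"])
  fix n :: int
  have "norm (cinner_l2 y (fourier_mode n)) * (real_of_int n)\<^sup>2 \<le> norm (cinner_l2 y (fourier_mode n)) * \<bar>mode_eig n\<bar>"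
    using abs_mode_eig_ge[of n] by (intro mult_left_mono) (smt (verit) zero_le_power2, simp)
  also have "\<dots> = norm (cinner_l2 (A_op y) (fourier_mode n))"
    using y by (simp add: fourier_coeff_A_op norm_mult)
  also have "\<dots> \<le> norm (A_op y)" by (rule norm_cinner_fourier_le)
  finally show "norm (cinner_l2 y (fourier_mode n)) * (real_of_int n)\<^sup>2 \<le> norm (A_op y)" .
qed simp

text \<open>Partial Fourier sums inserted in either argument give the same finite sum, because
  \<open>mode_eig\<close> is real; the inner product is continuous.\<close>

lemma A_op_symmetric:
  assumes y: "y \<in> L_dom" and w: "w \<in> L_dom"
  shows "cinner_l2 (A_op y) w = cinner_l2 y (A_op w)"
proof -
  let ?F = "finite_subsets_at_top (UNIV :: int set)"
  let ?y = "\<lambda>n. cinner_l2 y (fourier_mode n)" and ?w = "\<lambda>n. cinner_l2 w (fourier_mode n)"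
  have "((\<lambda>S. cinner_l2 (\<Sum>n\<in>S. ?y n *\<^sub>C fourier_mode n) (A_op w)) \<longlongrightarrow> cinner_l2 y (A_op w)) ?F"
    by (rule tendsto_cinner_l2[OF fourier_series_L_dom[OF y]])
  moreover have "((\<lambda>S. cinner_l2 (A_op y) (\<Sum>n\<in>S. ?w n *\<^sub>C fourier_mode n)) \<longlongrightarrow> cinner_l2 (A_op y) w) ?F"
    by (rule tendsto_cinner_l2_right[OF fourier_series_L_dom[OF w]])
  moreover have "cinner_l2 (\<Sum>n\<in>S. ?y n *\<^sub>C fourier_mode n) (A_op w)
      = cinner_l2 (A_op y) (\<Sum>n\<in>S. ?w n *\<^sub>C fourier_mode n)" for S
  proof -
    have "cinner_l2 (\<Sum>n\<in>S. ?y n *\<^sub>C fourier_mode n) (A_op w) = (\<Sum>n\<in>S. ?y n * cnj (cinner_l2 (A_op w) (fourier_mode n)))"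
      by (simp add: cinner_l2_sum cinner_l2_scale cinner_l2_commute[symmetric])
    also have "\<dots> = (\<Sum>n\<in>S. cinner_l2 (A_op y) (fourier_mode n) * cnj (?w n))"
      by (intro sum.cong refl) (simp add: fourier_coeff_A_op y w)
    also have "\<dots> = cnj (\<Sum>n\<in>S. ?w n * cinner_l2 (fourier_mode n) (A_op y))"
      by (simp add: mult.commute cinner_l2_commute[symmetric])
    also have "\<dots> = cnj (cinner_l2 (\<Sum>n\<in>S. ?w n *\<^sub>C fourier_mode n) (A_op y))"
      by (simp add: cinner_l2_sum cinner_l2_scale)
    finally show ?thesis by (simp only: cinner_l2_commute[symmetric])
  qed
  ultimately show ?thesis
    using tendsto_unique[of ?F] by fastforce
qed

text \<open>\<open>S\<close> collects the modes on which \<open>A - z\<close> may be small; off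
  \<open>S\<close> it stretches each coefficient by at least \<open>c\<close>. Bessel's inequality
  bounds the stretched coefficients, and the Fourier series of \<open>y\<close> supplies the limit.
  It serves three choices of \<open>S\<close>: resonant modes, low modes and a single mode.\<close>

lemma A_op_coercive:
  assumes y: "y \<in> L_dom" and S: "finite S" and c: "c \<ge> 0"
    and gap: "\<And>n. n \<notin> S \<Longrightarrow> c \<le> norm (of_real (mode_eig n) - z)"
  shows "c\<^sup>2 * ((norm y)\<^sup>2 - (\<Sum>n\<in>S. (norm (cinner_l2 y (fourier_mode n)))\<^sup>2)) \<le> (norm (A_op y - z *\<^sub>C y))\<^sup>2"
proof -
  let ?F = "finite_subsets_at_top (UNIV :: int set)"
  let ?y = "\<lambda>n. cinner_l2 y (fourier_mode n)"
  have coeff: "cinner_l2 (A_op y - z *\<^sub>C y) (fourier_mode n) = (of_real (mode_eig n) - z) * ?y n" for n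
    by (simp add: cinner_l2_diff cinner_l2_scale fourier_coeff_A_op y algebra_simps)
  have lim: "((\<lambda>T. c\<^sup>2 * ((norm (\<Sum>n\<in>T. ?y n *\<^sub>C fourier_mode n))\<^sup>2 - (\<Sum>n\<in>S. (norm (?y n))\<^sup>2)))
      \<longlongrightarrow> c\<^sup>2 * ((norm y)\<^sup>2 - (\<Sum>n\<in>S. (norm (?y n))\<^sup>2))) ?F"
    by (intro tendsto_intros fourier_series_L_dom y)
  have "\<forall>\<^sub>F T in ?F. finite T \<and> S \<subseteq> T"
    using S by (auto simp: eventually_finite_subsets_at_top intro: exI[of _ S])
  then have "\<forall>\<^sub>F T in ?F. c\<^sup>2 * ((norm (\<Sum>n\<in>T. ?y n *\<^sub>C fourier_mode n))\<^sup>2 - (\<Sum>n\<in>S. (norm (?y n))\<^sup>2))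
      \<le> (norm (A_op y - z *\<^sub>C y))\<^sup>2"
  proof eventually_elim
    case (elim T)
    then have T: "finite T" "S \<subseteq> T" by auto
    have "c\<^sup>2 * ((norm (\<Sum>n\<in>T. ?y n *\<^sub>C fourier_mode n))\<^sup>2 - (\<Sum>n\<in>S. (norm (?y n))\<^sup>2))
        = c\<^sup>2 * ((\<Sum>n\<in>T. (norm (?y n))\<^sup>2) - (\<Sum>n\<in>S. (norm (?y n))\<^sup>2))"
      by (subst norm_orthonormal_sum) (simp_all add: T fourier_mode_orthonormal)
    also have "\<dots> = (\<Sum>n\<in>T - S. c\<^sup>2 * (norm (?y n))\<^sup>2)"
      using T S by (simp add: sum_diff sum_distrib_left right_diff_distrib)
    also have "\<dots> \<le> (\<Sum>n\<in>T - S. (norm (cinner_l2 (A_op y - z *\<^sub>C y) (fourier_mode n)))\<^sup>2)"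
      unfolding coeff norm_mult power_mult_distrib
      by (intro sum_mono mult_right_mono power_mono gap c) auto
    also have "\<dots> \<le> (norm (A_op y - z *\<^sub>C y))\<^sup>2"
      using T by (intro bessel_fourier) simp
    finally show ?case .
  qed
  then show ?thesis by (rule tendsto_upperbound[OF lim]) simp
qed

text \<open>Three integrations, each antiderivative taken with mean zero so that the next one
  exists; \<open>- \<i>\<close> offsets the factor in \<open>A_op\<close>.\<close>

lemma A_op_surj_mean_zero:
  assumes "cinner_l2 g (fourier_mode 0) = 0"
  obtains w where "w \<in> L_dom" "A_op w = g"
proof -
  have "cinner_l2 ((- \<i>) *\<^sub>C g) (fourier_mode 0) = 0" using assms by (simp add: cinner_l2_scale cinner_l2_uminus)
  then obtain y2 where y2: "periodic_deriv y2 ((- \<i>) *\<^sub>C g)" "cinner_l2 y2 (fourier_mode 0) = 0"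
    using periodic_deriv_exists by blast
  then obtain y1 where y1: "periodic_deriv y1 y2" "cinner_l2 y1 (fourier_mode 0) = 0"
    using periodic_deriv_exists by blast
  then obtain y where y: "periodic_deriv y y1" "cinner_l2 y (fourier_mode 0) = 0"
    using periodic_deriv_exists by blast
  show ?thesis
    using L_domI[OF y(1) y1(1) y2(1)] by (intro that[of y]) simp_all
qed

text \<open>Dividing coefficients produces a \<open>y\<close> known only through them. It lies in
  the domain because a solution \<open>w\<close> of \<open>A_op w = f + z *\<^sub>C y\<close>,
  adjusted in the mode \<open>0\<close>, has the same coefficients.\<close>

lemma A_op_solve:
  assumes f: "\<And>n. of_real (mode_eig n) = z \<Longrightarrow> cinner_l2 f (fourier_mode n) = 0"
  obtains y where "y \<in> L_dom" "A_op y - z *\<^sub>C y = f"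
    "\<And>n. of_real (mode_eig n) = z \<Longrightarrow> cinner_l2 y (fourier_mode n) = 0"
proof -
  \<comment> \<open>\<open>a n = 0\<close> when \<open>mode_eig n = z\<close>, as division by zero yields zero.\<close>
  define a where "a = (\<lambda>n. cinner_l2 f (fourier_mode n) / (of_real (mode_eig n) - z))"
  have a: "a n * (of_real (mode_eig n) - z) = cinner_l2 f (fourier_mode n)" for n
    using f[of n] by (cases "of_real (mode_eig n) = z") (simp_all add: a_def)
  have "(\<lambda>n. norm (a n)) summable_on UNIV"
  proof (rule summable_on_if_inverse_square_bound)
    \<comment> \<open>Once \<open>n^2\<close> exceeds \<open>norm z\<close>, the growth
      \<open>8 * n^2\<close> still leaves at least \<open>n^2\<close> after subtracting
      \<open>norm z\<close>.\<close>
    show "finite {n :: int. (real_of_int n)\<^sup>2 \<le> norm z}" by (rule finite_int_square_le)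
    fix n assume "n \<notin> {n :: int. (real_of_int n)\<^sup>2 \<le> norm z}"
    then have "(real_of_int n)\<^sup>2 \<le> \<bar>mode_eig n\<bar> - norm z"
      using abs_mode_eig_ge[of n] by simp
    also have "\<dots> \<le> norm (of_real (mode_eig n) - z)"
      using norm_triangle_ineq2[of "complex_of_real (mode_eig n)" z] by simp
    finally have "norm (a n) * (real_of_int n)\<^sup>2 \<le> norm (a n) * norm (of_real (mode_eig n) - z)"
      by (rule mult_left_mono) simp
    also have "\<dots> = norm (cinner_l2 f (fourier_mode n))" by (simp only: norm_mult[symmetric] a)
    also have "\<dots> \<le> norm f" by (rule norm_cinner_fourier_le)
    finally show "norm (a n) * (real_of_int n)\<^sup>2 \<le> norm f" .
  qed
  then obtain y where y: "\<And>n. cinner_l2 y (fourier_mode n) = a n" using fourier_synthesis by blast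
  have g: "cinner_l2 (f + z *\<^sub>C y) (fourier_mode n) = of_real (mode_eig n) * a n" for n
    using a[of n] by (simp add: cinner_l2_add cinner_l2_scale y algebra_simps)
  then have "cinner_l2 (f + z *\<^sub>C y) (fourier_mode 0) = 0" by (simp add: mode_eig_def)
  then obtain w where w: "w \<in> L_dom" "A_op w = f + z *\<^sub>C y" by (rule A_op_surj_mean_zero)
  \<comment> \<open>The operator annihilates the mode \<open>0\<close>, so the mean can be set to
    \<open>a 0\<close> without changing the image.\<close>
  define w' where "w' = w + (a 0 - cinner_l2 w (fourier_mode 0)) *\<^sub>C fourier_mode 0"
  have Aw': "A_op w' = f + z *\<^sub>C y" and w': "w' \<in> L_dom"
    using w fourier_mode_L_dom[of 0]
    by (simp_all add: w'_def L_dom_add L_dom_cscale mode_eig_def)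
  have "w' = y"
  proof (rule fourier_ext)
    fix n
    show "cinner_l2 w' (fourier_mode n) = cinner_l2 y (fourier_mode n)"
    proof (cases "n = 0")
      case True
      then show ?thesis by (simp add: w'_def y cinner_l2_add cinner_l2_scale fourier_mode_orthonormal)
    next
      case False
      then have "mode_eig n \<noteq> 0" by (simp add: mode_eig_def)
      moreover have "of_real (mode_eig n) * cinner_l2 w' (fourier_mode n) = of_real (mode_eig n) * a n"
        using fourier_coeff_A_op[OF w', of n] unfolding Aw' g by (rule sym)
      ultimately show ?thesis using y[of n] by auto
    qed
  qed
  show ?thesis
  proof (rule that[of y])
    show "y \<in> L_dom" "A_op y - z *\<^sub>C y = f" using w' Aw' \<open>w' = y\<close> by simp_all
    show "cinner_l2 y (fourier_mode n) = 0" if "of_real (mode_eig n) = z" for n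
      using that by (simp add: y a_def)
  qed
qed

text \<open>The solution without resonant components satisfies the coercive bound with the spectral
  gap \<open>c\<close>, which gives \<open>1 / c\<close>.\<close>

lemma A_op_solve_bounded:
  obtains C where "C \<ge> 0"
    "\<And>f. (\<And>n. of_real (mode_eig n) = z \<Longrightarrow> cinner_l2 f (fourier_mode n) = 0) \<Longrightarrow>
      \<exists>y\<in>L_dom. A_op y - z *\<^sub>C y = f \<and> norm y \<le> C * norm f"
proof -
  obtain c where c: "c > 0" "\<And>n. of_real (mode_eig n) = z \<or> c \<le> norm (of_real (mode_eig n) - z)"
    using mode_eig_gap[where z=z] by metis
  let ?S = "{n. complex_of_real (mode_eig n) = z}"
  have "?S \<subseteq> {n. \<bar>mode_eig n\<bar> \<le> norm z}" by auto
  then have S: "finite ?S" using finite_mode_eig_le finite_subset by blast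
  show ?thesis
  proof (rule that[of "1 / c"])
    fix f assume "\<And>n. of_real (mode_eig n) = z \<Longrightarrow> cinner_l2 f (fourier_mode n) = 0"
    then obtain y where y: "y \<in> L_dom" "A_op y - z *\<^sub>C y = f"
      "\<And>n. of_real (mode_eig n) = z \<Longrightarrow> cinner_l2 y (fourier_mode n) = 0"
      using A_op_solve by metis
    have "c\<^sup>2 * ((norm y)\<^sup>2 - (\<Sum>n\<in>?S. (norm (cinner_l2 y (fourier_mode n)))\<^sup>2)) \<le> (norm (A_op y - z *\<^sub>C y))\<^sup>2"
      by (rule A_op_coercive[OF y(1) S]) (use c in \<open>auto simp: less_imp_le\<close>)
    then have "(c * norm y)\<^sup>2 \<le> (norm f)\<^sup>2"
      using y by (simp add: power_mult_distrib)
    then have "c * norm y \<le> norm f" by (rule power2_le_imp_le) simp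
    then have "norm y \<le> 1 / c * norm f" using c by (simp add: field_simps)
    then show "\<exists>y\<in>L_dom. A_op y - z *\<^sub>C y = f \<and> norm y \<le> 1 / c * norm f" using y by blast
  qed (use c in simp)
qed

text \<open>Only coefficients with \<open>mode_eig n = z\<close> survive, and injectivity of
  \<open>mode_eig\<close> leaves a single one.\<close>

lemma A_op_kernel:
  assumes y: "y \<in> L_dom" "A_op y = z *\<^sub>C y" and "y \<noteq> 0"
  obtains n where "of_real (mode_eig n) = z" "y = cinner_l2 y (fourier_mode n) *\<^sub>C fourier_mode n"
proof -
  have coeff: "cinner_l2 y (fourier_mode n) = 0" if "of_real (mode_eig n) \<noteq> z" for n
    using fourier_coeff_A_op[OF y(1), of n] y(2) that by (simp add: cinner_l2_scale)
  obtain n where n: "cinner_l2 y (fourier_mode n) \<noteq> 0"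
    using \<open>y \<noteq> 0\<close> fourier_total by blast
  then have z: "of_real (mode_eig n) = z" using coeff by blast
  have "y = cinner_l2 y (fourier_mode n) *\<^sub>C fourier_mode n"
  proof (rule fourier_ext)
    fix m
    have "cinner_l2 y (fourier_mode m) = 0" if "m \<noteq> n"
      using coeff[of m] mode_eig_inj[of m n] that z by (metis of_real_eq_iff)
    then show "cinner_l2 y (fourier_mode m) = cinner_l2 (cinner_l2 y (fourier_mode n) *\<^sub>C fourier_mode n) (fourier_mode m)"
      by (simp add: cinner_l2_scale fourier_mode_orthonormal)
  qed
  then show ?thesis using that z by blast
qed


section \<open>The rank-one perturbation\<close>

lemma L_op_add: "y \<in> L_dom \<Longrightarrow> w \<in> L_dom \<Longrightarrow> L_op \<alpha> v (y + w) = L_op \<alpha> v y + L_op \<alpha> v w"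
  by (simp add: L_op_eq L_dom_add cinner_l2_add distrib_left l2.scale_left_distrib)

lemma L_op_cscale: "y \<in> L_dom \<Longrightarrow> L_op \<alpha> v (c *\<^sub>C y) = c *\<^sub>C L_op \<alpha> v y"
  by (simp add: L_op_eq L_dom_cscale cinner_l2_scale l2.scale_right_distrib mult_ac)

lemma L_op_diff: "y \<in> L_dom \<Longrightarrow> w \<in> L_dom \<Longrightarrow> L_op \<alpha> v (y - w) = L_op \<alpha> v y - L_op \<alpha> v w"
  by (simp add: L_op_eq L_dom_diff cinner_l2_diff right_diff_distrib l2.scale_left_diff_distrib)

lemma L_op_symmetric:
  assumes "y \<in> L_dom" "w \<in> L_dom"
  shows "cinner_l2 (L_op \<alpha> v y) w = cinner_l2 y (L_op \<alpha> v w)"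
  using A_op_symmetric[OF assms] cinner_l2_commute[of v w]
  by (simp add: L_op_eq cinner_l2_add cinner_l2_add_right cinner_l2_scale cinner_l2_scale_right)

lemma eigenspace_diff_cscale:
  assumes "y \<in> eigenspace L_dom (L_op \<alpha> v) z" "w \<in> eigenspace L_dom (L_op \<alpha> v) z"
  shows "y - c *\<^sub>C w \<in> eigenspace L_dom (L_op \<alpha> v) z"
  using assms unfolding eigenspace_def
  by (simp add: L_dom_diff L_dom_cscale L_op_diff L_op_cscale l2.scale_right_diff_distrib mult.commute)

lemma eigenspace_cscale:
  assumes "y \<in> eigenspace L_dom (L_op \<alpha> v) z"
  shows "c *\<^sub>C y \<in> eigenspace L_dom (L_op \<alpha> v) z"
  using assms unfolding eigenspace_def
  by (simp add: L_dom_cscale L_op_cscale mult.commute)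

lemma eigenspace_normalize:
  assumes "eigenvalue L_dom (L_op \<alpha> v) z"
  obtains u where "u \<in> eigenspace L_dom (L_op \<alpha> v) z" "norm u = 1"
proof -
  obtain y where y: "y \<in> eigenspace L_dom (L_op \<alpha> v) z" "y \<noteq> 0"
    using assms unfolding eigenvalue_def by blast
  show ?thesis
    by (rule that[OF eigenspace_cscale[OF y(1), of "of_real (1 / norm y)"]])
      (use y(2) in \<open>simp only: norm_cscale norm_of_real, simp\<close>)
qed

text \<open>Symmetry compares \<open>z\<close> with \<open>cnj z'\<close>; applied to a nonzero
  \<open>w\<close> alone, it shows that \<open>z'\<close> is real.\<close>

lemma eigenspaces_orthogonal:
  assumes y: "y \<in> eigenspace L_dom (L_op \<alpha> v) z" and w: "w \<in> eigenspace L_dom (L_op \<alpha> v) z'"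
    and "z \<noteq> z'"
  shows "cinner_l2 y w = 0"
proof (cases "w = 0")
  case False
  have eq: "z * cinner_l2 y w = cnj z' * cinner_l2 y w"
    using L_op_symmetric[of y w \<alpha> v] y w by (simp add: eigenspace_def cinner_l2_scale cinner_l2_scale_right)
  have "z' * cinner_l2 w w = cnj z' * cinner_l2 w w"
    using L_op_symmetric[of w w \<alpha> v] w by (simp add: eigenspace_def cinner_l2_scale cinner_l2_scale_right)
  then have "cnj z' = z'" using False by (simp add: cinner_l2_self)
  then show ?thesis using eq \<open>z \<noteq> z'\<close> by simp
qed simp

text \<open>Sherman-Morrison formula: with \<open>(A - z) r = v\<close>, the operator
  \<open>L - z\<close> sends \<open>r\<close> to \<open>F *\<^sub>C v\<close>, so a multiple of
  \<open>r\<close> absorbs the rank-one term.\<close>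

lemma L_op_solve_bounded_generic:
  assumes z: "\<And>n. of_real (mode_eig n) \<noteq> z" and ne: "\<not> eigenvalue L_dom (L_op \<alpha> v) z"
  obtains C where "\<And>f. \<exists>y\<in>L_dom. L_op \<alpha> v y - z *\<^sub>C y = f \<and> norm y \<le> C * norm f"
proof -
  obtain C0 where C0: "C0 \<ge> 0" "\<And>f. \<exists>y\<in>L_dom. A_op y - z *\<^sub>C y = f \<and> norm y \<le> C0 * norm f"
    using A_op_solve_bounded[of z] z by metis
  obtain r where r: "r \<in> L_dom" "A_op r - z *\<^sub>C r = v" using C0(2)[of v] by blast
  let ?a = "complex_of_real \<alpha>"
  define F where "F = 1 + ?a * cinner_l2 r v"
  have Lr: "L_op \<alpha> v r - z *\<^sub>C r = F *\<^sub>C v"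
    using r(2) by (simp add: L_op_eq F_def l2.scale_left_distrib algebra_simps)
  \<comment> \<open>If \<open>F\<close> vanished, \<open>r\<close> would lie in the eigenspace and
    hence be zero, which gives \<open>F = 1\<close>.\<close>
  have "F \<noteq> 0"
  proof
    assume F: "F = 0"
    then have "r \<in> eigenspace L_dom (L_op \<alpha> v) z" using Lr r(1) by (simp add: eigenspace_def)
    then have "r = 0" using ne by (auto simp: eigenvalue_def)
    then show False using F by (simp add: F_def)
  qed
  show ?thesis
  proof (rule that)
    fix f
    obtain y0 where y0: "y0 \<in> L_dom" "A_op y0 - z *\<^sub>C y0 = f" "norm y0 \<le> C0 * norm f"
      using C0(2)[of f] by blast
    define t where "t = - ?a * cinner_l2 y0 v / F"
    let ?y = "y0 + t *\<^sub>C r"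
    have y: "?y \<in> L_dom" using y0(1) r(1) by (simp add: L_dom_add L_dom_cscale)
    have "L_op \<alpha> v ?y - z *\<^sub>C ?y = (L_op \<alpha> v y0 - z *\<^sub>C y0) + t *\<^sub>C (L_op \<alpha> v r - z *\<^sub>C r)"
      using y0(1) r(1) by (simp add: L_op_add L_op_cscale L_dom_cscale l2.scale_right_distrib
          l2.scale_right_diff_distrib mult.commute)
    also have "\<dots> = f + (?a * cinner_l2 y0 v) *\<^sub>C v + (t * F) *\<^sub>C v"
      unfolding Lr using y0(2) by (simp add: L_op_eq algebra_simps)
    also have "\<dots> = f"
      using \<open>F \<noteq> 0\<close> by (simp add: t_def)
    finally have eq: "L_op \<alpha> v ?y - z *\<^sub>C ?y = f" .
    have "norm t \<le> \<bar>\<alpha>\<bar> * (C0 * norm f * norm v) / norm F"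
      unfolding t_def norm_divide norm_mult norm_minus_cancel norm_of_real
      by (intro divide_right_mono mult_left_mono order_trans[OF norm_cinner_l2_le] mult_right_mono y0(3)) auto
    then have "norm ?y \<le> C0 * norm f + \<bar>\<alpha>\<bar> * (C0 * norm f * norm v) / norm F * norm r"
      by (intro order_trans[OF norm_triangle_ineq] add_mono y0(3)) (simp only: norm_cscale mult_right_mono norm_ge_zero)
    also have "\<dots> = (C0 + \<bar>\<alpha>\<bar> * C0 * norm v / norm F * norm r) * norm f"
      by (simp add: algebra_simps)
    finally show "\<exists>y\<in>L_dom. L_op \<alpha> v y - z *\<^sub>C y = f \<and>
        norm y \<le> (C0 + \<bar>\<alpha>\<bar> * C0 * norm v / norm F * norm r) * norm f"
      using y eq by blast
  qed
qed

text \<open>At an unperturbed eigenvalue that is not one of the perturbed operator, \<open>v\<close> has a component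
  along the mode; subtracting a multiple of \<open>v\<close> makes the right-hand side orthogonal to the mode,
  and a multiple of the mode is added to the solution to restore it.\<close>

lemma L_op_solve_bounded_mode:
  assumes ne: "\<not> eigenvalue L_dom (L_op \<alpha> v) (of_real (mode_eig m))"
  obtains C where "\<And>f. \<exists>y\<in>L_dom. L_op \<alpha> v y - of_real (mode_eig m) *\<^sub>C y = f \<and> norm y \<le> C * norm f"
proof -
  let ?a = "complex_of_real \<alpha>" and ?e = "fourier_mode m"
  define z where "z = complex_of_real (mode_eig m)"
  define p where "p = cinner_l2 ?e v"
  have e0: "?e \<noteq> 0" using norm_fourier_mode[of m] by (metis norm_zero zero_neq_one)
  have Le: "L_op \<alpha> v ?e - z *\<^sub>C ?e = (?a * p) *\<^sub>C v"
    by (simp add: L_op_eq fourier_mode_L_dom p_def z_def)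
  \<comment> \<open>Otherwise the mode itself would be an eigenvector of the perturbed
    operator.\<close>
  have "?a * p \<noteq> 0"
  proof
    assume "?a * p = 0"
    then have "L_op \<alpha> v ?e - z *\<^sub>C ?e = 0" unfolding Le by (simp only: l2.scale_zero_left)
    then have "?e \<in> eigenspace L_dom (L_op \<alpha> v) z"
      by (simp add: eigenspace_def fourier_mode_L_dom)
    then show False using ne e0 by (auto simp: eigenvalue_def z_def)
  qed
  then have a0: "\<alpha> \<noteq> 0" and p0: "p \<noteq> 0" by auto
  have vp: "cinner_l2 v ?e = cnj p" unfolding p_def by (rule cinner_l2_commute)
  obtain C0 where C0: "C0 \<ge> 0" "\<And>f. cinner_l2 f ?e = 0 \<Longrightarrow>
      \<exists>y\<in>L_dom. A_op y - z *\<^sub>C y = f \<and> norm y \<le> C0 * norm f"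
    using A_op_solve_bounded[of z] mode_eig_inj unfolding z_def by (metis of_real_eq_iff)
  define K where "K = C0 * (1 + norm v / norm p)"
  show ?thesis
  proof (rule that)
    fix f
    define b where "b = cinner_l2 f ?e / cnj p"
    have nb: "norm b \<le> norm f / norm p"
      unfolding b_def norm_divide complex_mod_cnj
      by (intro divide_right_mono norm_cinner_fourier_le) simp
    have "cinner_l2 (f - b *\<^sub>C v) ?e = 0"
      using p0 by (simp add: cinner_l2_diff cinner_l2_scale vp b_def)
    then obtain y0 where y0: "y0 \<in> L_dom" "A_op y0 - z *\<^sub>C y0 = f - b *\<^sub>C v" "norm y0 \<le> C0 * norm (f - b *\<^sub>C v)"
      using C0(2) by blast
    have "norm (f - b *\<^sub>C v) \<le> norm f + norm f / norm p * norm v"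
      by (intro order_trans[OF norm_triangle_ineq4] add_mono) (simp_all only: norm_cscale order_refl mult_right_mono[OF nb] norm_ge_zero)
    then have "norm y0 \<le> C0 * (norm f + norm f / norm p * norm v)"
      using y0(3) C0(1) by (meson mult_left_mono order_trans)
    then have ny0: "norm y0 \<le> K * norm f" by (simp add: K_def algebra_simps)
    \<comment> \<open>Solves the balance of all terms along \<open>v\<close>, namely
      \<open>- b + \<alpha> * (cinner_l2 y0 v + t * p) = 0\<close>.\<close>
    define t where "t = (b / ?a - cinner_l2 y0 v) / p"
    let ?y = "y0 + t *\<^sub>C ?e"
    have y: "?y \<in> L_dom" using y0(1) by (simp add: L_dom_add L_dom_cscale fourier_mode_L_dom)
    have "L_op \<alpha> v ?y - z *\<^sub>C ?y = (L_op \<alpha> v y0 - z *\<^sub>C y0) + t *\<^sub>C (L_op \<alpha> v ?e - z *\<^sub>C ?e)"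
      using y0(1) by (simp add: L_op_add L_op_cscale L_dom_cscale fourier_mode_L_dom l2.scale_right_distrib
          l2.scale_right_diff_distrib mult.commute)
    also have "\<dots> = f - b *\<^sub>C v + (?a * cinner_l2 y0 v) *\<^sub>C v + (t * (?a * p)) *\<^sub>C v"
      unfolding Le y0(2)[symmetric] by (simp add: L_op_eq algebra_simps)
    also have "\<dots> = f + (- b + ?a * cinner_l2 y0 v + t * (?a * p)) *\<^sub>C v"
      by (simp only: l2.scale_left_distrib l2.scale_minus_left) (simp add: algebra_simps)
    also have "- b + ?a * cinner_l2 y0 v + t * (?a * p) = 0"
      using a0 p0 by (simp add: t_def field_simps)
    finally have eq: "L_op \<alpha> v ?y - z *\<^sub>C ?y = f" by simp
    have "norm (b / ?a - cinner_l2 y0 v) \<le> norm f / norm p / \<bar>\<alpha>\<bar> + K * norm f * norm v"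
      by (intro order_trans[OF norm_triangle_ineq4] add_mono order_trans[OF norm_cinner_l2_le] mult_right_mono ny0)
        (simp_all only: norm_divide norm_of_real divide_right_mono[OF nb] abs_ge_zero norm_ge_zero)
    then have "norm t \<le> (norm f / norm p / \<bar>\<alpha>\<bar> + K * norm f * norm v) / norm p"
      unfolding t_def norm_divide by (rule divide_right_mono) simp
    then have "norm ?y \<le> K * norm f + (norm f / norm p / \<bar>\<alpha>\<bar> + K * norm f * norm v) / norm p"
      by (intro order_trans[OF norm_triangle_ineq] add_mono ny0) (simp add: norm_cscale)
    also have "\<dots> = (K + (1 / norm p / \<bar>\<alpha>\<bar> + K * norm v) / norm p) * norm f"
      by (simp add: algebra_simps add_divide_distrib)
    finally show "\<exists>y\<in>L_dom. L_op \<alpha> v y - of_real (mode_eig m) *\<^sub>C y = f \<and>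
        norm y \<le> (K + (1 / norm p / \<bar>\<alpha>\<bar> + K * norm v) / norm p) * norm f"
      using y eq unfolding z_def by blast
  qed
qed

text \<open>Away from eigenvalues every right-hand side has a solution with a bound; injectivity
  makes it the only solution, so the bound becomes the resolvent estimate.\<close>

lemma spectrum_imp_eigenvalue:
  assumes "z \<in> spectrum L_dom (L_op \<alpha> v)"
  shows "eigenvalue L_dom (L_op \<alpha> v) z"
proof (rule ccontr)
  assume ne: "\<not> eigenvalue L_dom (L_op \<alpha> v) z"
  let ?T = "\<lambda>y. L_op \<alpha> v y - z *\<^sub>C y"
  obtain C where C: "\<And>f. \<exists>y\<in>L_dom. ?T y = f \<and> norm y \<le> C * norm f"
  proof (cases "\<exists>m. of_real (mode_eig m) = z")
    case True
    then obtain m where m: "of_real (mode_eig m) = z" by blast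
    show ?thesis using L_op_solve_bounded_mode[of \<alpha> v m] ne that unfolding m by blast
  next
    case False
    then show ?thesis using L_op_solve_bounded_generic[of z \<alpha> v] ne that by blast
  qed
  have inj: "y = w" if "y \<in> L_dom" "w \<in> L_dom" "?T y = ?T w" for y w
  proof -
    have "y - w \<in> eigenspace L_dom (L_op \<alpha> v) z"
      using that by (simp add: eigenspace_def L_dom_diff L_op_diff l2.scale_right_diff_distrib algebra_simps)
    then have "y - w = 0" using ne unfolding eigenvalue_def by blast
    then show ?thesis by simp
  qed
  have "bij_betw ?T L_dom UNIV"
    unfolding bij_betw_def
  proof
    show "inj_on ?T L_dom" using inj by (auto simp: inj_on_def)
    show "?T ` L_dom = UNIV" using C by (metis (no_types, lifting) UNIV_eq_I imageI)
  qed
  moreover have "norm y \<le> C * norm (?T y)" if "y \<in> L_dom" for y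
    using C[of "?T y"] inj that by blast
  ultimately have "z \<in> resolvent_set L_dom (L_op \<alpha> v)" unfolding resolvent_set_def by blast
  then show False using assms by (simp add: spectrum_def)
qed

text \<open>On an eigenvector \<open>A - z\<close> is minus the rank-one term; so eigenvectors of
  \<open>L\<close> are approximate eigenvectors of \<open>A\<close>, with an error bound independent
  of \<open>z\<close>.\<close>

lemma norm_A_op_eigenvector_le:
  assumes "y \<in> eigenspace L_dom (L_op \<alpha> v) z"
  shows "norm (A_op y - z *\<^sub>C y) \<le> \<bar>\<alpha>\<bar> * (norm v)\<^sup>2 * norm y"
proof -
  have "A_op y - z *\<^sub>C y = - ((of_real \<alpha> * cinner_l2 y v) *\<^sub>C v)"
    using assms by (simp add: eigenspace_def L_op_eq algebra_simps)
  then have "norm (A_op y - z *\<^sub>C y) = \<bar>\<alpha>\<bar> * (norm (cinner_l2 y v) * norm v)"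
    by (simp add: norm_cscale norm_mult)
  also have "\<dots> \<le> \<bar>\<alpha>\<bar> * ((norm y * norm v) * norm v)"
    by (intro mult_left_mono mult_right_mono norm_cinner_l2_le) auto
  finally show ?thesis by (simp add: power2_eq_square mult_ac)
qed

text \<open>Normalized eigenvectors for eigenvalues of modulus at most \<open>R\<close> carry at least three quarters of
  their mass on a fixed finite set of modes, whereas by Bessel's inequality an orthonormal family
  puts a total mass of at most one on each mode.\<close>

lemma finite_bounded_eigenvalues:
  "finite {z. eigenvalue L_dom (L_op \<alpha> v) z \<and> norm z \<le> R}"
proof (rule ccontr)
  assume inf: "infinite {z. eigenvalue L_dom (L_op \<alpha> v) z \<and> norm z \<le> R}"
  \<comment> \<open>Bounds \<open>A_op\<close> on every unit eigenvector whose eigenvalue has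
    modulus at most \<open>R\<close>.\<close>
  define R' where "R' = \<bar>R\<bar> + \<bar>\<alpha>\<bar> * (norm v)\<^sup>2"
  have R': "R' \<ge> 0" by (simp add: R'_def)
  \<comment> \<open>Off \<open>S\<close> the operator stretches by at least
    \<open>2 * R' + 1\<close>, so the mass there is at most
    \<open>(R' / (2 * R' + 1))^2 \<le> 1 / 4\<close>; the \<open>1\<close> keeps the denominator
    positive.\<close>
  define S where "S = {n. \<bar>mode_eig n\<bar> \<le> 2 * R' + 1}"
  have S: "finite S" unfolding S_def by (rule finite_mode_eig_le)
  \<comment> \<open>So many eigenvectors need a mass of \<open>3 / 4 * (2 * card S + 1)\<close> on
    \<open>S\<close>, more than the available \<open>card S\<close>.\<close>
  obtain T where T: "finite T" "card T = 2 * card S + 1"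
    "T \<subseteq> {z. eigenvalue L_dom (L_op \<alpha> v) z \<and> norm z \<le> R}"
    using infinite_arbitrarily_large[OF inf] by metis
  have "\<exists>u. \<forall>z\<in>T. u z \<in> eigenspace L_dom (L_op \<alpha> v) z \<and> norm (u z) = 1"
    by (intro bchoice ballI) (use T(3) eigenspace_normalize in blast)
  then obtain u where u: "\<And>z. z \<in> T \<Longrightarrow> u z \<in> eigenspace L_dom (L_op \<alpha> v) z" "\<And>z. z \<in> T \<Longrightarrow> norm (u z) = 1"
    by metis
  have orth: "cinner_l2 (u z) (u w) = (if z = w then 1 else 0)" if "z \<in> T" "w \<in> T" for z w
    using that u eigenspaces_orthogonal[of "u z" \<alpha> v z "u w" w] by (auto simp: cinner_l2_self)
  have mass: "3 / 4 \<le> (\<Sum>n\<in>S. (norm (cinner_l2 (u z) (fourier_mode n)))\<^sup>2)" if z: "z \<in> T" for z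
  proof -
    have ud: "u z \<in> L_dom" using u(1)[OF z] by (simp add: eigenspace_def)
    have "norm (A_op (u z)) \<le> norm (A_op (u z) - z *\<^sub>C u z) + norm (z *\<^sub>C u z)"
      using norm_triangle_sub[of "A_op (u z)" "z *\<^sub>C u z"] by simp
    also have "\<dots> \<le> \<bar>\<alpha>\<bar> * (norm v)\<^sup>2 + \<bar>R\<bar>"
      using norm_A_op_eigenvector_le[OF u(1)[OF z]] u(2)[OF z] T(3) z
      by (intro add_mono) (auto simp: norm_cscale)
    finally have A: "norm (A_op (u z)) \<le> R'" by (simp add: R'_def)
    \<comment> \<open>Coercivity is taken at \<open>0\<close> instead of \<open>z\<close>, so that
      one \<open>S\<close> serves all eigenvalues in the disc.\<close>
    have "(2 * R' + 1)\<^sup>2 * ((norm (u z))\<^sup>2 - (\<Sum>n\<in>S. (norm (cinner_l2 (u z) (fourier_mode n)))\<^sup>2))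
        \<le> (norm (A_op (u z) - 0 *\<^sub>C u z))\<^sup>2"
      by (rule A_op_coercive[OF ud S]) (use R' in \<open>auto simp: S_def\<close>)
    also have "\<dots> \<le> R'\<^sup>2" using A by (simp add: power_mono)
    also have "\<dots> \<le> (2 * R' + 1)\<^sup>2 * (1 / 4)"
      using R' by (simp add: power2_eq_square algebra_simps)
    finally have "(norm (u z))\<^sup>2 - (\<Sum>n\<in>S. (norm (cinner_l2 (u z) (fourier_mode n)))\<^sup>2) \<le> 1 / 4"
      using R' by (subst (asm) mult_le_cancel_left_pos) auto
    then show ?thesis using u(2)[OF z] by simp
  qed
  have "3 / 4 * real (card T) = (\<Sum>z\<in>T. 3 / 4)" by simp
  also have "\<dots> \<le> (\<Sum>z\<in>T. \<Sum>n\<in>S. (norm (cinner_l2 (u z) (fourier_mode n)))\<^sup>2)"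
    by (intro sum_mono mass)
  also have "\<dots> = (\<Sum>n\<in>S. \<Sum>z\<in>T. (norm (cinner_l2 (u z) (fourier_mode n)))\<^sup>2)"
    by (rule sum.swap)
  also have "\<dots> \<le> (\<Sum>n\<in>S. 1)"
  proof (rule sum_mono)
    fix n
    have "(\<Sum>z\<in>T. (norm (cinner_l2 (u z) (fourier_mode n)))\<^sup>2) = (\<Sum>z\<in>T. (norm (cinner_l2 (fourier_mode n) (u z)))\<^sup>2)"
      by (intro sum.cong refl) (metis cinner_l2_commute complex_mod_cnj)
    also have "\<dots> \<le> (norm (fourier_mode n))\<^sup>2"
      by (rule bessel[OF T(1)]) (rule orth)
    finally show "(\<Sum>z\<in>T. (norm (cinner_l2 (u z) (fourier_mode n)))\<^sup>2) \<le> 1" by simp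
  qed
  finally have "3 / 4 * real (card T) \<le> real (card S)" by simp
  then show False using T(2) by simp
qed

section \<open>Structure and dimension of the eigenspaces\<close>

lemma eigenspace_kernel_part:
  assumes y: "y \<in> eigenspace L_dom (L_op \<alpha> v) z" "cinner_l2 y v = 0" "y \<noteq> 0"
  obtains n where "of_real (mode_eig n) = z" "y = cinner_l2 y (fourier_mode n) *\<^sub>C fourier_mode n"
    "fourier_mode n \<in> eigenspace L_dom (L_op \<alpha> v) z"
proof -
  have "y \<in> L_dom" "A_op y = z *\<^sub>C y" using y by (auto simp: eigenspace_def L_op_eq)
  then obtain n where n: "of_real (mode_eig n) = z" "y = cinner_l2 y (fourier_mode n) *\<^sub>C fourier_mode n"
    using A_op_kernel y(3) by metis
  have c: "cinner_l2 y (fourier_mode n) \<noteq> 0" using n(2) y(3) by (metis l2.scale_zero_left)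
  have "(1 / cinner_l2 y (fourier_mode n)) *\<^sub>C y = fourier_mode n"
    using c by (subst n(2)) simp
  then have "fourier_mode n \<in> eigenspace L_dom (L_op \<alpha> v) z"
    using eigenspace_cscale[OF y(1)] by metis
  then show ?thesis using n that by blast
qed

text \<open>\<open>N\<close> spans the eigenvectors orthogonal to \<open>v\<close>; a single
  eigenvector \<open>y\<close> not orthogonal to \<open>v\<close> reduces all others to these. The
  last alternative records what a second generator entails: a mode orthogonal to \<open>v\<close>
  and such a \<open>y\<close> at the same eigenvalue.\<close>

lemma eigenspace_span:
  obtains W where "finite W" "card W \<le> 2" "eigenspace L_dom (L_op \<alpha> v) z \<subseteq> l2.span W"
    "card W \<le> 1 \<or> (\<exists>n. \<exists>y\<in>eigenspace L_dom (L_op \<alpha> v) z. of_real (mode_eig n) = z \<and>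
      fourier_mode n \<in> eigenspace L_dom (L_op \<alpha> v) z \<and> cinner_l2 (fourier_mode n) v = 0 \<and> cinner_l2 y v \<noteq> 0)"
proof -
  let ?E = "eigenspace L_dom (L_op \<alpha> v) z"
  obtain N where N: "finite N" "card N \<le> 1" "\<And>y. y \<in> ?E \<Longrightarrow> cinner_l2 y v = 0 \<Longrightarrow> y \<in> l2.span N"
    "N = {} \<or> (\<exists>n. of_real (mode_eig n) = z \<and> fourier_mode n \<in> ?E \<and> cinner_l2 (fourier_mode n) v = 0)"
  proof (cases "\<exists>y\<in>?E. cinner_l2 y v = 0 \<and> y \<noteq> 0")
    case True
    then obtain y where y: "y \<in> ?E" "cinner_l2 y v = 0" "y \<noteq> 0" by blast
    obtain n where n: "of_real (mode_eig n) = z" "y = cinner_l2 y (fourier_mode n) *\<^sub>C fourier_mode n"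
      "fourier_mode n \<in> ?E"
      by (rule eigenspace_kernel_part[OF y])
    have "cinner_l2 y v = cinner_l2 y (fourier_mode n) * cinner_l2 (fourier_mode n) v"
      by (subst n(2)) (rule cinner_l2_scale)
    moreover have "cinner_l2 y (fourier_mode n) \<noteq> 0" using n(2) y(3) by (metis l2.scale_zero_left)
    ultimately have nv: "cinner_l2 (fourier_mode n) v = 0" using y(2) by simp
    have "x \<in> l2.span {fourier_mode n}" if x: "x \<in> ?E" "cinner_l2 x v = 0" for x
    proof (cases "x = 0")
      case False
      obtain m where m: "of_real (mode_eig m) = z" "x = cinner_l2 x (fourier_mode m) *\<^sub>C fourier_mode m"
        by (rule eigenspace_kernel_part[OF x False])
      have "m = n" using m(1) n(1) mode_eig_inj by (metis of_real_eq_iff)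
      then show ?thesis
        by (subst m(2)) (simp add: l2.span_scale l2.span_base)
    qed (simp add: l2.span_zero)
    then show ?thesis using n nv by (intro that[of "{fourier_mode n}"]) auto
  next
    case False
    then show ?thesis by (intro that[of "{}"]) (auto simp: l2.span_zero)
  qed
  show ?thesis
  proof (cases "\<exists>y\<in>?E. cinner_l2 y v \<noteq> 0")
    case True
    then obtain y where y: "y \<in> ?E" "cinner_l2 y v \<noteq> 0" by blast
    have "x \<in> l2.span (insert y N)" if x: "x \<in> ?E" for x
    proof -
      let ?c = "cinner_l2 x v / cinner_l2 y v"
      have "x - ?c *\<^sub>C y \<in> l2.span N"
        using y(2) by (intro N(3) eigenspace_diff_cscale x y(1)) (simp add: cinner_l2_diff cinner_l2_scale)
      then show ?thesis by (auto simp: l2.span_insert)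
    qed
    moreover have "card (insert y N) \<le> 2" using N(1,2) by (simp add: card_insert_if)
    moreover have "card (insert y N) \<le> 1 \<or> (\<exists>n. of_real (mode_eig n) = z \<and> fourier_mode n \<in> ?E \<and>
        cinner_l2 (fourier_mode n) v = 0)"
      using N(4) by auto
    ultimately show ?thesis using y N(1) by (intro that[of "insert y N"]) blast+
  next
    case False
    then show ?thesis using N by (intro that[of N]) auto
  qed
qed

lemma eig_multiplicity_le_card:
  assumes "finite W" "eigenspace D A z \<subseteq> l2.span W"
  shows "eig_multiplicity D A z \<le> enat (card W)"
  using assms l2.dim_le_card[OF assms(2,1)] unfolding eig_multiplicity_def by auto

lemma eig_multiplicity_le_2: "eig_multiplicity L_dom (L_op \<alpha> v) z \<le> 2"
proof -
  obtain W where W: "finite W" "card W \<le> 2" "eigenspace L_dom (L_op \<alpha> v) z \<subseteq> l2.span W"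
    by (rule eigenspace_span[of \<alpha> v z]) blast
  have "eig_multiplicity L_dom (L_op \<alpha> v) z \<le> enat (card W)" by (rule eig_multiplicity_le_card[OF W(1,3)])
  also have "\<dots> \<le> 2" using W(2) by (simp add: numeral_eq_enat)
  finally show ?thesis .
qed

lemma double_eigenvalue_bound:
  assumes "eig_multiplicity L_dom (L_op \<alpha> v) z = 2"
  obtains n where "of_real (mode_eig n) = z" "3 / 4 * (real_of_int n)\<^sup>2 \<le> \<bar>\<alpha>\<bar> * (norm v)\<^sup>2"
proof -
  let ?E = "eigenspace L_dom (L_op \<alpha> v) z"
  obtain W where W: "finite W" "?E \<subseteq> l2.span W"
    "card W \<le> 1 \<or> (\<exists>n. \<exists>y\<in>?E. of_real (mode_eig n) = z \<and>
      fourier_mode n \<in> ?E \<and> cinner_l2 (fourier_mode n) v = 0 \<and> cinner_l2 y v \<noteq> 0)"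
    by (rule eigenspace_span[of \<alpha> v z]) blast
  have "\<not> card W \<le> 1"
    using eig_multiplicity_le_card[OF W(1,2)] assms by (simp add: numeral_eq_enat)
  then obtain n y where n: "y \<in> ?E" "of_real (mode_eig n) = z" "fourier_mode n \<in> ?E"
    "cinner_l2 (fourier_mode n) v = 0" "cinner_l2 y v \<noteq> 0"
    using W(3) by blast
  \<comment> \<open>Removing the mode leaves the pairing with \<open>v\<close> unchanged, so
    \<open>w\<close> is nonzero.\<close>
  define w where "w = y - cinner_l2 y (fourier_mode n) *\<^sub>C fourier_mode n"
  have w: "w \<in> ?E" unfolding w_def by (rule eigenspace_diff_cscale[OF n(1,3)])
  have "cinner_l2 w v \<noteq> 0" using n(4,5) by (simp add: w_def cinner_l2_diff cinner_l2_scale)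
  then have w0: "norm w > 0" by auto
  have wn: "cinner_l2 w (fourier_mode n) = 0"
    by (simp add: w_def cinner_l2_diff cinner_l2_scale fourier_mode_orthonormal)
  let ?c = "3 / 4 * (real_of_int n)\<^sup>2"
  have "?c\<^sup>2 * ((norm w)\<^sup>2 - (\<Sum>m\<in>{n}. (norm (cinner_l2 w (fourier_mode m)))\<^sup>2)) \<le> (norm (A_op w - z *\<^sub>C w))\<^sup>2"
  proof (rule A_op_coercive)
    fix m assume "m \<notin> {n}"
    then have "?c \<le> \<bar>mode_eig m - mode_eig n\<bar>" by (intro mode_eig_diff_ge) simp
    then show "?c \<le> norm (of_real (mode_eig m) - z)"
      unfolding n(2)[symmetric] of_real_diff[symmetric] norm_of_real .
  qed (use w in \<open>auto simp: eigenspace_def\<close>)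
  then have "(?c * norm w)\<^sup>2 \<le> (norm (A_op w - z *\<^sub>C w))\<^sup>2"
    unfolding power_mult_distrib[of ?c "norm w"] by (simp add: wn)
  then have "?c * norm w \<le> norm (A_op w - z *\<^sub>C w)" by (rule power2_le_imp_le) (rule norm_ge_zero)
  also have "\<dots> \<le> \<bar>\<alpha>\<bar> * (norm v)\<^sup>2 * norm w" by (rule norm_A_op_eigenvector_le[OF w])
  finally have "?c \<le> \<bar>\<alpha>\<bar> * (norm v)\<^sup>2" using w0 by (rule mult_right_le_imp_le)
  then show ?thesis using n(2) that by blast
qed

theorem theorem4p5:
  fixes \<alpha> :: real and v :: l2
  shows "discrete_spectrum L_dom (L_op \<alpha> v) \<and>
    (\<forall>z. eigenvalue L_dom (L_op \<alpha> v) z \<longrightarrow> eig_multiplicity L_dom (L_op \<alpha> v) z \<le> 2) \<and>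
    finite {z. eigenvalue L_dom (L_op \<alpha> v) z \<and> eig_multiplicity L_dom (L_op \<alpha> v) z = 2}"
proof (intro conjI allI impI)
  show "discrete_spectrum L_dom (L_op \<alpha> v)"
    unfolding discrete_spectrum_def
  proof (intro conjI allI ballI notI)
    fix z
    assume "z islimpt spectrum L_dom (L_op \<alpha> v)"
    \<comment> \<open>A limit point would force infinitely many eigenvalues into one disc.\<close>
    then have "infinite (spectrum L_dom (L_op \<alpha> v) \<inter> ball z 1)"
      by (simp add: islimpt_eq_infinite_ball)
    moreover have "spectrum L_dom (L_op \<alpha> v) \<inter> ball z 1 \<subseteq> {w. eigenvalue L_dom (L_op \<alpha> v) w \<and> norm w \<le> norm z + 1}"
    proof
      fix w assume w: "w \<in> spectrum L_dom (L_op \<alpha> v) \<inter> ball z 1"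
      then have "norm (w - z) < 1" by (simp add: dist_norm norm_minus_commute)
      then have "norm w \<le> norm z + 1" using norm_triangle_sub[of w z] by linarith
      then show "w \<in> {w. eigenvalue L_dom (L_op \<alpha> v) w \<and> norm w \<le> norm z + 1}"
        using w spectrum_imp_eigenvalue by blast
    qed
    ultimately show False using finite_bounded_eigenvalues finite_subset by blast
  next
    fix z assume "z \<in> spectrum L_dom (L_op \<alpha> v)"
    then show "eigenvalue L_dom (L_op \<alpha> v) z" by (rule spectrum_imp_eigenvalue)
    have "eig_multiplicity L_dom (L_op \<alpha> v) z \<le> 2" by (rule eig_multiplicity_le_2)
    also have "(2::enat) < \<infinity>" by (simp add: numeral_eq_enat)
    finally show "eig_multiplicity L_dom (L_op \<alpha> v) z < \<infinity>" .
  qed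
  show "eig_multiplicity L_dom (L_op \<alpha> v) z \<le> 2" for z by (rule eig_multiplicity_le_2)
  show "finite {z. eigenvalue L_dom (L_op \<alpha> v) z \<and> eig_multiplicity L_dom (L_op \<alpha> v) z = 2}"
  proof (rule finite_subset)
    show "finite ((\<lambda>n. complex_of_real (mode_eig n)) ` {n. (real_of_int n)\<^sup>2 \<le> 4 / 3 * (\<bar>\<alpha>\<bar> * (norm v)\<^sup>2)})"
      by (intro finite_imageI finite_int_square_le)
    show "{z. eigenvalue L_dom (L_op \<alpha> v) z \<and> eig_multiplicity L_dom (L_op \<alpha> v) z = 2}
        \<subseteq> (\<lambda>n. complex_of_real (mode_eig n)) ` {n. (real_of_int n)\<^sup>2 \<le> 4 / 3 * (\<bar>\<alpha>\<bar> * (norm v)\<^sup>2)}"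
    proof
      fix z assume "z \<in> {z. eigenvalue L_dom (L_op \<alpha> v) z \<and> eig_multiplicity L_dom (L_op \<alpha> v) z = 2}"
      then obtain n where n: "of_real (mode_eig n) = z" "3 / 4 * (real_of_int n)\<^sup>2 \<le> \<bar>\<alpha>\<bar> * (norm v)\<^sup>2"
        using double_eigenvalue_bound by blast
      then have "(real_of_int n)\<^sup>2 \<le> 4 / 3 * (\<bar>\<alpha>\<bar> * (norm v)\<^sup>2)" by simp
      then show "z \<in> (\<lambda>n. complex_of_real (mode_eig n)) ` {n. (real_of_int n)\<^sup>2 \<le> 4 / 3 * (\<bar>\<alpha>\<bar> * (norm v)\<^sup>2)}"
        using n(1) by blast
    qed
  qed
qed

end
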